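(* Let $p\in[1,\infty)$ and $d:= \log 4/ \log 3$. Let $\Omega\subset\mathbb{R}^2$ be the snowflake domain. (i) The characteristic function ${\bf 1}_\Omega$ belongs to $B^{(2-d)/p,\,d/(2p)}_{p,\infty} (\mathbb{R}^2)$. (ii) Let $q\in[1,\infty]$, $\tau\in(0, \frac{d}{2p}]$, and $0 < s < \min\{\frac 1p ,\, 2 (\frac 1p - \tau)\}$. Then ${\bf 1}_\Omega$ belongs to $F^{s, \tau}_{p,q} (\mathbb{R}^2)$ if and only if $s< (2-d) /p$.
   Context: Snowflake domain: start with an equilateral triangle. Subdivide each side into three equal parts, remove the middle part and replace it by the two other sides of the equilateral triangle erected outward on it, so that each side is replaced by four segments of one third of its length; iterate this procedure on all segments. The limit curve is the von Koch curve, and the snowflake domain $\Omega$ is the bounded domain whose boundary $\partial\Omega$ is this curve. Dyadic cubes: for $j\in\mathbb{Z}$, $k\in\mathbb{Z}^n$ let $Q_{j,k}:=2^{-j}([0,1)^n+k)$ (here $n=2$); $\mathcal{Q}$ is the set of all of them; $\ell(P)$ is the edge length of $P$ and $j_P:=-\log_2\ell(P)$. Function spaces: fix $\varphi_0,\varphi\in\mathcal{S}(\mathbb{R}^n)$ with real-valued nonnegative Fourier transforms such that $\mathrm{supp}\,\mathcal{F}\varphi_0\subset\{|\xi|\le 2\}$, $|\mathcal{F}\varphi_0(\xi)|\ge C>0$ for $|\xi|\le 5/3$, $\mathrm{supp}\,\mathcal{F}\varphi\subset\{1/2\le|\xi|\le 2\}$, $|\mathcal{F}\varphi(\xi)|\ge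 C>0$ for $3/5\le|\xi|\le 5/3$; put $\varphi_j:=2^{jn}\varphi(2^j\cdot)$ for $j\ge 1$. For $s\in\mathbb{R}$, $\tau\in[0,\infty)$, $p,q\in(0,\infty]$, the Besov-type space $B^{s,\tau}_{p,q}(\mathbb{R}^n)$ is the set of all $f\in\mathcal{S}'(\mathbb{R}^n)$ with $$\|f\|_{B^{s,\tau}_{p,q}(\mathbb{R}^n)}:=\sup_{P\in\mathcal{Q}}\frac1{|P|^{\tau}}\Big\{\sum_{j=\max\{j_P,0\}}^\infty 2^{js q}\Big[\int_P|\varphi_j\ast f(x)|^p\,dx\Big]^{q/p}\Big\}^{1/q}<\infty,$$ and, for $p<\infty$, the Triebel--Lizorkin-type space $F^{s,\tau}_{p,q}(\mathbb{R}^n)$ is the set of all $f\in\mathcal{S}'(\mathbb{R}^n)$ with $$\|f\|_{F^{s,\tau}_{p,q}(\mathbb{R}^n)}:=\sup_{P\in\mathcal{Q}}\frac1{|P|^{\tau}}\Big\{\int_P\Big[\sum_{j=\max\{j_P,0\}}^\infty 2^{js q}|\varphi_j\ast f(x)|^q\Big]^{p/q}dx\Big\}^{1/p}<\infty,$$ with the usual modifications if $p=\infty$ and/or $q=\infty$. *)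

theory Defs
  imports "HOL-Probability.Essential_Supremum"
begin

section \<open>The snowflake domain\<close>

text \<open>The two points at one third and two thirds of the segment from \<open>a\<close> to \<open>b\<close>, and the apex of the
  equilateral triangle erected on the middle third to the right of the direction of travel. Along a
  boundary traversed counterclockwise the right-hand side is the outer side.\<close>

definition koch_third :: "real^2 \<Rightarrow> real^2 \<Rightarrow> real^2" where
  "koch_third a b = a + (1/3) *\<^sub>R (b - a)"

definition koch_two_thirds :: "real^2 \<Rightarrow> real^2 \<Rightarrow> real^2" where
  "koch_two_thirds a b = a + (2/3) *\<^sub>R (b - a)"

definition koch_apex :: "real^2 \<Rightarrow> real^2 \<Rightarrow> real^2" where
  "koch_apex a b =
     midpoint a b + (sqrt 3 / 6) *\<^sub>R vector [(b - a) $ 2, - ((b - a) $ 1)]"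

text \<open>The polygonal line obtained from the segment from \<open>a\<close> to \<open>b\<close> after \<open>m\<close> replacement rounds; each
  of the \<open>4 ^ m\<close> segments takes up a parameter interval of length \<open>1 / 4 ^ m\<close>.\<close>

primrec koch_path :: "nat \<Rightarrow> real^2 \<Rightarrow> real^2 \<Rightarrow> real \<Rightarrow> real^2" where
  "koch_path 0 a b = linepath a b"
| "koch_path (Suc m) a b =
     (koch_path m a (koch_third a b) +++ koch_path m (koch_third a b) (koch_apex a b)) +++
     (koch_path m (koch_apex a b) (koch_two_thirds a b) +++ koch_path m (koch_two_thirds a b) b)"

definition koch_curve :: "real^2 \<Rightarrow> real^2 \<Rightarrow> real \<Rightarrow> real^2" where
  "koch_curve a b t = lim (\<lambda>m. koch_path m a b t)"

definition snowflake_curve :: "real^2 \<Rightarrow> real^2 \<Rightarrow> real^2 \<Rightarrow> (real^2) set" where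
  "snowflake_curve A B C =
     path_image (koch_curve A B) \<union> path_image (koch_curve B C) \<union> path_image (koch_curve C A)"

text \<open>Every equilateral triangle has a counterclockwise labelling, so the orientation condition only
  fixes which side is the outer one.\<close>

definition ccw_equilateral_triangle :: "real^2 \<Rightarrow> real^2 \<Rightarrow> real^2 \<Rightarrow> bool" where
  "ccw_equilateral_triangle A B C \<longleftrightarrow>
     dist A B = dist B C \<and> dist B C = dist C A \<and>
     0 < (B - A) $ 1 * (C - A) $ 2 - (B - A) $ 2 * (C - A) $ 1"

definition snowflake_domain :: "(real^2) set \<Rightarrow> bool" where
  "snowflake_domain \<Omega> \<longleftrightarrow>
     (\<exists>A B C. ccw_equilateral_triangle A B C \<and>
        open \<Omega> \<and> connected \<Omega> \<and> bounded \<Omega> \<and> frontier \<Omega> = snowflake_curve A B C)"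

section \<open>Schwartz functions and tempered distributions\<close>

definition partial_deriv :: "'n::finite \<Rightarrow> (real^'n \<Rightarrow> complex) \<Rightarrow> real^'n \<Rightarrow> complex" where
  "partial_deriv i f x = frechet_derivative f (at x) (axis i 1)"

text \<open>A list of indices stands for the multi-index counting its entries.\<close>

primrec iter_partial :: "'n::finite list \<Rightarrow> (real^'n \<Rightarrow> complex) \<Rightarrow> real^'n \<Rightarrow> complex" where
  "iter_partial [] f = f"
| "iter_partial (i # is) f = partial_deriv i (iter_partial is f)"

definition schwartz :: "(real^'n::finite \<Rightarrow> complex) set" where
  "schwartz = {f.
     (\<forall>is x. iter_partial is f differentiable (at x)) \<and>
     (\<forall>is m. bdd_above (range (\<lambda>x. (1 + norm x) ^ m * norm (iter_partial is f x))))}"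

definition schwartz_seminorm :: "nat \<Rightarrow> 'n::finite list \<Rightarrow> (real^'n \<Rightarrow> complex) \<Rightarrow> real" where
  "schwartz_seminorm m is f = (SUP x. (1 + norm x) ^ m * norm (iter_partial is f x))"

text \<open>The topological dual of the Schwartz space: linear functionals bounded by finitely many of the
  defining seminorms.\<close>

definition tempered_distributions :: "((real^'n::finite \<Rightarrow> complex) \<Rightarrow> complex) set" where
  "tempered_distributions = {u \<in> extensional schwartz.
     (\<forall>f\<in>schwartz. \<forall>g\<in>schwartz. \<forall>a b. u (\<lambda>x. a * f x + b * g x) = a * u f + b * u g) \<and>
     (\<exists>C N. \<forall>f\<in>schwartz.
        norm (u f) \<le> C * (\<Sum>is | length is \<le> N. schwartz_seminorm N is f))}"

definition regular_distribution ::
    "(real^'n::finite \<Rightarrow> complex) \<Rightarrow> (real^'n \<Rightarrow> complex) \<Rightarrow> complex" where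
  "regular_distribution g = restrict (\<lambda>f. LINT x|lborel. g x * f x) schwartz"

definition conv_distribution ::
    "(real^'n::finite \<Rightarrow> complex) \<Rightarrow> ((real^'n \<Rightarrow> complex) \<Rightarrow> complex) \<Rightarrow> real^'n \<Rightarrow> complex" where
  "conv_distribution \<phi> u x = u (\<lambda>y. \<phi> (x - y))"

definition fourier :: "(real^'n::finite \<Rightarrow> complex) \<Rightarrow> real^'n \<Rightarrow> complex" where
  "fourier f \<xi> =
     of_real ((2 * pi) powr (- real CARD('n) / 2)) * (LINT x|lborel. cis (- (x \<bullet> \<xi>)) * f x)"

definition fourier_support :: "(real^'n::finite \<Rightarrow> complex) \<Rightarrow> (real^'n) set" where
  "fourier_support f = closure {\<xi>. fourier f \<xi> \<noteq> 0}"

definition admissible_pair :: "(real^'n::finite \<Rightarrow> complex) \<Rightarrow> (real^'n \<Rightarrow> complex) \<Rightarrow> bool" where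
  "admissible_pair \<phi>\<^sub>0 \<phi> \<longleftrightarrow>
     \<phi>\<^sub>0 \<in> schwartz \<and> \<phi> \<in> schwartz \<and>
     (\<forall>\<xi>. fourier \<phi>\<^sub>0 \<xi> \<in> \<real> \<and> 0 \<le> Re (fourier \<phi>\<^sub>0 \<xi>)) \<and>
     (\<forall>\<xi>. fourier \<phi> \<xi> \<in> \<real> \<and> 0 \<le> Re (fourier \<phi> \<xi>)) \<and>
     fourier_support \<phi>\<^sub>0 \<subseteq> {\<xi>. norm \<xi> \<le> 2} \<and>
     (\<exists>C>0. \<forall>\<xi>. norm \<xi> \<le> 5/3 \<longrightarrow> C \<le> norm (fourier \<phi>\<^sub>0 \<xi>)) \<and>
     fourier_support \<phi> \<subseteq> {\<xi>. 1/2 \<le> norm \<xi> \<and> norm \<xi> \<le> 2} \<and>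
     (\<exists>C>0. \<forall>\<xi>. 3/5 \<le> norm \<xi> \<and> norm \<xi> \<le> 5/3 \<longrightarrow> C \<le> norm (fourier \<phi> \<xi>))"

definition dyadic_resolution ::
    "(real^'n::finite \<Rightarrow> complex) \<Rightarrow> (real^'n \<Rightarrow> complex) \<Rightarrow> nat \<Rightarrow> real^'n \<Rightarrow> complex" where
  "dyadic_resolution \<phi>\<^sub>0 \<phi> j x =
     (if j = 0 then \<phi>\<^sub>0 x else 2 ^ (j * CARD('n)) * \<phi> (2 ^ j *\<^sub>R x))"

section \<open>Besov-type and Triebel--Lizorkin-type spaces\<close>

definition dyadic_cube :: "int \<Rightarrow> int^'n::finite \<Rightarrow> (real^'n) set" where
  "dyadic_cube j k =
     (\<lambda>x. (2 powi (- j)) *\<^sub>R (x + (\<chi> i. real_of_int (k $ i)))) ` {x. \<forall>i. 0 \<le> x $ i \<and> x $ i < 1}"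

text \<open>Only used for exponents \<open>0 < r < \<infinity>\<close>.\<close>

definition epowr :: "ennreal \<Rightarrow> real \<Rightarrow> ennreal" where
  "epowr x r = (if x = \<infinity> then \<infinity> else ennreal (enn2real x powr r))"

definition Lp_norm_on :: "ennreal \<Rightarrow> (real^'n::finite) set \<Rightarrow> (real^'n \<Rightarrow> ennreal) \<Rightarrow> ennreal" where
  "Lp_norm_on p P g =
     (if p = \<infinity> then esssup (restrict_space lborel P) g
      else epowr (\<integral>\<^sup>+x\<in>P. epowr (g x) (enn2real p) \<partial>lborel) (1 / enn2real p))"

definition lq_norm_from :: "ennreal \<Rightarrow> nat \<Rightarrow> (nat \<Rightarrow> ennreal) \<Rightarrow> ennreal" where
  "lq_norm_from q J a =
     (if q = \<infinity> then (SUP j\<in>{J..}. a j)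
      else epowr (\<Sum>i. epowr (a (J + i)) (enn2real q)) (1 / enn2real q))"

text \<open>The supremum over dyadic cubes \<open>P\<close> runs over their indices \<open>(j, k)\<close>. The cube \<open>Q\<^sub>j\<^sub>,\<^sub>k\<close> has edge
  length \<open>2 powi (- j)\<close>, hence \<open>j\<^sub>P = j\<close>, and \<open>max {j\<^sub>P, 0}\<close> is \<open>nat j\<close>. The factors \<open>2 powr (j * s)\<close> are
  put inside the \<open>p\<close>- and \<open>q\<close>-th powers, which covers infinite \<open>p\<close> and \<open>q\<close> as well.\<close>

definition besov_type_norm ::
    "(real^'n::finite \<Rightarrow> complex) \<Rightarrow> (real^'n \<Rightarrow> complex) \<Rightarrow> real \<Rightarrow> real \<Rightarrow> ennreal \<Rightarrow> ennreal \<Rightarrow>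
     ((real^'n \<Rightarrow> complex) \<Rightarrow> complex) \<Rightarrow> ennreal" where
  "besov_type_norm \<phi>\<^sub>0 \<phi> s \<tau> p q f =
     (SUP (i, k) \<in> UNIV.
        ennreal (1 / measure lborel (dyadic_cube i k :: (real^'n) set) powr \<tau>) *
        lq_norm_from q (nat i) (\<lambda>j. ennreal (2 powr (real j * s)) *
          Lp_norm_on p (dyadic_cube i k)
            (\<lambda>x. ennreal (norm (conv_distribution (dyadic_resolution \<phi>\<^sub>0 \<phi> j) f x)))))"

definition besov_type_space ::
    "(real^'n::finite \<Rightarrow> complex) \<Rightarrow> (real^'n \<Rightarrow> complex) \<Rightarrow> real \<Rightarrow> real \<Rightarrow> ennreal \<Rightarrow> ennreal \<Rightarrow>
     ((real^'n \<Rightarrow> complex) \<Rightarrow> complex) set" where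
  "besov_type_space \<phi>\<^sub>0 \<phi> s \<tau> p q =
     {f \<in> tempered_distributions. besov_type_norm \<phi>\<^sub>0 \<phi> s \<tau> p q f < \<infinity>}"

definition triebel_lizorkin_type_norm ::
    "(real^'n::finite \<Rightarrow> complex) \<Rightarrow> (real^'n \<Rightarrow> complex) \<Rightarrow> real \<Rightarrow> real \<Rightarrow> ennreal \<Rightarrow> ennreal \<Rightarrow>
     ((real^'n \<Rightarrow> complex) \<Rightarrow> complex) \<Rightarrow> ennreal" where
  "triebel_lizorkin_type_norm \<phi>\<^sub>0 \<phi> s \<tau> p q f =
     (SUP (i, k) \<in> UNIV.
        ennreal (1 / measure lborel (dyadic_cube i k :: (real^'n) set) powr \<tau>) *
        Lp_norm_on p (dyadic_cube i k) (\<lambda>x.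
          lq_norm_from q (nat i) (\<lambda>j. ennreal (2 powr (real j * s)) *
            ennreal (norm (conv_distribution (dyadic_resolution \<phi>\<^sub>0 \<phi> j) f x)))))"

text \<open>Meant for \<open>p < \<infinity>\<close> only.\<close>

definition triebel_lizorkin_type_space ::
    "(real^'n::finite \<Rightarrow> complex) \<Rightarrow> (real^'n \<Rightarrow> complex) \<Rightarrow> real \<Rightarrow> real \<Rightarrow> ennreal \<Rightarrow> ennreal \<Rightarrow>
     ((real^'n \<Rightarrow> complex) \<Rightarrow> complex) set" where
  "triebel_lizorkin_type_space \<phi>\<^sub>0 \<phi> s \<tau> p q =
     {f \<in> tempered_distributions. triebel_lizorkin_type_norm \<phi>\<^sub>0 \<phi> s \<tau> p q f < \<infinity>}"

end

theory Submission
  imports Defs "HOL-Probability.Characteristic_Functions"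
begin

text \<open>
  Write \<open>\<beta> = 2 - d\<close> and let \<open>u\<^sub>j\<close> be the convolution of the characteristic function of \<open>\<Omega>\<close> with the
  \<open>j\<close>-th kernel. Since the mother kernel has mean zero, \<open>u\<^sub>j(x)\<close> decays rapidly in
  \<open>2\<^sup>j dist(x, \<partial>\<Omega>)\<close>, and the \<open>r\<close>-neighbourhood of \<open>\<partial>\<Omega>\<close> inside a square of side \<open>l \<le> 1\<close> has area
  at most a constant times \<open>r\<^sup>\<beta> l\<^sup>d\<close>, because the pieces of one generation of the Koch curve lie in
  disjoint open cells. This bounds the \<open>p\<close>-th power integral of \<open>u\<^sub>j\<close> over a square by
  \<open>2\<^sup>-\<^sup>j\<^sup>\<beta> l\<^sup>d\<close> and gives all memberships.

  Conversely, if the function belongs to a Triebel--Lizorkin-type space with \<open>s \<ge> \<beta>/p\<close>, then the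
  supremum over \<open>j\<close> of \<open>2\<^sup>j\<^sup>\<beta> |u\<^sub>j|\<^sup>p\<close> is locally integrable, so by dominated convergence the energies
  \<open>\<parallel>u\<^sub>j\<parallel>\<^sup>2\<close> in \<open>L\<^sup>2\<close> are \<open>o(2\<^sup>-\<^sup>j\<^sup>\<beta>)\<close>. On the Fourier side they control the amount of a Gaussian of width
  \<open>e\<close>, started in \<open>\<Omega>\<close>, that leaves \<open>\<Omega>\<close>, which is then \<open>o(e\<^sup>\<beta>)\<close>. But every Koch segment of length
  \<open>e\<close> has a ball of radius \<open>e/100\<close> inside \<open>\<Omega>\<close> and another one outside \<open>\<Omega>\<close> within distance \<open>4e\<close>, and as
  there are about \<open>e\<close> to the power \<open>-d\<close> such segments with disjoint cells, the leak is at least a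
  constant times \<open>e\<^sup>\<beta>\<close>.
\<close>

section \<open>Coordinates along a segment\<close>

text \<open>At the critical smoothness each level separately satisfies the required p-th power
  bound, so for q = \<infinity> no divergent sum is at hand; all that the norm adds is a common
  majorant of the levels, and the refutation has to rest on a little-o. A Gaussian is the test
  object because it is positive, has a positive transform, and its double integral can be read
  geometrically as well as on the Fourier side. Passing between the two readings costs the sum over
  j of min(1, 4^j e^2) 2^(-j \<beta>), which is comparable to e^\<beta> because 0 < \<beta> < 2, so
  that a little-o survives. Of the kernels' transforms only lower bounds on overlapping annuli
  enter, and no reproducing formula. The other obstacle is topological. The domain is specified
  through its frontier, so it has to be proved that it lies on the inner side of every small
  segment. Instead of Jordan's theorem, convex regions that miss the curve pass this information
  from one generation to the next.\<close>

definition right_normal :: "real^2 \<Rightarrow> real^2" where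
  "right_normal w = vector [w $ 2, - (w $ 1)]"

text \<open>The second coordinate is measured in multiples of \<open>sqrt 3\<close>, so that all maps between a segment
  and its four replacements have rational coefficients.\<close>

definition seg_x :: "real^2 \<Rightarrow> real^2 \<Rightarrow> real^2 \<Rightarrow> real" where
  "seg_x a b p = ((p - a) \<bullet> (b - a)) / (norm (b - a))\<^sup>2"

definition seg_v :: "real^2 \<Rightarrow> real^2 \<Rightarrow> real^2 \<Rightarrow> real" where
  "seg_v a b p = ((p - a) \<bullet> right_normal (b - a)) / (sqrt 3 * (norm (b - a))\<^sup>2)"

definition seg_pt :: "real^2 \<Rightarrow> real^2 \<Rightarrow> real \<Rightarrow> real \<Rightarrow> real^2" where
  "seg_pt a b x v = a + x *\<^sub>R (b - a) + (sqrt 3 * v) *\<^sub>R right_normal (b - a)"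

lemma right_normal_nth [simp]: "right_normal w $ 1 = w $ 2" "right_normal w $ 2 = - (w $ 1)"
  by (simp_all add: right_normal_def)

lemma norm_vec2: "(norm (w :: real^2))\<^sup>2 = (w $ 1)\<^sup>2 + (w $ 2)\<^sup>2"
  unfolding power2_norm_eq_inner by (simp add: inner_vec_def sum_2 power2_eq_square)

lemma inner_vec2: "(v :: real^2) \<bullet> w = v $ 1 * w $ 1 + v $ 2 * w $ 2"
  by (simp add: inner_vec_def sum_2)

lemma vec2_eq_iff: "(v :: real^2) = w \<longleftrightarrow> v $ 1 = w $ 1 \<and> v $ 2 = w $ 2"
  by (simp add: vec_eq_iff forall_2)

lemma norm_right_normal [simp]: "norm (right_normal w) = norm w"
proof -
  have "(norm (right_normal w))\<^sup>2 = (norm w)\<^sup>2"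
    unfolding norm_vec2 by simp
  then show ?thesis by simp
qed

lemma seg_coords [simp]:
  assumes "a \<noteq> b"
  shows "seg_x a b (seg_pt a b x v) = x" "seg_v a b (seg_pt a b x v) = v"
proof -
  have n: "(norm (b - a))\<^sup>2 \<noteq> 0" using assms by simp
  have "(seg_pt a b x v - a) \<bullet> (b - a) = x * (norm (b - a))\<^sup>2"
    unfolding inner_vec2 norm_vec2 seg_pt_def by (simp add: power2_eq_square algebra_simps)
  then show "seg_x a b (seg_pt a b x v) = x"
    unfolding seg_x_def using n by simp
  have "(seg_pt a b x v - a) \<bullet> right_normal (b - a) = v * (sqrt 3 * (norm (b - a))\<^sup>2)"
    unfolding inner_vec2 norm_vec2 seg_pt_def by (simp add: power2_eq_square algebra_simps)
  then show "seg_v a b (seg_pt a b x v) = v"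
    unfolding seg_v_def using n by simp
qed

lemma seg_pt_coords [simp]:
  assumes "a \<noteq> b"
  shows "seg_pt a b (seg_x a b p) (seg_v a b p) = p"
proof -
  define n where "n = (norm (b - a))\<^sup>2"
  have n0: "n \<noteq> 0" using assms by (simp add: n_def)
  have n1: "n = (b$1 - a$1)\<^sup>2 + (b$2 - a$2)\<^sup>2" unfolding n_def norm_vec2 by simp
  have s: "sqrt 3 * seg_v a b p = ((p - a) \<bullet> right_normal (b - a)) / n"
    unfolding seg_v_def n_def by simp
  have x: "seg_x a b p = ((p - a) \<bullet> (b - a)) / n" unfolding seg_x_def n_def by simp
  have "(u * c + w * e) / n * c + (u * e + w * (- c)) / n * e = u"
    and "(u * c + w * e) / n * e + (u * e + w * (- c)) / n * (- c) = w"
    if "n = c\<^sup>2 + e\<^sup>2" for u w c e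
  proof -
    have "(u * c + w * e) * c + (u * e + w * (- c)) * e = u * n"
      "(u * c + w * e) * e + (u * e + w * (- c)) * (- c) = w * n"
      unfolding that by (simp_all add: power2_eq_square algebra_simps)
    then show "(u * c + w * e) / n * c + (u * e + w * (- c)) / n * e = u"
      and "(u * c + w * e) / n * e + (u * e + w * (- c)) / n * (- c) = w"
      using n0 by (simp_all only: times_divide_eq_left add_divide_distrib[symmetric]) simp_all
  qed
  from this[OF n1, of "p$1 - a$1" "p$2 - a$2"] show ?thesis
    unfolding seg_pt_def s x vec2_eq_iff inner_vec2
    by (simp only: vector_add_component vector_scaleR_component vector_minus_component right_normal_nth
      real_scaleR_def add.assoc) simp
qed

text \<open>An equilateral triangle over a unit segment has height \<open>sqrt 3 / 2\<close>, which
  is 1/2 in the rescaled second coordinate; over the middle third it becomes 1/6.\<close>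

lemma koch_points:
  "koch_third a b = seg_pt a b (1/3) 0"
  "koch_two_thirds a b = seg_pt a b (2/3) 0"
  "koch_apex a b = seg_pt a b (1/2) (1/6)"
  unfolding koch_third_def koch_two_thirds_def koch_apex_def seg_pt_def right_normal_def midpoint_def
  by (simp_all add: vec2_eq_iff field_simps)

lemma seg_pt_ends [simp]: "seg_pt a b 0 0 = a" "seg_pt a b 1 0 = b"
  by (simp_all add: seg_pt_def)

lemma sqrt3_simps [simp]: "sqrt 3 * (sqrt 3 * x) = 3 * x" for x :: real
  by (simp only: mult.assoc[symmetric] real_sqrt_mult_self) 

text \<open>The four similarities of ratio 1/3, the middle two combined with a turn by 60 degrees.
  Measuring \<open>v\<close> in units of \<open>sqrt 3\<close> absorbs the sines and leaves the
  coefficients 1/6 and 1/2.\<close>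

lemma seg_pt_children:
  "seg_pt a (koch_third a b) x v = seg_pt a b (x/3) (v/3)"
  "seg_pt (koch_third a b) (koch_apex a b) x v = seg_pt a b (1/3 + x/6 - v/2) (x/6 + v/6)"
  "seg_pt (koch_apex a b) (koch_two_thirds a b) x v = seg_pt a b (1/2 + x/6 + v/2) (1/6 - x/6 + v/6)"
  "seg_pt (koch_two_thirds a b) b x v = seg_pt a b (2/3 + x/3) (v/3)"
  unfolding koch_points seg_pt_def vec2_eq_iff
  by (simp_all add: field_simps)

lemma norm_seg_pt_diff:
  "(dist (seg_pt a b x v) (seg_pt a b x' v'))\<^sup>2 = (norm (b - a))\<^sup>2 * ((x - x')\<^sup>2 + 3 * (v - v')\<^sup>2)"
  unfolding dist_norm norm_vec2 seg_pt_def
  by (simp add: power2_eq_square algebra_simps)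

section \<open>The four replacement segments\<close>

definition koch_children :: "real^2 \<Rightarrow> real^2 \<Rightarrow> ((real^2) \<times> (real^2)) set" where
  "koch_children a b = {(a, koch_third a b), (koch_third a b, koch_apex a b),
     (koch_apex a b, koch_two_thirds a b), (koch_two_thirds a b, b)}"

lemma koch_children_cases:
  assumes "(c, e) \<in> koch_children a b"
  obtains "c = a" "e = koch_third a b" | "c = koch_third a b" "e = koch_apex a b"
    | "c = koch_apex a b" "e = koch_two_thirds a b" | "c = koch_two_thirds a b" "e = b"
  using assms unfolding koch_children_def by auto

lemma norm_koch_children:
  assumes "(c, e) \<in> koch_children a b"
  shows "norm (e - c) = norm (b - a) / 3"
proof -
  have 1: "norm (seg_pt a b x v - seg_pt a b x' v') = norm (b - a) / 3"
    if "(x - x')\<^sup>2 + 3 * (v - v')\<^sup>2 = 1/9" for x v x' v'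
  proof -
    have "(dist (seg_pt a b x v) (seg_pt a b x' v'))\<^sup>2 = (norm (b - a) / 3)\<^sup>2"
      unfolding norm_seg_pt_diff that by (simp add: power2_eq_square)
    then show ?thesis by (simp add: dist_norm)
  qed
  have "norm (koch_third a b - a) = norm (b - a) / 3"
    using 1[of "1/3" 0 0 0] by (simp add: koch_points power2_eq_square)
  moreover have "norm (koch_apex a b - koch_third a b) = norm (b - a) / 3"
    using 1[of "1/2" "1/3" "1/6" 0] by (simp add: koch_points power2_eq_square)
  moreover have "norm (koch_two_thirds a b - koch_apex a b) = norm (b - a) / 3"
    using 1[of "2/3" "1/2" 0 "1/6"] by (simp add: koch_points power2_eq_square)
  moreover have "norm (b - koch_two_thirds a b) = norm (b - a) / 3"
    using 1[of 1 "2/3" 0 0] by (simp add: koch_points power2_eq_square)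
  ultimately show ?thesis
    using assms unfolding koch_children_def by auto
qed

lemma koch_children_neq: "(c, e) \<in> koch_children a b \<Longrightarrow> a \<noteq> b \<Longrightarrow> c \<noteq> e"
  using norm_koch_children[of c e a b] by auto

text \<open>With the parent's coordinates linear in those of a child, every inclusion and
  disjointness claim about the regions below becomes rational linear arithmetic.\<close>

lemma koch_children_coords:
  assumes "a \<noteq> b"
  shows "seg_x a b p = seg_x a (koch_third a b) p / 3"
    "seg_v a b p = seg_v a (koch_third a b) p / 3"
    and "seg_x a b p = 1/3 + seg_x (koch_third a b) (koch_apex a b) p / 6 - seg_v (koch_third a b) (koch_apex a b) p / 2"
    "seg_v a b p = seg_x (koch_third a b) (koch_apex a b) p / 6 + seg_v (koch_third a b) (koch_apex a b) p / 6"
    and "seg_x a b p = 1/2 + seg_x (koch_apex a b) (koch_two_thirds a b) p / 6 + seg_v (koch_apex a b) (koch_two_thirds a b) p / 2"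
    "seg_v a b p = 1/6 - seg_x (koch_apex a b) (koch_two_thirds a b) p / 6 + seg_v (koch_apex a b) (koch_two_thirds a b) p / 6"
    and "seg_x a b p = 2/3 + seg_x (koch_two_thirds a b) b p / 3"
    "seg_v a b p = seg_v (koch_two_thirds a b) b p / 3"
proof -
  have c: "c \<noteq> e" if "(c, e) \<in> koch_children a b" for c e
    using koch_children_neq that assms by blast
  have ne: "a \<noteq> koch_third a b" "koch_third a b \<noteq> koch_apex a b" 
      "koch_apex a b \<noteq> koch_two_thirds a b" "koch_two_thirds a b \<noteq> b"
    by (rule c; simp add: koch_children_def)+
  show "seg_x a b p = seg_x a (koch_third a b) p / 3"
    "seg_v a b p = seg_v a (koch_third a b) p / 3"
    using seg_pt_coords[OF ne(1), of p] unfolding seg_pt_children by (metis assms seg_coords)+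
  show "seg_x a b p = 1/3 + seg_x (koch_third a b) (koch_apex a b) p / 6 - seg_v (koch_third a b) (koch_apex a b) p / 2"
    "seg_v a b p = seg_x (koch_third a b) (koch_apex a b) p / 6 + seg_v (koch_third a b) (koch_apex a b) p / 6"
    using seg_pt_coords[OF ne(2), of p] unfolding seg_pt_children by (metis assms seg_coords)+
  show "seg_x a b p = 1/2 + seg_x (koch_apex a b) (koch_two_thirds a b) p / 6 + seg_v (koch_apex a b) (koch_two_thirds a b) p / 2"
    "seg_v a b p = 1/6 - seg_x (koch_apex a b) (koch_two_thirds a b) p / 6 + seg_v (koch_apex a b) (koch_two_thirds a b) p / 6"
    using seg_pt_coords[OF ne(3), of p] unfolding seg_pt_children by (metis assms seg_coords)+
  show "seg_x a b p = 2/3 + seg_x (koch_two_thirds a b) b p / 3"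
    "seg_v a b p = seg_v (koch_two_thirds a b) b p / 3"
    using seg_pt_coords[OF ne(4), of p] unfolding seg_pt_children by (metis assms seg_coords)+
qed

section \<open>Polygonal regions attached to a segment\<close>

text \<open>A triple stands for an open half plane in segment coordinates. Intersections of finitely
  many of them are open, which the area estimates use, and convex, hence connected.\<close>

definition seg_poly :: "(real \<times> real \<times> real) list \<Rightarrow> real^2 \<Rightarrow> real^2 \<Rightarrow> (real^2) set" where
  "seg_poly H a b = {p. \<forall>(\<alpha>, \<beta>, \<gamma>) \<in> set H. \<alpha> * seg_x a b p + \<beta> * seg_v a b p < \<gamma>}"

lemma continuous_on_seg_x [continuous_intros]: "continuous_on S (seg_x a b)"
  unfolding seg_x_def by (cases "a = b") (auto intro!: continuous_intros)

lemma continuous_on_seg_v [continuous_intros]: "continuous_on S (seg_v a b)"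
  unfolding seg_v_def by (cases "a = b") (auto intro!: continuous_intros)

lemma open_seg_poly [intro, simp]: "open (seg_poly H a b)"
proof -
  have "seg_poly H a b = (\<Inter>h\<in>set H. {p. fst h * seg_x a b p + fst (snd h) * seg_v a b p < snd (snd h)})"
    unfolding seg_poly_def by (auto simp: case_prod_beta)
  then show ?thesis
    by (auto intro!: open_Collect_less continuous_intros)
qed

lemma seg_affine:
  assumes "s + t = 1"
  shows "seg_x a b (s *\<^sub>R p + t *\<^sub>R q) = s * seg_x a b p + t * seg_x a b q"
    and "seg_v a b (s *\<^sub>R p + t *\<^sub>R q) = s * seg_v a b p + t * seg_v a b q"
proof -
  have "a = s *\<^sub>R a + t *\<^sub>R a" using assms by (metis scaleR_left_distrib scaleR_one)
  then have "s *\<^sub>R p + t *\<^sub>R q - a = s *\<^sub>R (p - a) + t *\<^sub>R (q - a)"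
    by (simp add: algebra_simps)
  then show "seg_x a b (s *\<^sub>R p + t *\<^sub>R q) = s * seg_x a b p + t * seg_x a b q"
    and "seg_v a b (s *\<^sub>R p + t *\<^sub>R q) = s * seg_v a b p + t * seg_v a b q"
    unfolding seg_x_def seg_v_def by (simp_all add: inner_add_left add_divide_distrib)
qed

lemma convex_seg_poly [intro, simp]: "convex (seg_poly H a b)"
proof (rule convexI)
  fix p q :: "real^2" and s t :: real
  assume pq: "p \<in> seg_poly H a b" "q \<in> seg_poly H a b" and st: "0 \<le> s" "0 \<le> t" "s + t = 1"
  have "\<alpha> * (s * seg_x a b p + t * seg_x a b q) + \<beta> * (s * seg_v a b p + t * seg_v a b q) < \<gamma>"
    if "(\<alpha>, \<beta>, \<gamma>) \<in> set H" for \<alpha> \<beta> \<gamma>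
  proof -
    have 1: "\<alpha> * seg_x a b p + \<beta> * seg_v a b p < \<gamma>" "\<alpha> * seg_x a b q + \<beta> * seg_v a b q < \<gamma>"
      using pq that unfolding seg_poly_def by auto
    have "s * (\<alpha> * seg_x a b p + \<beta> * seg_v a b p) + t * (\<alpha> * seg_x a b q + \<beta> * seg_v a b q) < \<gamma>"
      using convex_bound_lt[OF 1 st] by (simp add: algebra_simps)
    then show ?thesis by (simp add: algebra_simps)
  qed
  then show "s *\<^sub>R p + t *\<^sub>R q \<in> seg_poly H a b"
    unfolding seg_poly_def using seg_affine[OF st(3)] by auto
qed

lemma connected_seg_poly [intro, simp]: "connected (seg_poly H a b)"
  by (simp add: convex_connected)

text \<open>The closed triangle with corners \<open>a\<close>, \<open>b\<close>,
  \<open>koch_apex a b\<close> and base angles of 30 degrees. The four similarities map it into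
  itself, and being closed it also contains the limit arc.\<close>

definition seg_triangle :: "real^2 \<Rightarrow> real^2 \<Rightarrow> (real^2) set" where
  "seg_triangle a b = {p. 0 \<le> seg_v a b p \<and> 3 * seg_v a b p \<le> seg_x a b p \<and> 3 * seg_v a b p \<le> 1 - seg_x a b p}"

lemma closed_seg_triangle [intro, simp]: "closed (seg_triangle a b)"
  unfolding seg_triangle_def
  by (intro closed_Collect_conj closed_Collect_le continuous_intros)

text \<open>The pentagon of the open set condition for the Koch curve. It is chosen larger than the triangle
  that carries the arc, so as to contain room on both sides of the arc.\<close>

definition seg_cell :: "real^2 \<Rightarrow> real^2 \<Rightarrow> (real^2) set" where
  "seg_cell = seg_poly [(-1,-3,0), (1,-3,1), (-1,1,0), (1,1,1), (0,1,1/6)]"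

lemma mem_seg_cell: "p \<in> seg_cell a b \<longleftrightarrow>
  0 < seg_x a b p + 3 * seg_v a b p \<and> seg_x a b p < 1 + 3 * seg_v a b p \<and>
  seg_v a b p < seg_x a b p \<and> seg_v a b p < 1 - seg_x a b p \<and> seg_v a b p < 1/6"
  unfolding seg_cell_def seg_poly_def by auto

lemma open_seg_cell [intro, simp]: "open (seg_cell a b)"
  by (simp add: seg_cell_def)

text \<open>Together with the disjointness below this is the open set condition for the four
  similarities.\<close>

lemma seg_cell_children:
  assumes "a \<noteq> b" "(c, e) \<in> koch_children a b"
  shows "seg_cell c e \<subseteq> seg_cell a b"
proof
  fix p assume p: "p \<in> seg_cell c e"
  show "p \<in> seg_cell a b"
    using assms(2) p koch_children_coords[OF assms(1), of p]
    by (cases rule: koch_children_cases) (auto simp: mem_seg_cell)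
qed

lemma seg_triangle_children:
  assumes "a \<noteq> b" "(c, e) \<in> koch_children a b"
  shows "seg_triangle c e \<subseteq> seg_triangle a b"
proof
  fix p assume p: "p \<in> seg_triangle c e"
  show "p \<in> seg_triangle a b"
    using assms(2) p koch_children_coords[OF assms(1), of p]
    by (cases rule: koch_children_cases) (auto simp: seg_triangle_def)
qed

lemma seg_cell_children_disjoint:
  assumes "a \<noteq> b"
  shows "seg_cell a (koch_third a b) \<inter> seg_cell (koch_third a b) (koch_apex a b) = {}"
    and "seg_cell a (koch_third a b) \<inter> seg_cell (koch_apex a b) (koch_two_thirds a b) = {}"
    and "seg_cell a (koch_third a b) \<inter> seg_cell (koch_two_thirds a b) b = {}"
    and "seg_cell (koch_third a b) (koch_apex a b) \<inter> seg_cell (koch_apex a b) (koch_two_thirds a b) = {}"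
    and "seg_cell (koch_third a b) (koch_apex a b) \<inter> seg_cell (koch_two_thirds a b) b = {}"
    and "seg_cell (koch_apex a b) (koch_two_thirds a b) \<inter> seg_cell (koch_two_thirds a b) b = {}"
  unfolding disjoint_iff mem_seg_cell
proof (safe, goal_cases)
  case (1 p) then show ?case using koch_children_coords(1,2,3,4)[OF assms, of p] by argo
next
  case (2 p) then show ?case using koch_children_coords(1,2,5,6)[OF assms, of p] by argo
next
  case (3 p) then show ?case using koch_children_coords(1,2,7,8)[OF assms, of p] by argo
next
  \<comment> \<open>The two middle cells are mirror images of each other and are separated by the
    axis at 1/2.\<close>
  case (4 p)
  have "seg_x a b p < 1/2" unfolding koch_children_coords(3)[OF assms, of p] using 4(2) by argo
  moreover have "seg_x a b p > 1/2" unfolding koch_children_coords(5)[OF assms, of p] using 4(6) by argo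
  ultimately show ?case by simp
next
  case (5 p) then show ?case using koch_children_coords(3,4,7,8)[OF assms, of p] by argo
next
  case (6 p) then show ?case using koch_children_coords(5,6,7,8)[OF assms, of p] by argo
qed

lemma dist_seg_le:
  assumes "a \<noteq> b"
  shows "dist p q \<le> norm (b - a) * (\<bar>seg_x a b p - seg_x a b q\<bar> + 2 * \<bar>seg_v a b p - seg_v a b q\<bar>)"
proof -
  have s3: "sqrt 3 \<le> 2" by (rule real_le_lsqrt) auto
  have "seg_pt a b x v - seg_pt a b x' v' = (x - x') *\<^sub>R (b - a)
      + (sqrt 3 * (v - v')) *\<^sub>R right_normal (b - a)" for x v x' v'
    unfolding seg_pt_def by (simp add: scaleR_left_diff_distrib right_diff_distrib)
  from this[of "seg_x a b p" "seg_v a b p" "seg_x a b q" "seg_v a b q"]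
  have "p - q = (seg_x a b p - seg_x a b q) *\<^sub>R (b - a)
      + (sqrt 3 * (seg_v a b p - seg_v a b q)) *\<^sub>R right_normal (b - a)"
    by (simp only: seg_pt_coords[OF assms])
  then have "dist p q \<le> norm (b - a) * \<bar>seg_x a b p - seg_x a b q\<bar>
      + sqrt 3 * \<bar>seg_v a b p - seg_v a b q\<bar> * norm (b - a)"
    unfolding dist_norm using norm_triangle_ineq[of "(seg_x a b p - seg_x a b q) *\<^sub>R (b - a)"
      "(sqrt 3 * (seg_v a b p - seg_v a b q)) *\<^sub>R right_normal (b - a)"]
    by (simp add: abs_mult mult.commute)
  also have "sqrt 3 * \<bar>seg_v a b p - seg_v a b q\<bar> * norm (b - a)
      \<le> 2 * \<bar>seg_v a b p - seg_v a b q\<bar> * norm (b - a)"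
    by (intro mult_right_mono s3) auto
  finally show ?thesis by (simp add: algebra_simps)
qed

lemma seg_coords_dist:
  assumes "a \<noteq> b"
  shows "\<bar>seg_x a b p - seg_x a b q\<bar> \<le> dist p q / norm (b - a)"
    and "\<bar>seg_v a b p - seg_v a b q\<bar> \<le> dist p q / norm (b - a)"
proof -
  have n: "norm (b - a) > 0" using assms by simp
  have "(dist p q)\<^sup>2 = (norm (b - a))\<^sup>2 * ((seg_x a b p - seg_x a b q)\<^sup>2 + 3 * (seg_v a b p - seg_v a b q)\<^sup>2)"
    using norm_seg_pt_diff[of a b "seg_x a b p" "seg_v a b p" "seg_x a b q" "seg_v a b q"] assms by simp
  then have e: "(dist p q / norm (b - a))\<^sup>2 = (seg_x a b p - seg_x a b q)\<^sup>2 + 3 * (seg_v a b p - seg_v a b q)\<^sup>2"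
    using n by (simp add: power_divide)
  have *: "0 \<le> (seg_x a b p - seg_x a b q)\<^sup>2" "0 \<le> (seg_v a b p - seg_v a b q)\<^sup>2" by auto
  have "\<bar>seg_x a b p - seg_x a b q\<bar>\<^sup>2 \<le> (dist p q / norm (b - a))\<^sup>2"
    unfolding e power2_abs using * by argo
  then show "\<bar>seg_x a b p - seg_x a b q\<bar> \<le> dist p q / norm (b - a)"
    by (rule power2_le_imp_le) simp
  have "\<bar>seg_v a b p - seg_v a b q\<bar>\<^sup>2 \<le> (dist p q / norm (b - a))\<^sup>2"
    unfolding e power2_abs using * by argo
  then show "\<bar>seg_v a b p - seg_v a b q\<bar> \<le> dist p q / norm (b - a)"
    by (rule power2_le_imp_le) simp
qed

lemma seg_triangle_diameter:
  assumes "a \<noteq> b" "p \<in> seg_triangle a b" "q \<in> seg_triangle a b"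
  shows "dist p q \<le> 2 * norm (b - a)"
proof -
  have "\<bar>seg_x a b p - seg_x a b q\<bar> + 2 * \<bar>seg_v a b p - seg_v a b q\<bar> \<le> 2"
    using assms(2,3) unfolding seg_triangle_def mem_Collect_eq by argo
  then have "norm (b - a) * (\<bar>seg_x a b p - seg_x a b q\<bar> + 2 * \<bar>seg_v a b p - seg_v a b q\<bar>) \<le> norm (b - a) * 2"
    by (intro mult_left_mono) auto
  then show ?thesis using dist_seg_le[OF assms(1), of p q] by simp
qed

lemma ends_in_seg_triangle:
  "a \<noteq> b \<Longrightarrow> a \<in> seg_triangle a b" "a \<noteq> b \<Longrightarrow> b \<in> seg_triangle a b"
  using seg_coords[of a b 0 0] seg_coords[of a b 1 0] unfolding seg_triangle_def by auto

lemma seg_cell_near: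
  assumes "a \<noteq> b" "p \<in> seg_cell a b"
  shows "dist p a \<le> 2 * norm (b - a)"
proof -
  have z: "seg_x a b a = 0" "seg_v a b a = 0"
    using seg_coords[OF assms(1), of 0 0] by auto
  have "0 < seg_x a b p + 3 * seg_v a b p" "seg_x a b p < 1 + 3 * seg_v a b p"
    "seg_v a b p < seg_x a b p" "seg_v a b p < 1 - seg_x a b p" "seg_v a b p < 1/6"
    using assms(2) unfolding mem_seg_cell by auto
  then have "\<bar>seg_x a b p - seg_x a b a\<bar> + 2 * \<bar>seg_v a b p - seg_v a b a\<bar> \<le> 2"
    unfolding z by argo
  then have "norm (b - a) * (\<bar>seg_x a b p - seg_x a b a\<bar> + 2 * \<bar>seg_v a b p - seg_v a b a\<bar>) \<le> norm (b - a) * 2"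
    by (intro mult_left_mono) auto
  then show ?thesis using dist_seg_le[OF assms(1), of p a] by simp
qed

section \<open>The Koch curve\<close>

abbreviation koch_arc :: "real^2 \<Rightarrow> real^2 \<Rightarrow> (real^2) set" where
  "koch_arc a b \<equiv> path_image (koch_curve a b)"

lemma joinpaths_left: "0 \<le> t \<Longrightarrow> t \<le> 1 \<Longrightarrow> (p +++ q) (t / 2) = p t"
  by (simp add: joinpaths_def)

text \<open>At \<open>t = 0\<close> the join still evaluates its first path, so the matching of the
  end points enters there.\<close>

lemma joinpaths_right:
  assumes "pathfinish p = pathstart q" "0 \<le> t" "t \<le> 1"
  shows "(p +++ q) ((1 + t) / 2) = q t"
proof (cases "t = 0")
  case True
  then show ?thesis using assms(1) by (simp add: joinpaths_def pathfinish_def pathstart_def)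
next
  case False
  then have "2 * ((1 + t) / 2) - 1 = t" "\<not> (1 + t) / 2 \<le> 1 / 2" using assms by (auto simp: field_simps)
  then show ?thesis unfolding joinpaths_def by presburger
qed

lemma koch_path_ends [simp]:
  "pathstart (koch_path m a b) = a" "pathfinish (koch_path m a b) = b"
  by (induction m arbitrary: a b) auto

text \<open>The nested joins give each replacement segment a quarter of the parameter interval. The
  child and its parameter do not depend on \<open>m\<close>, so this self-similarity passes to the
  limit curve.\<close>

lemma koch_path_child:
  assumes "0 \<le> t" "t \<le> 1"
  obtains c e u where "(c, e) \<in> koch_children a b" "0 \<le> u" "u \<le> 1"
    "\<And>m. koch_path (Suc m) a b t = koch_path m c e u"
proof -
  consider "t \<le> 1/4" | "1/4 < t" "t \<le> 1/2" | "1/2 < t" "t \<le> 3/4" | "3/4 < t" by linarith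
  then show thesis
  proof cases
    case 1
    show thesis
      by (rule that[of a "koch_third a b" "4 * t"])
        (use 1 assms in \<open>auto simp: koch_children_def joinpaths_def\<close>)
  next
    case 2
    show thesis
      by (rule that[of "koch_third a b" "koch_apex a b" "4 * t - 1"])
        (use 2 assms in \<open>auto simp: koch_children_def joinpaths_def\<close>)
  next
    case 3
    show thesis
      by (rule that[of "koch_apex a b" "koch_two_thirds a b" "4 * t - 2"])
        (use 3 assms in \<open>auto simp: koch_children_def joinpaths_def algebra_simps\<close>)
  next
    case 4
    show thesis
      by (rule that[of "koch_two_thirds a b" b "4 * t - 3"])
        (use 4 assms in \<open>auto simp: koch_children_def joinpaths_def algebra_simps\<close>)
  qed
qed

lemma koch_path_parent:
  assumes "(c, e) \<in> koch_children a b" "0 \<le> u" "u \<le> 1"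
  obtains t where "0 \<le> t" "t \<le> 1" "\<And>m. koch_path (Suc m) a b t = koch_path m c e u"
  using assms(1)
proof (cases rule: koch_children_cases)
  case 1
  show thesis
    by (rule that[of "(u / 2) / 2"]) (use assms 1 in \<open>auto simp: joinpaths_left simp del: divide_divide_eq_left\<close>)
next
  case 2
  show thesis
    by (rule that[of "((1 + u) / 2) / 2"])
      (use assms 2 in \<open>auto simp: joinpaths_left joinpaths_right simp del: divide_divide_eq_left\<close>)
next
  case 3
  show thesis
    by (rule that[of "(1 + u / 2) / 2"])
      (use assms 3 in \<open>auto simp: joinpaths_left joinpaths_right simp del: divide_divide_eq_left\<close>)
next
  case 4
  show thesis
    by (rule that[of "(1 + (1 + u) / 2) / 2"])
      (use assms 4 in \<open>auto simp: joinpaths_left joinpaths_right simp del: divide_divide_eq_left\<close>)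
qed

lemma koch_path_in_triangle:
  assumes "a \<noteq> b" "0 \<le> t" "t \<le> 1"
  shows "koch_path m a b t \<in> seg_triangle a b"
  using assms
proof (induction m arbitrary: a b t)
  case 0
  have "linepath a b t = seg_pt a b t 0"
    by (simp add: linepath_def seg_pt_def algebra_simps)
  then show ?case using 0 by (simp add: seg_triangle_def)
next
  case (Suc m)
  obtain c e u where *: "(c, e) \<in> koch_children a b" "0 \<le> u" "u \<le> 1"
    "koch_path (Suc m) a b t = koch_path m c e u"
    using koch_path_child[of t a b] Suc.prems by metis
  have "koch_path m c e u \<in> seg_triangle c e"
    using Suc.IH[OF koch_children_neq[OF *(1) Suc.prems(1)] *(2,3)] .
  then show ?case
    using seg_triangle_children[OF Suc.prems(1) *(1)] * by auto
qed

text \<open>After descending \<open>m\<close> generations both points lie in the triangle of one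
  segment of length \<open>norm (b - a) / 3 ^ m\<close>, whose diameter is at most twice that
  length.\<close>

lemma koch_path_step:
  assumes "a \<noteq> b" "0 \<le> t" "t \<le> 1"
  shows "dist (koch_path (Suc m) a b t) (koch_path m a b t) \<le> 2 * norm (b - a) / 3 ^ m"
  using assms
proof (induction m arbitrary: a b t)
  case 0
  then show ?case
    using seg_triangle_diameter[OF 0(1) koch_path_in_triangle[OF 0, of "Suc 0"] koch_path_in_triangle[OF 0, of 0]]
    by simp
next
  case (Suc m)
  obtain c e u where *: "(c, e) \<in> koch_children a b" "0 \<le> u" "u \<le> 1"
    "\<And>m. koch_path (Suc m) a b t = koch_path m c e u"
    using koch_path_child[of t a b] Suc.prems by metis
  have "dist (koch_path (Suc m) c e u) (koch_path m c e u) \<le> 2 * norm (e - c) / 3 ^ m"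
    using Suc.IH[OF koch_children_neq[OF *(1) Suc.prems(1)] *(2,3)] .
  then show ?case
    unfolding *(4) norm_koch_children[OF *(1)] by simp
qed

text \<open>\<open>koch_curve\<close> is defined by an unguarded \<open>lim\<close>; the geometric
  decay of the steps makes it a genuine limit on the unit interval.\<close>

lemma koch_path_convergent:
  assumes "a \<noteq> b" "0 \<le> t" "t \<le> 1"
  shows "(\<lambda>m. koch_path m a b t) \<longlonglongrightarrow> koch_curve a b t"
proof -
  have geom: "summable (\<lambda>m. 2 * norm (b - a) * (1/3) ^ m)"
    by (intro summable_mult summable_geometric) simp
  have "norm (koch_path (Suc m) a b t - koch_path m a b t) \<le> 2 * norm (b - a) * (1/3) ^ m" for m
  proof -
    have "2 * norm (b - a) * (1/3) ^ m = 2 * norm (b - a) / 3 ^ m"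
      by (simp add: power_divide)
    then show ?thesis using koch_path_step[OF assms, of m] by (metis dist_norm)
  qed
  then have "summable (\<lambda>m. norm (koch_path (Suc m) a b t - koch_path m a b t))"
    by (intro summable_comparison_test'[OF geom, of 0]) (simp only: real_norm_def abs_norm_cancel)
  then have "convergent (\<lambda>n. \<Sum>m<n. koch_path (Suc m) a b t - koch_path m a b t)"
    unfolding summable_iff_convergent[symmetric] by (rule summable_norm_cancel)
  then have "convergent (\<lambda>n. koch_path n a b t - koch_path 0 a b t)"
    unfolding sum_lessThan_telescope[of "\<lambda>n. koch_path n a b t"] .
  then have "convergent (\<lambda>n. koch_path n a b t)"
    by (simp only: convergent_diff_const_right_iff)
  then show ?thesis
    unfolding koch_curve_def by (simp only: convergent_LIMSEQ_iff)
qed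

lemma koch_curve_shift:
  assumes "\<And>m. koch_path (Suc m) a b t = koch_path m c e u"
  shows "koch_curve a b t = koch_curve c e u"
  unfolding koch_curve_def assms[symmetric] lim_def filterlim_sequentially_Suc[of "\<lambda>m. koch_path m a b t"] ..

text \<open>Both inclusions come from shifting the generation index by one, with the same child and
  parameter for all generations.\<close>

lemma koch_arc_children: "koch_arc a b = (\<Union>(c, e) \<in> koch_children a b. koch_arc c e)"
proof (intro equalityI subsetI)
  fix p assume "p \<in> koch_arc a b"
  then obtain t where t: "0 \<le> t" "t \<le> 1" "p = koch_curve a b t"
    unfolding path_image_def by auto
  obtain c e u where *: "(c, e) \<in> koch_children a b" "0 \<le> u" "u \<le> 1"
    "\<And>m. koch_path (Suc m) a b t = koch_path m c e u"
    using koch_path_child[OF t(1,2), of a b] by metis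
  then show "p \<in> (\<Union>(c, e) \<in> koch_children a b. koch_arc c e)"
    unfolding t(3) koch_curve_shift[OF *(4)] path_image_def by force
next
  fix p assume "p \<in> (\<Union>(c, e) \<in> koch_children a b. koch_arc c e)"
  then obtain c e u where *: "(c, e) \<in> koch_children a b" "0 \<le> u" "u \<le> 1" "p = koch_curve c e u"
    unfolding path_image_def by auto
  then obtain t where "0 \<le> t" "t \<le> 1" "\<And>m. koch_path (Suc m) a b t = koch_path m c e u"
    using koch_path_parent by metis
  then show "p \<in> koch_arc a b"
    unfolding *(4) path_image_def using koch_curve_shift[of a b t c e u] by force
qed

lemma koch_arc_child_subset: "(c, e) \<in> koch_children a b \<Longrightarrow> koch_arc c e \<subseteq> koch_arc a b"
  unfolding koch_arc_children[of a b] by auto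

lemma koch_arc_in_triangle: 
  assumes "a \<noteq> b"
  shows "koch_arc a b \<subseteq> seg_triangle a b"
proof
  fix p assume "p \<in> koch_arc a b"
  then obtain t where t: "0 \<le> t" "t \<le> 1" "p = koch_curve a b t"
    unfolding path_image_def by auto
  show "p \<in> seg_triangle a b"
    unfolding t(3)
    by (rule Lim_in_closed_set[OF closed_seg_triangle _ _ koch_path_convergent[OF assms t(1,2)]])
      (auto simp: koch_path_in_triangle[OF assms t(1,2)])
qed

lemma koch_curve_start: "koch_curve a b 0 = a"
  unfolding koch_curve_def using koch_path_ends(1) unfolding pathstart_def by (simp add: limI)

lemma koch_curve_finish: "koch_curve a b 1 = b"
  unfolding koch_curve_def using koch_path_ends(2) unfolding pathfinish_def by (simp add: limI)

lemma ends_in_koch_arc: "a \<in> koch_arc a b" "b \<in> koch_arc a b"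
proof -
  have "koch_curve a b 0 \<in> koch_arc a b" "koch_curve a b 1 \<in> koch_arc a b"
    by (simp_all add: path_image_def)
  then show "a \<in> koch_arc a b" "b \<in> koch_arc a b"
    by (simp_all only: koch_curve_start koch_curve_finish)
qed

text \<open>Supplies a point of the arc that lies in the open cell, in contrast to the end
  points.\<close>

lemma koch_third_in_arc: "koch_third a b \<in> koch_arc a b"
  using ends_in_koch_arc(2)[of "koch_third a b" a] koch_arc_child_subset[of a "koch_third a b" a b]
  by (auto simp: koch_children_def)

section \<open>The two sides of the snowflake curve\<close>

text \<open>Stated for arbitrary \<open>Z\<close>, because the inner side of the arc is followed with \<open>Z = \<Omega>\<close> and the
  outer side with \<open>Z = - \<Omega>\<close>.\<close>

definition arc_isolated :: "(real^2) set \<Rightarrow> real^2 \<Rightarrow> real^2 \<Rightarrow> bool" where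
  "arc_isolated Z a b \<longleftrightarrow> a \<noteq> b \<and> koch_arc a b \<subseteq> frontier Z \<and> frontier Z \<inter> seg_cell a b \<subseteq> koch_arc a b"

text \<open>\<open>seg_lower\<close>, \<open>seg_left\<close> and \<open>seg_right\<close> are the
  three open triangles that remain of the pentagon when the closed triangle carrying the arc is cut
  out: one on the inner side, two on the outer side.\<close>

definition seg_lower :: "real^2 \<Rightarrow> real^2 \<Rightarrow> (real^2) set" where
  "seg_lower = seg_poly [(0,1,0), (-1,-3,0), (1,-3,1)]"

definition seg_left :: "real^2 \<Rightarrow> real^2 \<Rightarrow> (real^2) set" where
  "seg_left = seg_poly [(1,-3,0), (-1,1,0), (0,1,1/6)]"

definition seg_right :: "real^2 \<Rightarrow> real^2 \<Rightarrow> (real^2) set" where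
  "seg_right = seg_poly [(-1,-3,-1), (1,1,1), (0,1,1/6)]"

text \<open>Convex passages between the four triangles of the replacements: one through the removed middle
  third and one through each of the two outer notches.\<close>

definition seg_gate :: "real^2 \<Rightarrow> real^2 \<Rightarrow> (real^2) set" where
  "seg_gate = seg_poly [(-1,1,-1/3), (1,1,2/3), (-1,-3,0), (1,-3,1), (-1,1,0), (1,1,1), (0,1,1/6)]"

definition seg_left_gate :: "real^2 \<Rightarrow> real^2 \<Rightarrow> (real^2) set" where
  "seg_left_gate = seg_poly [(1,0,1/3), (-1,-3,-1/3), (-1,-3,0), (1,-3,1), (-1,1,0), (1,1,1), (0,1,1/6)]"

definition seg_right_gate :: "real^2 \<Rightarrow> real^2 \<Rightarrow> (real^2) set" where
  "seg_right_gate = seg_poly [(-1,0,-2/3), (1,-3,2/3), (-1,-3,0), (1,-3,1), (-1,1,0), (1,1,1), (0,1,1/6)]"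

lemma connected_seg_regions:
  "connected (seg_lower a b)" "connected (seg_left a b)" "connected (seg_right a b)"
  "connected (seg_gate a b)" "connected (seg_left_gate a b)" "connected (seg_right_gate a b)"
  by (simp_all add: seg_lower_def seg_left_def seg_right_def seg_gate_def seg_left_gate_def seg_right_gate_def)

lemma mem_seg_lower: "p \<in> seg_lower a b \<longleftrightarrow>
    seg_v a b p < 0 \<and> 0 < seg_x a b p + 3 * seg_v a b p \<and> seg_x a b p < 1 + 3 * seg_v a b p"
  unfolding seg_lower_def seg_poly_def by auto

lemma mem_seg_left: "p \<in> seg_left a b \<longleftrightarrow>
    seg_x a b p < 3 * seg_v a b p \<and> seg_v a b p < seg_x a b p \<and> seg_v a b p < 1/6"
  unfolding seg_left_def seg_poly_def by auto

lemma mem_seg_right: "p \<in> seg_right a b \<longleftrightarrow>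
    1 - seg_x a b p < 3 * seg_v a b p \<and> seg_v a b p < 1 - seg_x a b p \<and> seg_v a b p < 1/6"
  unfolding seg_right_def seg_poly_def by auto

lemma mem_seg_gate: "p \<in> seg_gate a b \<longleftrightarrow> p \<in> seg_cell a b \<and>
    seg_v a b p < seg_x a b p - 1/3 \<and> seg_v a b p < 2/3 - seg_x a b p"
  unfolding seg_gate_def mem_seg_cell seg_poly_def by auto

lemma mem_seg_left_gate: "p \<in> seg_left_gate a b \<longleftrightarrow> p \<in> seg_cell a b \<and>
    seg_x a b p < 1/3 \<and> 1/3 < seg_x a b p + 3 * seg_v a b p"
  unfolding seg_left_gate_def mem_seg_cell seg_poly_def by auto

lemma mem_seg_right_gate: "p \<in> seg_right_gate a b \<longleftrightarrow> p \<in> seg_cell a b \<and>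
    2/3 < seg_x a b p \<and> seg_x a b p < 2/3 + 3 * seg_v a b p"
  unfolding seg_right_gate_def mem_seg_cell seg_poly_def by auto

lemmas seg_regions = mem_seg_cell mem_seg_lower mem_seg_left mem_seg_right mem_seg_gate
  mem_seg_left_gate mem_seg_right_gate

text \<open>Stands in for Jordan's theorem: a connected region off the frontier lies wholly on one
  side, and a single point of contact decides on which.\<close>

lemma connected_subset_if_no_frontier:
  assumes "connected S" "S \<inter> frontier Z = {}" "S \<inter> Z \<noteq> {}"
  shows "S \<subseteq> Z"
  using connected_Int_frontier[OF assms(1,3)] assms(2) by auto

text \<open>A child's arc lies in its closed triangle, so this keeps every arc out of the cells of
  its siblings; it is what lets isolation pass to the children.\<close>

lemma seg_triangle_cell_children_disjoint:
  assumes "a \<noteq> b" "(c, e) \<in> koch_children a b" "(c', e') \<in> koch_children a b" "(c, e) \<noteq> (c', e')"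
  shows "seg_triangle c e \<inter> seg_cell c' e' = {}"
proof (rule equals0I)
  fix p assume "p \<in> seg_triangle c e \<inter> seg_cell c' e'"
  then have p: "p \<in> seg_triangle c e" "p \<in> seg_cell c' e'" by auto
  note co = koch_children_coords[OF assms(1), of p]
  show False
    using assms(2)
  proof (cases rule: koch_children_cases)
    case 1
    note A = p(1)[unfolded 1 seg_triangle_def mem_Collect_eq]
    show False using assms(3)
    proof (cases rule: koch_children_cases)
      case 2 then show False using A p(2)[unfolded 2 mem_seg_cell] co(1-4) by argo
    next case 3 then show False using A p(2)[unfolded 3 mem_seg_cell] co(1,2,5,6) by argo
    next case 4 then show False using A p(2)[unfolded 4 mem_seg_cell] co(1,2,7,8) by argo
    qed (use 1 assms(4) in auto)
  next
    case 2
    note A = p(1)[unfolded 2 seg_triangle_def mem_Collect_eq]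
    show False using assms(3)
    proof (cases rule: koch_children_cases)
      case 1 then show False using A p(2)[unfolded 1 mem_seg_cell] co(1-4) by argo
    next case 3 then show False using A p(2)[unfolded 3 mem_seg_cell] co(3-6) by argo
    next case 4 then show False using A p(2)[unfolded 4 mem_seg_cell] co(3,4,7,8) by argo
    qed (use 2 assms(4) in auto)
  next
    case 3
    note A = p(1)[unfolded 3 seg_triangle_def mem_Collect_eq]
    show False using assms(3)
    proof (cases rule: koch_children_cases)
      case 1 then show False using A p(2)[unfolded 1 mem_seg_cell] co(1,2,5,6) by argo
    next case 2 then show False using A p(2)[unfolded 2 mem_seg_cell] co(3-6) by argo
    next case 4 then show False using A p(2)[unfolded 4 mem_seg_cell] co(5-8) by argo
    qed (use 3 assms(4) in auto)
  next
    case 4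
    note A = p(1)[unfolded 4 seg_triangle_def mem_Collect_eq]
    show False using assms(3)
    proof (cases rule: koch_children_cases)
      case 1 then show False using A p(2)[unfolded 1 mem_seg_cell] co(1,2,7,8) by argo
    next case 2 then show False using A p(2)[unfolded 2 mem_seg_cell] co(3,4,7,8) by argo
    next case 3 then show False using A p(2)[unfolded 3 mem_seg_cell] co(5-8) by argo
    qed (use 4 assms(4) in auto)
  qed
qed

section \<open>Passing isolation and sides on to the four replacements\<close>

lemma arc_isolated_children:
  assumes "arc_isolated Z a b" "(c, e) \<in> koch_children a b"
  shows "arc_isolated Z c e"
proof -
  have ab: "a \<noteq> b" using assms(1) by (simp add: arc_isolated_def)
  have "frontier Z \<inter> seg_cell c e \<subseteq> koch_arc c e"
  proof
    fix p assume p: "p \<in> frontier Z \<inter> seg_cell c e"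
    then have "p \<in> koch_arc a b"
      using assms(1) seg_cell_children[OF ab assms(2)] unfolding arc_isolated_def by auto
    then obtain c' e' where c': "(c', e') \<in> koch_children a b" "p \<in> koch_arc c' e'"
      unfolding koch_arc_children[of a b] by auto
    then have "p \<in> seg_triangle c' e'"
      using koch_arc_in_triangle[OF koch_children_neq[OF c'(1) ab]] by auto
    then have "(c, e) = (c', e')"
      using seg_triangle_cell_children_disjoint[OF ab c'(1) assms(2)] p by auto
    then show "p \<in> koch_arc c e" using c' by simp
  qed
  then show ?thesis
    using assms(1) koch_arc_child_subset[OF assms(2)] koch_children_neq[OF assms(2) ab]
    unfolding arc_isolated_def by auto
qed

text \<open>Inside an isolated cell the frontier lies on the children's arcs and hence in their
  triangles, so avoiding these triangles is enough.\<close>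

lemma no_frontier_off_children:
  assumes "arc_isolated Z a b" "S \<subseteq> seg_cell a b"
    "\<And>c e. (c, e) \<in> koch_children a b \<Longrightarrow> S \<inter> seg_triangle c e = {}"
  shows "S \<inter> frontier Z = {}"
proof (rule equals0I)
  have ab: "a \<noteq> b" using assms(1) by (simp add: arc_isolated_def)
  fix p assume p: "p \<in> S \<inter> frontier Z"
  then have "p \<in> koch_arc a b"
    using assms(1,2) unfolding arc_isolated_def by auto
  then obtain c e where c: "(c, e) \<in> koch_children a b" "p \<in> koch_arc c e"
    unfolding koch_arc_children[of a b] by auto
  then show False
    using koch_arc_in_triangle[OF koch_children_neq[OF c(1) ab]] assms(3)[OF c(1)] p by auto
qed

lemma gates_off_children:
  assumes "a \<noteq> b" "(c, e) \<in> koch_children a b"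
  shows "seg_gate a b \<inter> seg_triangle c e = {}" "seg_left_gate a b \<inter> seg_triangle c e = {}"
    "seg_right_gate a b \<inter> seg_triangle c e = {}"
proof -
  have "p \<notin> seg_gate a b \<and> p \<notin> seg_left_gate a b \<and> p \<notin> seg_right_gate a b" if p: "p \<in> seg_triangle c e" for p
  proof -
    note co = koch_children_coords[OF assms(1), of p]
    note P = p[unfolded seg_triangle_def mem_Collect_eq]
    show ?thesis
      using assms(2)
    proof (cases rule: koch_children_cases)
      case 1 then show ?thesis using P[unfolded 1] co(1,2) unfolding seg_regions by argo
    next case 2 then show ?thesis using P[unfolded 2] co(3,4) unfolding seg_regions by argo
    next case 3 then show ?thesis using P[unfolded 3] co(5,6) unfolding seg_regions by argo
    next case 4 then show ?thesis using P[unfolded 4] co(7,8) unfolding seg_regions by argo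
    qed
  qed
  then show "seg_gate a b \<inter> seg_triangle c e = {}" "seg_left_gate a b \<inter> seg_triangle c e = {}"
    "seg_right_gate a b \<inter> seg_triangle c e = {}" by auto
qed

lemma gates_no_frontier:
  assumes "arc_isolated Z a b"
  shows "seg_gate a b \<inter> frontier Z = {}" "seg_left_gate a b \<inter> frontier Z = {}"
    "seg_right_gate a b \<inter> frontier Z = {}"
proof -
  have ab: "a \<noteq> b" using assms by (simp add: arc_isolated_def)
  show "seg_gate a b \<inter> frontier Z = {}" "seg_left_gate a b \<inter> frontier Z = {}"
    "seg_right_gate a b \<inter> frontier Z = {}"
    by (rule no_frontier_off_children[OF assms]; use gates_off_children[OF ab] in \<open>auto simp: seg_regions\<close>)+
qed

lemma seg_gate_subset:
  assumes "arc_isolated Z a b" "seg_lower a b \<subseteq> Z"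
  shows "seg_gate a b \<subseteq> Z"
proof (rule connected_subset_if_no_frontier)
  have ab: "a \<noteq> b" using assms by (simp add: arc_isolated_def)
  show "connected (seg_gate a b)" by (rule connected_seg_regions)
  show "seg_gate a b \<inter> frontier Z = {}" by (rule gates_no_frontier[OF assms(1)])
  \<comment> \<open>A point slightly below the midpoint of the base serves as the contact between
    the two regions.\<close>
  have "seg_pt a b (1/2) (-1/20) \<in> seg_gate a b \<inter> seg_lower a b"
    using ab by (simp add: seg_regions)
  then show "seg_gate a b \<inter> Z \<noteq> {}" using assms(2) by auto
qed

lemma seg_left_gate_subset:
  assumes "arc_isolated Z a b" "seg_left a b \<subseteq> Z"
  shows "seg_left_gate a b \<subseteq> Z"
proof (rule connected_subset_if_no_frontier)
  have ab: "a \<noteq> b" using assms by (simp add: arc_isolated_def)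
  show "connected (seg_left_gate a b)" by (rule connected_seg_regions)
  show "seg_left_gate a b \<inter> frontier Z = {}" by (rule gates_no_frontier[OF assms(1)])
  have "seg_pt a b (1/4) (1/8) \<in> seg_left_gate a b \<inter> seg_left a b"
    using ab by (simp add: seg_regions)
  then show "seg_left_gate a b \<inter> Z \<noteq> {}" using assms(2) by auto
qed

lemma seg_right_gate_subset:
  assumes "arc_isolated Z a b" "seg_right a b \<subseteq> Z"
  shows "seg_right_gate a b \<subseteq> Z"
proof (rule connected_subset_if_no_frontier)
  have ab: "a \<noteq> b" using assms by (simp add: arc_isolated_def)
  show "connected (seg_right_gate a b)" by (rule connected_seg_regions)
  show "seg_right_gate a b \<inter> frontier Z = {}" by (rule gates_no_frontier[OF assms(1)])
  have "seg_pt a b (3/4) (1/8) \<in> seg_right_gate a b \<inter> seg_right a b"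
    using ab by (simp add: seg_regions)
  then show "seg_right_gate a b \<inter> Z \<noteq> {}" using assms(2) by auto
qed

text \<open>Over the two outer thirds the inner triangle merely shrinks; along the two new sides it
  points into the passage through the removed middle third.\<close>

lemma seg_lower_children:
  assumes "a \<noteq> b" "(c, e) \<in> koch_children a b"
  shows "seg_lower c e \<subseteq> seg_lower a b \<union> seg_gate a b"
proof
  fix p assume p: "p \<in> seg_lower c e"
  note co = koch_children_coords[OF assms(1), of p]
  note P = p[unfolded mem_seg_lower]
  show "p \<in> seg_lower a b \<union> seg_gate a b"
    using assms(2)
  proof (cases rule: koch_children_cases)
    case 1 then show ?thesis using P[unfolded 1] co(1,2) unfolding Un_iff seg_regions by argo
  next case 2 then show ?thesis using P[unfolded 2] co(3,4) unfolding Un_iff seg_regions by argo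
  next case 3 then show ?thesis using P[unfolded 3] co(5,6) unfolding Un_iff seg_regions by argo
  next case 4 then show ?thesis using P[unfolded 4] co(7,8) unfolding Un_iff seg_regions by argo
  qed
qed

text \<open>Left and right may mix under the turned similarities, so only the union is tracked; both
  sides are outer ones, joined to each other's descendants through the two notches.\<close>

lemma seg_sides_children:
  assumes "a \<noteq> b" "(c, e) \<in> koch_children a b"
  shows "seg_left c e \<union> seg_right c e \<subseteq> seg_left a b \<union> seg_right a b \<union> seg_left_gate a b \<union> seg_right_gate a b"
proof
  fix p assume p: "p \<in> seg_left c e \<union> seg_right c e"
  note co = koch_children_coords[OF assms(1), of p]
  note P = p[unfolded Un_iff mem_seg_left mem_seg_right]
  show "p \<in> seg_left a b \<union> seg_right a b \<union> seg_left_gate a b \<union> seg_right_gate a b"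
    using assms(2)
  proof (cases rule: koch_children_cases)
    case 1 then show ?thesis using P[unfolded 1] co(1,2) unfolding Un_iff seg_regions by argo
  next case 2 then show ?thesis using P[unfolded 2] co(3,4) unfolding Un_iff seg_regions by argo
  next case 3 then show ?thesis using P[unfolded 3] co(5,6) unfolding Un_iff seg_regions by argo
  next case 4 then show ?thesis using P[unfolded 4] co(7,8) unfolding Un_iff seg_regions by argo
  qed
qed

text \<open>A point of the cell is thus either in a region whose side can be determined or in a
  smaller triangle; the descent below iterates this alternative.\<close>

lemma seg_cell_cover:
  assumes "a \<noteq> b" "p \<in> seg_cell a b"
  shows "p \<in> seg_lower a b \<union> seg_gate a b \<union> seg_left a b \<union> seg_right a b \<union> seg_left_gate a b \<union> seg_right_gate a b
    \<or> (\<exists>(c, e) \<in> koch_children a b. p \<in> seg_triangle c e)"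
proof (rule ccontr)
  note co = koch_children_coords[OF assms(1), of p]
  assume n: "\<not> ?thesis"
  then have t: "p \<notin> seg_triangle a (koch_third a b)" "p \<notin> seg_triangle (koch_third a b) (koch_apex a b)"
    "p \<notin> seg_triangle (koch_apex a b) (koch_two_thirds a b)" "p \<notin> seg_triangle (koch_two_thirds a b) b"
    unfolding koch_children_def by auto
  have u: "p \<notin> seg_lower a b" "p \<notin> seg_gate a b" "p \<notin> seg_left a b" "p \<notin> seg_right a b" 
    "p \<notin> seg_left_gate a b" "p \<notin> seg_right_gate a b" using n by auto
  define x v where "x = seg_x a b p" and "v = seg_v a b p"
  have "\<not> (0 \<le> v \<and> 3 * v \<le> x \<and> 3 * v \<le> 1/3 - x)"
    using t(1) co(1,2) unfolding seg_triangle_def mem_Collect_eq x_def v_def by argo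
  moreover have "\<not> (x - 1/3 \<le> v \<and> 3 * v \<le> x \<and> 1/3 \<le> x)"
    using t(2) co(3,4) unfolding seg_triangle_def mem_Collect_eq x_def v_def by argo
  moreover have "\<not> (2/3 - x \<le> v \<and> 3 * v \<le> 1 - x \<and> x \<le> 2/3)"
    using t(3) co(5,6) unfolding seg_triangle_def mem_Collect_eq x_def v_def by argo
  moreover have "\<not> (0 \<le> v \<and> 3 * v \<le> 1 - x \<and> 3 * v \<le> x - 2/3)"
    using t(4) co(7,8) unfolding seg_triangle_def mem_Collect_eq x_def v_def by argo
  moreover have "0 < x + 3 * v" "x < 1 + 3 * v" "v < x" "v < 1 - x" "v < 1/6"
    using assms(2) unfolding mem_seg_cell x_def v_def by auto
  moreover have "v \<ge> 0" "\<not> (v < x - 1/3 \<and> v < 2/3 - x)" "\<not> x < 3 * v" "\<not> 1 - x < 3 * v"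
    "\<not> (x < 1/3 \<and> 1/3 < x + 3 * v)" "\<not> (2/3 < x \<and> x < 2/3 + 3 * v)"
    using u assms(2) unfolding seg_regions x_def v_def by argo+
  ultimately show False by argo
qed

text \<open>The three exceptional corners lie on the arc, so an open set that avoids its frontier
  does not contain them.\<close>

lemma seg_triangle_cell:
  assumes "a \<noteq> b" "p \<in> seg_triangle a b"
  shows "p \<in> seg_cell a b \<or> p = a \<or> p = b \<or> p = koch_apex a b"
proof (rule ccontr)
  assume n: "\<not> ?thesis"
  have p: "p = seg_pt a b (seg_x a b p) (seg_v a b p)" using assms(1) by simp
  have "\<not> (seg_x a b p = 0 \<and> seg_v a b p = 0)" "\<not> (seg_x a b p = 1 \<and> seg_v a b p = 0)"
    "\<not> (seg_x a b p = 1/2 \<and> seg_v a b p = 1/6)"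
    using n p seg_pt_ends[of a b] koch_points(3)[of a b] by metis+
  then show False
    using n assms(2) unfolding mem_seg_cell seg_triangle_def mem_Collect_eq by argo
qed

text \<open>Descent: a point of \<Omega> in the triangle avoids all regions known to be outside,
  hence lies in the triangle of some child. After finitely many generations that triangle fits into
  a ball around the point inside \<Omega>, although its corner is a frontier point.\<close>

lemma seg_triangle_misses_open:
  assumes "open \<Omega>" "arc_isolated \<Omega> a b" "seg_lower a b \<inter> \<Omega> = {}" "seg_left a b \<inter> \<Omega> = {}" "seg_right a b \<inter> \<Omega> = {}"
  shows "seg_triangle a b \<inter> \<Omega> = {}"
proof (rule equals0I)
  fix p assume p: "p \<in> seg_triangle a b \<inter> \<Omega>"
  obtain r where r: "r > 0" "ball p r \<subseteq> \<Omega>" using p assms(1) open_contains_ball by blast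
  have fr: "frontier \<Omega> \<inter> \<Omega> = {}" using frontier_disjoint_eq assms(1) by auto
  \<comment> \<open>Phrased for \<open>- \<Omega>\<close>, because the passages transport inclusions
    and here it is the complement that is followed.\<close>
  have False if "2 * norm (b - a) < r * 3 ^ n" "p \<in> seg_triangle a b"
    "arc_isolated (- \<Omega>) a b" "seg_lower a b \<subseteq> - \<Omega>" "seg_left a b \<subseteq> - \<Omega>" "seg_right a b \<subseteq> - \<Omega>" for n a b
    using that
  proof (induction n arbitrary: a b)
    case 0
    then have ab: "a \<noteq> b" by (simp add: arc_isolated_def)
    have "dist p a < r"
      using seg_triangle_diameter[OF ab 0(2) ends_in_seg_triangle(1)[OF ab]] 0(1) by simp
    then have "a \<in> \<Omega>" using r by auto
    moreover have "a \<in> frontier \<Omega>"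
      using 0(3) ends_in_koch_arc(1)[of a b] by (auto simp: arc_isolated_def)
    ultimately show False using fr by auto
  next
    case (Suc n)
    then have ab: "a \<noteq> b" by (simp add: arc_isolated_def)
    have "(koch_apex a b, koch_two_thirds a b) \<in> koch_children a b" by (simp add: koch_children_def)
    then have "a \<in> koch_arc a b" "b \<in> koch_arc a b" "koch_apex a b \<in> koch_arc a b"
      using koch_arc_child_subset[of "koch_apex a b" "koch_two_thirds a b" a b]
      by (auto simp: ends_in_koch_arc intro: ends_in_koch_arc(1))
    then have "p \<in> seg_cell a b"
      using seg_triangle_cell[OF ab Suc.prems(2)] Suc.prems(3) p fr
      unfolding arc_isolated_def by auto
    moreover have "p \<notin> seg_lower a b \<union> seg_gate a b \<union> seg_left a b \<union> seg_right a b \<union> seg_left_gate a b \<union> seg_right_gate a b"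
      using p Suc.prems(4-6) seg_gate_subset[OF Suc.prems(3,4)] seg_left_gate_subset[OF Suc.prems(3,5)]
        seg_right_gate_subset[OF Suc.prems(3,6)] by auto
    ultimately obtain c e where c: "(c, e) \<in> koch_children a b" "p \<in> seg_triangle c e"
      using seg_cell_cover[OF ab, of p] by auto
    show False
    proof (rule Suc.IH[OF _ c(2) arc_isolated_children[OF Suc.prems(3) c(1)]])
      show "2 * norm (e - c) < r * 3 ^ n"
        using Suc.prems(1) norm_koch_children[OF c(1)] by simp
      show "seg_lower c e \<subseteq> - \<Omega>"
        using seg_lower_children[OF ab c(1)] seg_gate_subset[OF Suc.prems(3,4)] Suc.prems(4) by blast
      show "seg_left c e \<subseteq> - \<Omega>" "seg_right c e \<subseteq> - \<Omega>"
        using seg_sides_children[OF ab c(1)] seg_left_gate_subset[OF Suc.prems(3,5)]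
          seg_right_gate_subset[OF Suc.prems(3,6)] Suc.prems(5,6) by blast+
    qed
  qed
  moreover obtain n where "2 * norm (b - a) / r < 3 ^ n"
    using real_arch_pow[of 3 "2 * norm (b - a) / r"] by auto
  then have "2 * norm (b - a) < r * 3 ^ n" using r by (simp add: field_simps)
  ultimately show False
    using p assms(2-5) unfolding arc_isolated_def frontier_complement by blast
qed

section \<open>The invariant that fixes the inner and the outer side\<close>

definition arc_separates :: "(real^2) set \<Rightarrow> real^2 \<Rightarrow> real^2 \<Rightarrow> bool" where
  "arc_separates \<Omega> a b \<longleftrightarrow> arc_isolated \<Omega> a b \<and> seg_lower a b \<subseteq> \<Omega> \<and> seg_left a b \<subseteq> - \<Omega> \<and> seg_right a b \<subseteq> - \<Omega>"

lemma arc_separates_gates: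
  assumes "arc_separates \<Omega> a b"
  shows "seg_gate a b \<subseteq> \<Omega>" "seg_left_gate a b \<subseteq> - \<Omega>" "seg_right_gate a b \<subseteq> - \<Omega>"
proof -
  have 1: "arc_isolated \<Omega> a b" using assms by (simp add: arc_separates_def)
  then have 2: "arc_isolated (- \<Omega>) a b" by (simp add: arc_isolated_def frontier_complement)
  show "seg_gate a b \<subseteq> \<Omega>" "seg_left_gate a b \<subseteq> - \<Omega>" "seg_right_gate a b \<subseteq> - \<Omega>"
    using assms seg_gate_subset[OF 1] seg_left_gate_subset[OF 2] seg_right_gate_subset[OF 2]
    by (simp_all add: arc_separates_def)
qed

lemma arc_separates_children:
  assumes "arc_separates \<Omega> a b" "(c, e) \<in> koch_children a b"
  shows "arc_separates \<Omega> c e"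
proof -
  have ab: "a \<noteq> b" using assms by (simp add: arc_separates_def arc_isolated_def)
  show ?thesis
    using assms(1) arc_isolated_children[OF _ assms(2)] seg_lower_children[OF ab assms(2)] seg_sides_children[OF ab assms(2)]
      arc_separates_gates[OF assms(1)]
    unfolding arc_separates_def by blast
qed

text \<open>The first centre lies in the mouth of the removed third, the second in the left outer
  notch. Inside these balls both coordinates move by less than 1/100, which is within the slack of
  all defining inequalities.\<close>

lemma ball_in_seg_gates:
  assumes "a \<noteq> b"
  shows "ball (seg_pt a b (1/2) 0) (norm (b - a) / 100) \<subseteq> seg_gate a b"
    and "ball (seg_pt a b (5/18) (1/18)) (norm (b - a) / 100) \<subseteq> seg_left_gate a b"
proof -
  have n: "norm (b - a) > 0" using assms by simp
  have *: "\<bar>seg_x a b p - x\<bar> < 1/100 \<and> \<bar>seg_v a b p - v\<bar> < 1/100"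
    if "p \<in> ball (seg_pt a b x v) (norm (b - a) / 100)" for p x v
  proof -
    have "dist p (seg_pt a b x v) < norm (b - a) / 100" using that by (simp add: dist_commute)
    then have "dist p (seg_pt a b x v) / norm (b - a) < 1/100" using n by (simp add: field_simps)
    then show ?thesis
      using seg_coords_dist[OF assms, of p "seg_pt a b x v", unfolded seg_coords[OF assms]]
      by (meson le_less_trans)
  qed
  show "ball (seg_pt a b (1/2) 0) (norm (b - a) / 100) \<subseteq> seg_gate a b"
    by (rule subsetI, drule *) (unfold seg_regions, argo)
  show "ball (seg_pt a b (5/18) (1/18)) (norm (b - a) / 100) \<subseteq> seg_left_gate a b"
    by (rule subsetI, drule *) (unfold seg_regions, argo)
qed

text \<open>Equal sides fix the inner product of two edges, Lagrange's identity then fixes the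
  square of their determinant, and the orientation its sign. The vertex gets a negative
  \<open>v\<close>, so the apexes of the construction are on the outer side.\<close>

lemma ccw_third_vertex:
  assumes "ccw_equilateral_triangle A B C"
  shows "A \<noteq> B" "C = seg_pt A B (1/2) (-1/2)"
proof -
  define b1 b2 c1 c2 where "b1 = (B - A) $ 1" "b2 = (B - A) $ 2" "c1 = (C - A) $ 1" "c2 = (C - A) $ 2"
  note d = b1_b2_c1_c2_def
  have pos: "0 < b1 * c2 - b2 * c1" using assms unfolding ccw_equilateral_triangle_def d by simp
  then show ne: "A \<noteq> B" unfolding d by auto
  have eq: "b1\<^sup>2 + b2\<^sup>2 = c1\<^sup>2 + c2\<^sup>2" "b1\<^sup>2 + b2\<^sup>2 = (c1 - b1)\<^sup>2 + (c2 - b2)\<^sup>2"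
  proof -
    have "dist A B = dist C A" "dist A B = dist B C" using assms unfolding ccw_equilateral_triangle_def by auto
    then have "(norm (B - A))\<^sup>2 = (norm (C - A))\<^sup>2" "(norm (B - A))\<^sup>2 = (norm (C - B))\<^sup>2"
      by (simp_all add: dist_norm norm_minus_commute)
    then show "b1\<^sup>2 + b2\<^sup>2 = c1\<^sup>2 + c2\<^sup>2" "b1\<^sup>2 + b2\<^sup>2 = (c1 - b1)\<^sup>2 + (c2 - b2)\<^sup>2"
      unfolding norm_vec2 d by simp_all
  qed
  define n where "n = b1\<^sup>2 + b2\<^sup>2"
  have n: "n = (norm (B - A))\<^sup>2" unfolding n_def norm_vec2 d by simp
  then have n0: "n > 0" using ne by simp
  have dot: "2 * (b1 * c1 + b2 * c2) = n"
    using eq unfolding n_def by (simp add: power2_eq_square algebra_simps)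
  have "4 * ((b1 * c2 - b2 * c1)\<^sup>2 + (b1 * c1 + b2 * c2)\<^sup>2) = 4 * ((b1\<^sup>2 + b2\<^sup>2) * (c1\<^sup>2 + c2\<^sup>2))"
    by (simp add: power2_eq_square algebra_simps)
  also have "\<dots> = 4 * n\<^sup>2" using eq(1) by (simp add: n_def power2_eq_square)
  finally have "4 * (b1 * c2 - b2 * c1)\<^sup>2 + (2 * (b1 * c1 + b2 * c2))\<^sup>2 = 4 * n\<^sup>2"
    by (simp add: power_mult_distrib del: distrib_left_numeral)
  then have "(2 * (b1 * c2 - b2 * c1))\<^sup>2 = (sqrt 3 * n)\<^sup>2"
    unfolding dot by (simp add: power_mult_distrib del: right_diff_distrib_numeral)
  then have cross: "2 * (b1 * c2 - b2 * c1) = sqrt 3 * n"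
    by (rule power2_eq_imp_eq) (use pos n0 in auto)
  have "seg_x A B C = 1/2"
    unfolding seg_x_def inner_vec2 n[symmetric] using dot n0 by (simp add: d field_simps)
  moreover have "seg_v A B C = -1/2"
  proof -
    have "(C - A) \<bullet> right_normal (B - A) = - (b1 * c2 - b2 * c1)"
      unfolding inner_vec2 d by (simp add: algebra_simps)
    also have "\<dots> = - (sqrt 3 * n / 2)" using cross by simp
    finally show ?thesis unfolding seg_v_def n[symmetric] using n0 by simp
  qed
  ultimately show "C = seg_pt A B (1/2) (-1/2)"
    using seg_pt_coords[OF ne, of C] by metis
qed

lemma ccw_rotate:
  assumes "ccw_equilateral_triangle A B C"
  shows "ccw_equilateral_triangle B C A"
  using assms unfolding ccw_equilateral_triangle_def by (simp add: algebra_simps)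

text \<open>Brings the triangles of the other two sides into the coordinates of \<open>A B\<close>,
  so that all three arcs can be compared by linear arithmetic.\<close>

lemma ccw_coords:
  assumes "ccw_equilateral_triangle A B C"
  shows "seg_x A B p = 1 - seg_x B C p / 2 + 3 * seg_v B C p / 2"
    and "seg_v A B p = - seg_x B C p / 2 - seg_v B C p / 2"
    and "seg_x A B p = 1/2 - seg_x C A p / 2 - 3 * seg_v C A p / 2"
    and "seg_v A B p = - 1/2 + seg_x C A p / 2 - seg_v C A p / 2"
proof -
  note AB = ccw_third_vertex[OF assms]
  have BC: "B \<noteq> C" and CA: "C \<noteq> A"
    using ccw_third_vertex(1)[OF ccw_rotate[OF assms]] ccw_third_vertex(1)[OF ccw_rotate[OF ccw_rotate[OF assms]]] by auto
  have "seg_pt B C x v = seg_pt A B (1 - x / 2 + 3 * v / 2) (- x / 2 - v / 2)" for x v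
    unfolding AB(2) seg_pt_def vec2_eq_iff by (simp add: field_simps)
  from this[of "seg_x B C p" "seg_v B C p"] seg_pt_coords[OF BC, of p]
  show "seg_x A B p = 1 - seg_x B C p / 2 + 3 * seg_v B C p / 2"
    "seg_v A B p = - seg_x B C p / 2 - seg_v B C p / 2"
    using seg_coords[OF AB(1)] by metis+
  have "seg_pt C A x v = seg_pt A B (1/2 - x / 2 - 3 * v / 2) (- 1/2 + x / 2 - v / 2)" for x v
    unfolding AB(2) seg_pt_def vec2_eq_iff by (simp add: field_simps)
  from this[of "seg_x C A p" "seg_v C A p"] seg_pt_coords[OF CA, of p]
  show "seg_x A B p = 1/2 - seg_x C A p / 2 - 3 * seg_v C A p / 2"
    "seg_v A B p = - 1/2 + seg_x C A p / 2 - seg_v C A p / 2"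
    using seg_coords[OF AB(1)] by metis+
qed

text \<open>The other two arcs stay off the cell of \<open>A B\<close>; the upper regions extend to
  infinity without meeting the curve while \<Omega> is bounded; and the initial triangle cannot miss
  \<Omega>, since then the arc inside the cell would not be in the frontier.\<close>

lemma snowflake_arc_separates:
  assumes tri: "ccw_equilateral_triangle A B C" and \<Omega>: "open \<Omega>" "bounded \<Omega>" "frontier \<Omega> = snowflake_curve A B C"
  shows "arc_separates \<Omega> A B"
proof -
  note AB = ccw_third_vertex[OF tri]
  have BC: "B \<noteq> C" and CA: "C \<noteq> A"
    using ccw_third_vertex(1)[OF ccw_rotate[OF tri]] ccw_third_vertex(1)[OF ccw_rotate[OF ccw_rotate[OF tri]]] by auto
  have K: "p \<in> koch_arc A B \<or> p \<in> seg_triangle B C \<or> p \<in> seg_triangle C A" if "p \<in> frontier \<Omega>" for p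
    using that koch_arc_in_triangle[OF BC] koch_arc_in_triangle[OF CA] unfolding \<Omega>(3) snowflake_curve_def by auto
  have K': "p \<in> seg_triangle A B \<or> p \<in> seg_triangle B C \<or> p \<in> seg_triangle C A" if "p \<in> frontier \<Omega>" for p
    using K[OF that] koch_arc_in_triangle[OF AB(1)] by auto
  have co: "seg_x A B p = 1 - seg_x B C p / 2 + 3 * seg_v B C p / 2" 
    "seg_v A B p = - seg_x B C p / 2 - seg_v B C p / 2"
    "seg_x A B p = 1/2 - seg_x C A p / 2 - 3 * seg_v C A p / 2"
    "seg_v A B p = - 1/2 + seg_x C A p / 2 - seg_v C A p / 2" for p
    using ccw_coords[OF tri] by auto
  have iso: "arc_isolated \<Omega> A B"
  proof -
    have "p \<in> koch_arc A B" if "p \<in> frontier \<Omega>" "p \<in> seg_cell A B" for p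
    proof -
      have "p \<notin> seg_triangle B C" "p \<notin> seg_triangle C A"
        using that(2) co(1,2)[of p] co(3,4)[of p] unfolding seg_triangle_def mem_Collect_eq mem_seg_cell by argo+
      then show ?thesis using K[OF that(1)] by simp
    qed
    then show ?thesis
      using AB(1) \<Omega>(3) unfolding arc_isolated_def snowflake_curve_def by auto
  qed
  \<comment> \<open>\<open>T\<close> is the open initial triangle.\<close>
  define T where "T = seg_poly [(0,1,0), (-1,-1,0), (1,-1,1)] A B"
  have memT: "p \<in> T \<longleftrightarrow> seg_v A B p < 0 \<and> 0 < seg_x A B p + seg_v A B p \<and> seg_x A B p < 1 + seg_v A B p" for p
    unfolding T_def seg_poly_def by auto
  have T0: "T \<inter> frontier \<Omega> = {}"
  proof (rule equals0I)
    fix p assume p: "p \<in> T \<inter> frontier \<Omega>"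
    then have "p \<in> seg_triangle A B \<or> p \<in> seg_triangle B C \<or> p \<in> seg_triangle C A" 
      "seg_v A B p < 0 \<and> 0 < seg_x A B p + seg_v A B p \<and> seg_x A B p < 1 + seg_v A B p"
      using K'[of p] memT[of p] by auto
    then show False
      using co(1,2)[of p] co(3,4)[of p] unfolding seg_triangle_def mem_Collect_eq by argo
  qed
  have lowT: "seg_lower A B \<subseteq> T"
  proof
    fix p assume "p \<in> seg_lower A B" then show "p \<in> T" unfolding mem_seg_lower memT by argo
  qed
  \<comment> \<open>The two half planes lie beyond those edges of the hexagonal hull of the
    snowflake that meet at the apex over \<open>A B\<close>.\<close>
  have outside: "seg_poly [h] A B \<inter> \<Omega> = {}" if h: "h = (1,-3,0) \<or> h = (-1,-3,-1)" for h
  proof (rule ccontr)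
    assume ne: "seg_poly [h] A B \<inter> \<Omega> \<noteq> {}"
    have mem: "p \<in> seg_poly [h] A B \<longleftrightarrow> (if h = (1,-3,0) then seg_x A B p < 3 * seg_v A B p else 1 - seg_x A B p < 3 * seg_v A B p)" for p
      using h unfolding seg_poly_def by auto
    have "seg_poly [h] A B \<inter> frontier \<Omega> = {}"
    proof (rule equals0I)
      fix p assume p: "p \<in> seg_poly [h] A B \<inter> frontier \<Omega>"
      then have "seg_x A B p < 3 * seg_v A B p \<or> 1 - seg_x A B p < 3 * seg_v A B p"
        using mem[of p] by (auto split: if_splits)
      moreover have "p \<in> seg_triangle A B \<or> p \<in> seg_triangle B C \<or> p \<in> seg_triangle C A"
        using K'[of p] p by auto
      ultimately show False
        using co(1,2)[of p] co(3,4)[of p] unfolding seg_triangle_def mem_Collect_eq by argo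
    qed
    then have sub: "seg_poly [h] A B \<subseteq> \<Omega>"
      using connected_subset_if_no_frontier[OF connected_seg_poly _ ne] by blast
    obtain e where e: "dist A x \<le> e" if "x \<in> \<Omega>" for x
      using \<Omega>(2) unfolding bounded_any_center[of \<Omega> A] by auto
    \<comment> \<open>High enough to leave the ball of radius \<open>e\<close> around
      \<open>A\<close>: the point at height \<open>v\<close> has distance
      \<open>sqrt 3 * (v * norm (B - A))\<close> from \<open>A\<close>.\<close>
    define v where "v = (\<bar>e\<bar> + 1) / norm (B - A) + 1"
    have n: "norm (B - A) > 0" using AB(1) by simp
    have v: "v \<ge> 1" unfolding v_def by simp
    have "seg_pt A B 0 v \<in> seg_poly [h] A B"
      unfolding mem using v AB(1) by (auto simp: seg_coords[OF AB(1)])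
    then have "dist A (seg_pt A B 0 v) \<le> e" using sub e by auto
    moreover have "dist A (seg_pt A B 0 v) = sqrt 3 * (v * norm (B - A))"
      using v by (simp add: dist_norm seg_pt_def abs_mult)
    moreover have "1 * (v * norm (B - A)) \<le> sqrt 3 * (v * norm (B - A))"
      using v n by (intro mult_right_mono) auto
    moreover have "v * norm (B - A) = \<bar>e\<bar> + 1 + norm (B - A)"
      unfolding v_def using n by (simp add: field_simps)
    ultimately show False using n by argo
  qed
  have L: "seg_left A B \<inter> \<Omega> = {}"
  proof -
    have "seg_left A B \<subseteq> seg_poly [(1,-3,0)] A B" unfolding seg_left_def seg_poly_def by auto
    then show ?thesis using outside[of "(1,-3,0)"] by auto
  qed
  have R: "seg_right A B \<inter> \<Omega> = {}"
  proof -
    have "seg_right A B \<subseteq> seg_poly [(-1,-3,-1)] A B" unfolding seg_right_def seg_poly_def by auto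
    then show ?thesis using outside[of "(-1,-3,-1)"] by auto
  qed
  have iso': "arc_isolated (- \<Omega>) A B" using iso by (simp add: arc_isolated_def frontier_complement)
  \<comment> \<open>Otherwise every region around the arc would be outside and \<Omega> would miss
    the whole cell, although \<open>koch_third A B\<close> is a frontier point in it.\<close>
  have "T \<inter> \<Omega> \<noteq> {}"
  proof
    assume T: "T \<inter> \<Omega> = {}"
    then have low: "seg_lower A B \<inter> \<Omega> = {}" using lowT by auto
    have tri: "seg_triangle A B \<inter> \<Omega> = {}"
      using seg_triangle_misses_open[OF \<Omega>(1) iso low L R] .
    have "seg_cell A B \<inter> \<Omega> = {}"
    proof (rule equals0I)
      fix p assume p: "p \<in> seg_cell A B \<inter> \<Omega>"
      then show False
        using seg_cell_cover[OF AB(1), of p] seg_triangle_children[OF AB(1)] tri low L R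
          seg_gate_subset[OF iso'] seg_left_gate_subset[OF iso'] seg_right_gate_subset[OF iso'] by blast
    qed
    moreover have "koch_third A B \<in> seg_cell A B"
      unfolding koch_points mem_seg_cell by (simp add: AB(1))
    ultimately have "koch_third A B \<notin> closure \<Omega>"
      using open_Int_closure_eq_empty[OF open_seg_cell, of A B \<Omega>] by auto
    moreover have "koch_third A B \<in> frontier \<Omega>"
      using koch_third_in_arc \<Omega>(3) unfolding snowflake_curve_def by auto
    ultimately show False by (simp add: frontier_def)
  qed
  then have "T \<subseteq> \<Omega>"
    using connected_subset_if_no_frontier[OF _ T0] unfolding T_def by simp
  then show ?thesis
    unfolding arc_separates_def using iso L R lowT by auto
qed

section \<open>Areas of neighbourhoods of the snowflake curve\<close>

abbreviation area :: "(real^2) set \<Rightarrow> real" where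
  "area \<equiv> measure lborel"

definition nbhd :: "(real^2) set \<Rightarrow> real \<Rightarrow> (real^2) set" where
  "nbhd S r = (\<Union>y\<in>S. ball y r)"

lemma mem_nbhd: "x \<in> nbhd S r \<longleftrightarrow> (\<exists>y\<in>S. dist x y < r)"
  by (auto simp: nbhd_def dist_commute)

lemma open_nbhd [simp, intro]: "open (nbhd S r)"
  by (auto simp: nbhd_def)

lemma nbhd_Un: "nbhd (S \<union> T) r = nbhd S r \<union> nbhd T r"
  by (auto simp: nbhd_def)

lemma area_mono:
  assumes "S \<subseteq> T" "S \<in> sets borel" "T \<in> sets borel" "bounded T"
  shows "area S \<le> area T"
  using emeasure_bounded_finite[OF assms(4)] assms
  by (intro measure_mono_fmeasurable) (auto simp: fmeasurable_def)

lemma area_Un_le: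
  assumes "S \<in> sets borel" "T \<in> sets borel" "bounded S" "bounded T"
  shows "area (S \<union> T) \<le> area S + area T"
  using emeasure_bounded_finite[OF assms(3)] emeasure_bounded_finite[OF assms(4)] assms
  by (intro measure_Un_le) auto

lemma area_Un_disjoint:
  assumes "S \<in> sets borel" "T \<in> sets borel" "bounded S" "bounded T" "S \<inter> T = {}"
  shows "area (S \<union> T) = area S + area T"
  using emeasure_bounded_finite[OF assms(3)] emeasure_bounded_finite[OF assms(4)] assms
  by (intro measure_Union) auto

lemma area_ball: "0 \<le> r \<Longrightarrow> area (ball c r) = pi * r\<^sup>2"
  by (simp add: content_ball unit_ball_vol_2)

lemma koch_arc_near: "a \<noteq> b \<Longrightarrow> y \<in> koch_arc a b \<Longrightarrow> dist y a \<le> 2 * norm (b - a)"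
  using koch_arc_in_triangle seg_triangle_diameter ends_in_seg_triangle(1) by blast

lemma nbhd_koch_arc_subset:
  assumes "a \<noteq> b"
  shows "nbhd (koch_arc a b) r \<subseteq> ball a (2 * norm (b - a) + r)"
proof
  fix x assume "x \<in> nbhd (koch_arc a b) r"
  then obtain y where y: "y \<in> koch_arc a b" "dist x y < r" by (auto simp: mem_nbhd)
  then show "x \<in> ball a (2 * norm (b - a) + r)"
    using koch_arc_near[OF assms y(1)] dist_triangle[of a x y] by (simp add: dist_commute)
qed

lemma bounded_nbhd_koch_arc: "a \<noteq> b \<Longrightarrow> bounded (nbhd (koch_arc a b) r)"
  using nbhd_koch_arc_subset bounded_ball bounded_subset by metis

lemma bounded_seg_cell: "a \<noteq> b \<Longrightarrow> bounded (seg_cell a b)"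
  using seg_cell_near[of a b] by (auto simp: bounded_any_center[of _ a] dist_commute)

lemma nbhd_koch_arc_children:
  "nbhd (koch_arc a b) r = nbhd (koch_arc a (koch_third a b)) r \<union> nbhd (koch_arc (koch_third a b) (koch_apex a b)) r
     \<union> nbhd (koch_arc (koch_apex a b) (koch_two_thirds a b)) r \<union> nbhd (koch_arc (koch_two_thirds a b) b) r"
  unfolding koch_arc_children[of a b] by (auto simp: koch_children_def mem_nbhd)

lemma area_Un4_le:
  assumes "S1 \<in> sets borel" "S2 \<in> sets borel" "S3 \<in> sets borel" "S4 \<in> sets borel"
    "bounded S1" "bounded S2" "bounded S3" "bounded S4"
  shows "area (S1 \<union> S2 \<union> S3 \<union> S4) \<le> area S1 + area S2 + area S3 + area S4"
proof -
  have "area (S1 \<union> S2 \<union> S3 \<union> S4) \<le> area (S1 \<union> S2 \<union> S3) + area S4"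
    "area (S1 \<union> S2 \<union> S3) \<le> area (S1 \<union> S2) + area S3" "area (S1 \<union> S2) \<le> area S1 + area S2"
    using assms by (auto intro!: area_Un_le)
  then show ?thesis by linarith
qed

lemma koch_childrenI:
  "(a, koch_third a b) \<in> koch_children a b" "(koch_third a b, koch_apex a b) \<in> koch_children a b"
  "(koch_apex a b, koch_two_thirds a b) \<in> koch_children a b" "(koch_two_thirds a b, b) \<in> koch_children a b"
  by (auto simp: koch_children_def)

lemma area_seg_cell_children:
  assumes "a \<noteq> b" "B \<in> sets borel"
  shows "area (seg_cell a (koch_third a b) \<inter> B) + area (seg_cell (koch_third a b) (koch_apex a b) \<inter> B)
    + area (seg_cell (koch_apex a b) (koch_two_thirds a b) \<inter> B) + area (seg_cell (koch_two_thirds a b) b \<inter> B)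
    \<le> area (seg_cell a b \<inter> B)"
proof -
  let ?S1 = "seg_cell a (koch_third a b) \<inter> B" and ?S2 = "seg_cell (koch_third a b) (koch_apex a b) \<inter> B"
    and ?S3 = "seg_cell (koch_apex a b) (koch_two_thirds a b) \<inter> B" and ?S4 = "seg_cell (koch_two_thirds a b) b \<inter> B"
  have bd: "bounded ?S1" "bounded ?S2" "bounded ?S3" "bounded ?S4" 
    using koch_children_neq[OF koch_childrenI(1) assms(1)] koch_children_neq[OF koch_childrenI(2) assms(1)]
      koch_children_neq[OF koch_childrenI(3) assms(1)] koch_children_neq[OF koch_childrenI(4) assms(1)]
    by (auto intro!: bounded_Int bounded_seg_cell)
  have op: "?S1 \<in> sets borel" "?S2 \<in> sets borel" "?S3 \<in> sets borel" "?S4 \<in> sets borel"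
    using assms(2) by auto
  have "area (?S1 \<union> ?S2 \<union> ?S3 \<union> ?S4) = area (?S1 \<union> ?S2 \<union> ?S3) + area ?S4"
    by (rule area_Un_disjoint; use op bd seg_cell_children_disjoint[OF assms(1)] in fastforce)
  moreover have "area (?S1 \<union> ?S2 \<union> ?S3) = area (?S1 \<union> ?S2) + area ?S3"
    by (rule area_Un_disjoint; use op bd seg_cell_children_disjoint[OF assms(1)] in fastforce)
  moreover have "area (?S1 \<union> ?S2) = area ?S1 + area ?S2"
    by (rule area_Un_disjoint; use op bd seg_cell_children_disjoint[OF assms(1)] in fastforce)
  moreover have "area (?S1 \<union> ?S2 \<union> ?S3 \<union> ?S4) \<le> area (seg_cell a b \<inter> B)"
  proof (rule area_mono)
    show "?S1 \<union> ?S2 \<union> ?S3 \<union> ?S4 \<subseteq> seg_cell a b \<inter> B"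
      using seg_cell_children[OF assms(1) koch_childrenI(1)] seg_cell_children[OF assms(1) koch_childrenI(2)]
        seg_cell_children[OF assms(1) koch_childrenI(3)] seg_cell_children[OF assms(1) koch_childrenI(4)] by blast
    show "?S1 \<union> ?S2 \<union> ?S3 \<union> ?S4 \<in> sets borel" "seg_cell a b \<inter> B \<in> sets borel" using op assms(2) by auto
    show "bounded (seg_cell a b \<inter> B)" using bounded_seg_cell[OF assms(1)] by (rule bounded_Int[OF disjI1])
  qed
  ultimately show ?thesis by linarith
qed

text \<open>Covering by the \<open>4 ^ n\<close> pieces of generation \<open>n\<close>, the
  neighbourhood of each being inside one ball about its starting point.\<close>

lemma area_nbhd_koch_arc_level:
  assumes "a \<noteq> b" "0 < r"
  shows "area (nbhd (koch_arc a b) r) \<le> 4 ^ n * (pi * (2 * norm (b - a) / 3 ^ n + r)\<^sup>2)"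
  using assms
proof (induction n arbitrary: a b)
  case 0
  have "area (nbhd (koch_arc a b) r) \<le> area (ball a (2 * norm (b - a) + r))"
    by (rule area_mono[OF nbhd_koch_arc_subset[OF 0(1)]]) auto
  then show ?case using 0 by (simp add: area_ball)
next
  case (Suc n)
  have *: "area (nbhd (koch_arc c e) r) \<le> 4 ^ n * (pi * (2 * norm (b - a) / 3 ^ Suc n + r)\<^sup>2)"
    and **: "bounded (nbhd (koch_arc c e) r)"
    if "(c, e) \<in> koch_children a b" for c e
    using Suc.IH[OF koch_children_neq[OF that Suc.prems(1)] Suc.prems(2)]
      bounded_nbhd_koch_arc[OF koch_children_neq[OF that Suc.prems(1)]]
    unfolding norm_koch_children[OF that] by (simp_all add: mult.commute)
  show ?case
    unfolding nbhd_koch_arc_children[of a b]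
    by (rule order_trans[OF area_Un4_le])
      (use *[OF koch_childrenI(1)] *[OF koch_childrenI(2)] *[OF koch_childrenI(3)] *[OF koch_childrenI(4)] **[OF koch_childrenI(1)]
       **[OF koch_childrenI(2)] **[OF koch_childrenI(3)] **[OF koch_childrenI(4)] in \<open>auto simp del: power_Suc simp add: power_Suc[of "4::real"]\<close>)
qed

text \<open>Counts the pieces near a ball by area: if the neighbourhood of a piece of length
  \<open>L\<close> meets the ball, its whole cell, of area at least
  \<open>pi * (L / 100)\<^sup>2\<close>, lies in the enlarged ball, and the cells are disjoint. As a
  product inequality the claim is additive over the four children, so an induction replaces the
  count.\<close>

lemma area_nbhd_koch_arc_localize:
  assumes "a \<noteq> b" "norm (b - a) = 3 ^ n * L" "0 < L" "0 < r"
    and M: "\<And>c e. norm (e - c) = L \<Longrightarrow> area (nbhd (koch_arc c e) r) \<le> M"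
  shows "area (nbhd (koch_arc a b) r \<inter> ball z \<rho>) * (pi * (L / 100)\<^sup>2) \<le> M * area (seg_cell a b \<inter> ball z (\<rho> + r + 5 * L))"
  using assms(1,2)
proof (induction n arbitrary: a b)
  case 0
  then have L: "norm (b - a) = L" by simp
  have bd: "bounded (nbhd (koch_arc a b) r)" using bounded_nbhd_koch_arc[OF 0(1)] .
  have M0: "M \<ge> 0" using M[OF L] measure_nonneg[of lborel "nbhd (koch_arc a b) r"] by linarith
  show ?case
  proof (cases "nbhd (koch_arc a b) r \<inter> ball z \<rho> = {}")
    case True
    then show ?thesis using M0 by simp
  next
    case False
    then obtain x where "x \<in> nbhd (koch_arc a b) r" and xz: "x \<in> ball z \<rho>" by blast
    then obtain y where "y \<in> koch_arc a b" "dist x y < r" by (auto simp: mem_nbhd)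
    with xz have xy: "y \<in> koch_arc a b" "dist x y < r" "dist x z < \<rho>" by (auto simp: dist_commute)
    \<comment> \<open>Two lengths lead from the arc to \<open>a\<close> and two more from
      \<open>a\<close> into the cell; the fifth is slack.\<close>
    have "seg_cell a b \<subseteq> ball z (\<rho> + r + 5 * L)"
    proof
      fix p assume "p \<in> seg_cell a b"
      then have "dist p a \<le> 2 * L" "dist y a \<le> 2 * L"
        using seg_cell_near[OF 0(1)] koch_arc_near[OF 0(1) xy(1)] L by auto
      then have "dist z p < \<rho> + r + 5 * L"
        using xy(2,3) dist_triangle[of z p a] dist_triangle[of z a y] dist_triangle[of z y x] assms(3)
        by (simp add: dist_commute)
      then show "p \<in> ball z (\<rho> + r + 5 * L)" by simp
    qed
    then have "seg_cell a b \<inter> ball z (\<rho> + r + 5 * L) = seg_cell a b" by auto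
    moreover have "pi * (L / 100)\<^sup>2 \<le> area (seg_cell a b)"
    proof -
      have "area (ball (seg_pt a b (1/2) 0) (norm (b - a) / 100)) \<le> area (seg_cell a b)"
        using ball_in_seg_gates(1)[OF 0(1)] bounded_seg_cell[OF 0(1)] 
        by (intro area_mono) (auto simp: mem_seg_gate)
      then show ?thesis using assms(3) L by (simp add: area_ball)
    qed
    moreover have "area (nbhd (koch_arc a b) r \<inter> ball z \<rho>) \<le> M"
      using area_mono[of "nbhd (koch_arc a b) r \<inter> ball z \<rho>" "nbhd (koch_arc a b) r"] bd M[OF L] by auto
    ultimately show ?thesis using M0 by (auto intro!: mult_mono)
  qed
next
  case (Suc n)
  let ?B = "ball z \<rho>" and ?B' = "ball z (\<rho> + r + 5 * L)"
  have *: "area (nbhd (koch_arc c e) r \<inter> ?B) * (pi * (L / 100)\<^sup>2) \<le> M * area (seg_cell c e \<inter> ?B')"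
    if "(c, e) \<in> koch_children a b" for c e
    by (rule Suc.IH[OF koch_children_neq[OF that Suc.prems(1)]]) (use norm_koch_children[OF that] Suc.prems(2) in simp)
  have **: "bounded (nbhd (koch_arc c e) r \<inter> ?B)" for c e by (simp add: bounded_Int)
  obtain w :: "real^2" where "norm w = L" using assms(3) vector_choose_size[of L] by auto
  then have M0: "M \<ge> 0" using M[of w 0] order_trans[OF measure_nonneg[of lborel "nbhd (koch_arc 0 w) r"], of M] by simp
  have "area (nbhd (koch_arc a b) r \<inter> ?B) \<le> area (nbhd (koch_arc a (koch_third a b)) r \<inter> ?B)
     + area (nbhd (koch_arc (koch_third a b) (koch_apex a b)) r \<inter> ?B)
     + area (nbhd (koch_arc (koch_apex a b) (koch_two_thirds a b)) r \<inter> ?B)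
     + area (nbhd (koch_arc (koch_two_thirds a b) b) r \<inter> ?B)"
    unfolding nbhd_koch_arc_children[of a b] Int_Un_distrib2
    by (rule area_Un4_le) (auto intro: **)
  then have "area (nbhd (koch_arc a b) r \<inter> ?B) * (pi * (L / 100)\<^sup>2) \<le> (area (nbhd (koch_arc a (koch_third a b)) r \<inter> ?B)
     + area (nbhd (koch_arc (koch_third a b) (koch_apex a b)) r \<inter> ?B)
     + area (nbhd (koch_arc (koch_apex a b) (koch_two_thirds a b)) r \<inter> ?B)
     + area (nbhd (koch_arc (koch_two_thirds a b) b) r \<inter> ?B)) * (pi * (L / 100)\<^sup>2)"
    by (rule mult_right_mono) simp
  also have "\<dots> \<le> M * (area (seg_cell a (koch_third a b) \<inter> ?B') + area (seg_cell (koch_third a b) (koch_apex a b) \<inter> ?B')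
    + area (seg_cell (koch_apex a b) (koch_two_thirds a b) \<inter> ?B') + area (seg_cell (koch_two_thirds a b) b \<inter> ?B'))"
    using *[OF koch_childrenI(1)] *[OF koch_childrenI(2)] *[OF koch_childrenI(3)] *[OF koch_childrenI(4)]
    unfolding distrib_left distrib_right by linarith
  also have "\<dots> \<le> M * area (seg_cell a b \<inter> ?B')"
    using area_seg_cell_children[OF Suc.prems(1), of ?B'] M0 by (intro mult_left_mono) auto
  finally show ?case .
qed

section \<open>The dimension and the power laws for the areas\<close>

definition koch_dim :: real where "koch_dim = ln 4 / ln 3"

lemma powr_koch_dim: "3 powr koch_dim = 4" "(3 ^ k) powr koch_dim = 4 ^ k"
proof -
  show 1: "3 powr koch_dim = 4" by (simp add: koch_dim_def powr_def)
  have "((3::real) ^ k) powr koch_dim = (3 powr koch_dim) ^ k"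
    by (induction k) (simp_all add: powr_mult)
  then show "(3 ^ k) powr koch_dim = 4 ^ k" using 1 by simp
qed

lemma koch_dim_bounds: "1 < koch_dim" "koch_dim < 2"
proof -
  have "ln (3::real) < ln 4" by simp
  then show "1 < koch_dim" by (simp add: koch_dim_def field_simps)
  have "ln (4::real) < ln (3 ^ 2)" by (subst ln_less_cancel_iff) auto
  also have "ln (3 ^ 2 :: real) = 2 * ln 3" by (simp only: ln_realpow)
  finally show "koch_dim < 2" by (simp add: koch_dim_def field_simps)
qed

lemma obtain_scale:
  fixes r L :: real
  assumes "0 < r" "r < L"
  obtains k where "L / 3 ^ Suc k \<le> r" "r < L / 3 ^ k"
proof -
  have "\<exists>k. L / 3 ^ k \<le> r"
  proof -
    obtain k where "L / r < 3 ^ k" using real_arch_pow[of 3 "L / r"] by auto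
    then have "L / 3 ^ k \<le> r" using assms by (simp add: field_simps)
    then show ?thesis by auto
  qed
  then obtain k where k: "L / 3 ^ k \<le> r" "\<And>i. i < k \<Longrightarrow> \<not> L / 3 ^ i \<le> r"
    using exists_least_iff[of "\<lambda>k. L / 3 ^ k \<le> r"] by auto
  have "k \<noteq> 0" using k(1) assms by (cases k) auto
  then obtain k' where "k = Suc k'" by (cases k) auto
  then show thesis using k(1) k(2)[of k'] by (intro that[of k']) auto
qed

text \<open>At the generation whose segments have length between \<open>r\<close> and
  \<open>3 * r\<close> the covering balls have radius at most \<open>7 * r\<close>, whence the 49.
  The number of pieces is at most \<open>(L / r) powr koch_dim\<close> because
  \<open>3 powr koch_dim = 4\<close>.\<close>

lemma area_nbhd_koch_arc:
  assumes "0 < r" "r < norm (b - a)"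
  shows "area (nbhd (koch_arc a b) r) \<le> 49 * pi * norm (b - a) powr koch_dim * r powr (2 - koch_dim)"
proof -
  define L where "L = norm (b - a)"
  have ab: "a \<noteq> b" using assms by auto
  obtain k where k: "L / 3 ^ Suc k \<le> r" "r < L / 3 ^ k"
    using obtain_scale[of r L] assms unfolding L_def by auto
  have "2 * L / 3 ^ k \<le> 6 * r" using k(1) by (simp add: field_simps)
  then have "(2 * L / 3 ^ k + r)\<^sup>2 \<le> (7 * r)\<^sup>2"
    using assms by (intro power_mono) (auto simp: L_def)
  then have "4 ^ k * (pi * (2 * L / 3 ^ k + r)\<^sup>2) \<le> 4 ^ k * (pi * (7 * r)\<^sup>2)"
    by (intro mult_left_mono) auto
  then have "area (nbhd (koch_arc a b) r) \<le> 4 ^ k * (pi * (7 * r)\<^sup>2)"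
    using area_nbhd_koch_arc_level[OF ab assms(1), of k] unfolding L_def by linarith
  also have "\<dots> = 49 * pi * (4 ^ k * r\<^sup>2)" by (simp add: power2_eq_square)
  also have "4 ^ k * r\<^sup>2 \<le> (L / r) powr koch_dim * r\<^sup>2"
  proof -
    have "3 ^ k \<le> L / r" using k(2) assms by (simp add: field_simps)
    then have "(3 ^ k) powr koch_dim \<le> (L / r) powr koch_dim"
      using koch_dim_bounds by (intro powr_mono2) auto
    then show ?thesis unfolding powr_koch_dim by (intro mult_right_mono) auto
  qed
  also have "(L / r) powr koch_dim * r\<^sup>2 = L powr koch_dim * r powr (2 - koch_dim)"
    using assms by (simp add: L_def powr_divide powr_diff)
  finally show ?thesis by (simp add: L_def)
qed

text \<open>The local bound serves small cubes. In the global one the last factor accounts for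
  \<open>r\<close> exceeding the size of the curve, where the area grows like
  \<open>r\<^sup>2\<close>.\<close>

lemma area_nbhd_koch_arc_ball:
  assumes "a \<noteq> b"
  obtains C where "0 < C"
    "\<And>r z t. 0 < r \<Longrightarrow> 0 < t \<Longrightarrow> t \<le> 1 \<Longrightarrow> area (nbhd (koch_arc a b) r \<inter> ball z t) \<le> C * r powr (2 - koch_dim) * t powr koch_dim"
    "\<And>r. 0 < r \<Longrightarrow> area (nbhd (koch_arc a b) r) \<le> C * r powr (2 - koch_dim) * (1 + r) powr koch_dim"
proof -
  define L0 where "L0 = norm (b - a)"
  have L0: "L0 > 0" using assms by (simp add: L0_def)
  \<comment> \<open>The sum of the constants of all cases below, so that each of them is dominated
    separately.\<close>
  define C where "C = pi + pi / L0 powr (2 - koch_dim) + 49 * pi * L0 powr koch_dim + 9 * pi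
    + 49 * 49 * pi * 10 ^ 4 * 3 powr koch_dim"
  have C: "pi \<le> C" "pi / L0 powr (2 - koch_dim) \<le> C" "49 * pi * L0 powr koch_dim \<le> C" "9 * pi \<le> C"
    "49 * 49 * pi * 10 ^ 4 * 3 powr koch_dim \<le> C"
    unfolding C_def using L0 by (auto intro!: add_increasing2 add_increasing)
  have Cpos: "C > 0" using C(1) pi_gt_zero by linarith
  have sq: "x powr (2 - koch_dim) * x powr koch_dim = x\<^sup>2" if "x > 0" for x :: real
    using that by (simp flip: powr_add)
  show thesis
  proof (rule that[OF Cpos])
    fix r :: real assume r: "0 < r"
    show "area (nbhd (koch_arc a b) r) \<le> C * r powr (2 - koch_dim) * (1 + r) powr koch_dim"
    proof (cases "r < L0")
      case True
      have "area (nbhd (koch_arc a b) r) \<le> 49 * pi * L0 powr koch_dim * r powr (2 - koch_dim)"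
        using area_nbhd_koch_arc[OF r, of b a] True by (simp add: L0_def)
      also have "\<dots> \<le> C * r powr (2 - koch_dim)" using C(3) by (intro mult_right_mono) auto
      also have "\<dots> * 1 \<le> C * r powr (2 - koch_dim) * (1 + r) powr koch_dim"
        using r koch_dim_bounds Cpos by (intro mult_left_mono ge_one_powr_ge_zero) auto
      finally show ?thesis by simp
    next
      case False
      have "area (nbhd (koch_arc a b) r) \<le> pi * (2 * L0 + r)\<^sup>2"
        using area_nbhd_koch_arc_level[OF assms r, of 0] by (simp add: L0_def)
      also have "\<dots> \<le> pi * (3 * r)\<^sup>2" using False L0 by (intro mult_left_mono power_mono) auto
      also have "\<dots> = 9 * pi * (r powr (2 - koch_dim) * r powr koch_dim)"
        using sq[OF r] by (simp add: power2_eq_square)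
      also have "\<dots> \<le> C * (r powr (2 - koch_dim) * (1 + r) powr koch_dim)"
        using C(4) r koch_dim_bounds Cpos by (intro mult_mono powr_mono2) auto
      finally show ?thesis by (simp add: mult.assoc)
    qed
  next
    fix r t :: real and z :: "real^2" assume r: "0 < r" and t: "0 < t" "t \<le> 1"
    have ball: "area (nbhd (koch_arc a b) r \<inter> ball z t) \<le> pi * t\<^sup>2"
      using area_mono[of "nbhd (koch_arc a b) r \<inter> ball z t" "ball z t"] t by (simp add: area_ball)
    consider "t \<le> r" | "L0 \<le> r" | "r < t" "r < L0" by linarith
    then show "area (nbhd (koch_arc a b) r \<inter> ball z t) \<le> C * r powr (2 - koch_dim) * t powr koch_dim"
    proof cases
      \<comment> \<open>The area of the ball itself is already small enough.\<close>
      case 1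
      have "pi * t\<^sup>2 = pi * (t powr (2 - koch_dim) * t powr koch_dim)" using sq[OF t(1)] by simp
      also have "\<dots> \<le> C * (r powr (2 - koch_dim) * t powr koch_dim)"
        using C(1) 1 t koch_dim_bounds Cpos by (intro mult_mono powr_mono2) auto
      finally show ?thesis using ball by (simp add: mult.assoc)
    next
      \<comment> \<open>The neighbourhood is as wide as the whole curve; \<open>t \<le> 1\<close>
        bounds \<open>t\<^sup>2\<close> by \<open>t powr koch_dim\<close>.\<close>
      case 2
      have "pi * t\<^sup>2 = pi * (t powr (2 - koch_dim) * t powr koch_dim)" using sq[OF t(1)] by simp
      also have "\<dots> \<le> pi * (1 * t powr koch_dim)"
        using t koch_dim_bounds by (intro mult_left_mono mult_right_mono powr_le1) auto
      also have "\<dots> \<le> (pi / L0 powr (2 - koch_dim) * r powr (2 - koch_dim)) * t powr koch_dim"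
      proof -
        have "1 \<le> r powr (2 - koch_dim) / L0 powr (2 - koch_dim)"
          using 2 L0 koch_dim_bounds by (simp add: powr_mono2)
        then have "pi * 1 \<le> pi * (r powr (2 - koch_dim) / L0 powr (2 - koch_dim))"
          by (intro mult_left_mono) auto
        then have "pi * 1 * t powr koch_dim \<le> pi * (r powr (2 - koch_dim) / L0 powr (2 - koch_dim)) * t powr koch_dim"
          by (rule mult_right_mono) simp
        then show ?thesis by simp
      qed
      also have "\<dots> \<le> C * r powr (2 - koch_dim) * t powr koch_dim"
        using C(2) by (intro mult_right_mono) auto
      finally show ?thesis using ball by linarith
    next
      case 3
      \<comment> \<open>Work with pieces of length comparable to \<open>t\<close>, or with the whole
        arc if \<open>t\<close> is at least its length; in both cases the cells in question fill an
        area of order \<open>(L0 / 3 ^ n)\<^sup>2\<close>.\<close>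
      obtain n where n: "L0 / 3 ^ n \<le> 3 * t" "r < L0 / 3 ^ n" 
        "area (seg_cell a b \<inter> ball z (t + r + 5 * (L0 / 3 ^ n))) \<le> 49 * pi * (L0 / 3 ^ n)\<^sup>2"
      proof (cases "t < L0")
        case True
        obtain n where n: "L0 / 3 ^ Suc n \<le> t" "t < L0 / 3 ^ n" using obtain_scale[OF t(1) True] .
        have "area (seg_cell a b \<inter> ball z (t + r + 5 * (L0 / 3 ^ n))) \<le> area (ball z (t + r + 5 * (L0 / 3 ^ n)))"
          by (rule area_mono) auto
        also have "\<dots> = pi * (t + r + 5 * (L0 / 3 ^ n))\<^sup>2" using r t L0 by (intro area_ball) auto
        also have "\<dots> \<le> pi * (7 * (L0 / 3 ^ n))\<^sup>2"
          using n 3 r t L0 by (intro mult_left_mono power_mono) auto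
        also have "\<dots> = 49 * pi * (L0 / 3 ^ n)\<^sup>2" by (simp add: power2_eq_square)
        finally have "area (seg_cell a b \<inter> ball z (t + r + 5 * (L0 / 3 ^ n))) \<le> 49 * pi * (L0 / 3 ^ n)\<^sup>2" .
        moreover have "L0 / 3 ^ n \<le> 3 * t" using n(1) by (simp add: field_simps)
        ultimately show ?thesis using that[of n] n 3 by auto
      next
        case False
        have "area (seg_cell a b \<inter> ball z (t + r + 5 * (L0 / 3 ^ 0))) \<le> area (ball a (3 * L0))"
        proof (rule area_mono)
          show "seg_cell a b \<inter> ball z (t + r + 5 * (L0 / 3 ^ 0)) \<subseteq> ball a (3 * L0)"
          proof
            fix x assume "x \<in> seg_cell a b \<inter> ball z (t + r + 5 * (L0 / 3 ^ 0))"
            then have "dist x a \<le> 2 * L0" using seg_cell_near[OF assms, of x] by (simp add: L0_def)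
            then show "x \<in> ball a (3 * L0)" using L0 by (simp add: dist_commute)
          qed
        qed auto
        also have "\<dots> \<le> 49 * pi * L0\<^sup>2" using L0 by (simp add: area_ball power_mult_distrib)
        finally show ?thesis using that[of 0] False 3 t by auto
      qed
      define L where "L = L0 / 3 ^ n"
      have L: "L > 0" "r < L" "L \<le> 3 * t" using n L0 by (auto simp: L_def)
      have "area (nbhd (koch_arc a b) r \<inter> ball z t) * (pi * (L / 100)\<^sup>2)
        \<le> (49 * pi * L powr koch_dim * r powr (2 - koch_dim)) * area (seg_cell a b \<inter> ball z (t + r + 5 * L))"
      proof (rule area_nbhd_koch_arc_localize[OF assms _ L(1) r])
        show "norm (b - a) = 3 ^ n * L" by (simp add: L_def L0_def)
        show "area (nbhd (koch_arc c e) r) \<le> 49 * pi * L powr koch_dim * r powr (2 - koch_dim)"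
          if "norm (e - c) = L" for c e
          using area_nbhd_koch_arc[OF r, of e c] that L(2) by simp
      qed
      also have "\<dots> \<le> (49 * pi * L powr koch_dim * r powr (2 - koch_dim)) * (49 * pi * L\<^sup>2)"
        using n(3) unfolding L_def by (intro mult_left_mono) auto
      also have "\<dots> = (49 * 49 * pi * 10 ^ 4 * L powr koch_dim * r powr (2 - koch_dim)) * (pi * (L / 100)\<^sup>2)"
        by (simp add: power2_eq_square)
      finally have "area (nbhd (koch_arc a b) r \<inter> ball z t) \<le> 49 * 49 * pi * 10 ^ 4 * L powr koch_dim * r powr (2 - koch_dim)"
        using L(1) by (simp only: mult_le_cancel_right) simp
      also have "\<dots> \<le> 49 * 49 * pi * 10 ^ 4 * (3 powr koch_dim * t powr koch_dim) * r powr (2 - koch_dim)"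
      proof -
        have "L powr koch_dim \<le> (3 * t) powr koch_dim" using L koch_dim_bounds by (intro powr_mono2) auto
        then show ?thesis using t by (intro mult_right_mono mult_left_mono) (auto simp: powr_mult)
      qed
      also have "\<dots> = (49 * 49 * pi * 10 ^ 4 * 3 powr koch_dim) * (t powr koch_dim * r powr (2 - koch_dim))"
        by simp
      also have "\<dots> \<le> C * (t powr koch_dim * r powr (2 - koch_dim))"
        using C(5) by (intro mult_right_mono) auto
      finally show ?thesis by (simp add: mult_ac)
    qed
  qed
qed

lemma area_nbhd_snowflake:
  assumes "ccw_equilateral_triangle A B C"
  obtains D where "0 < D"
    "\<And>r z t. 0 < r \<Longrightarrow> 0 < t \<Longrightarrow> t \<le> 1 \<Longrightarrow>
       area (nbhd (snowflake_curve A B C) r \<inter> ball z t) \<le> D * r powr (2 - koch_dim) * t powr koch_dim"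
    "\<And>r. 0 < r \<Longrightarrow> area (nbhd (snowflake_curve A B C) r) \<le> D * r powr (2 - koch_dim) * (1 + r) powr koch_dim"
proof -
  have ne: "A \<noteq> B" "B \<noteq> C" "C \<noteq> A"
    using ccw_third_vertex(1)[OF assms] ccw_third_vertex(1)[OF ccw_rotate[OF assms]]
      ccw_third_vertex(1)[OF ccw_rotate[OF ccw_rotate[OF assms]]] by auto
  from area_nbhd_koch_arc_ball[OF ne(1)] obtain D1 where D1: "0 < D1" 
    "\<And>r z t. 0 < r \<Longrightarrow> 0 < t \<Longrightarrow> t \<le> 1 \<Longrightarrow> area (nbhd (koch_arc A B) r \<inter> ball z t) \<le> D1 * r powr (2 - koch_dim) * t powr koch_dim"
    "\<And>r. 0 < r \<Longrightarrow> area (nbhd (koch_arc A B) r) \<le> D1 * r powr (2 - koch_dim) * (1 + r) powr koch_dim" by blast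
  from area_nbhd_koch_arc_ball[OF ne(2)] obtain D2 where D2: "0 < D2" 
    "\<And>r z t. 0 < r \<Longrightarrow> 0 < t \<Longrightarrow> t \<le> 1 \<Longrightarrow> area (nbhd (koch_arc B C) r \<inter> ball z t) \<le> D2 * r powr (2 - koch_dim) * t powr koch_dim"
    "\<And>r. 0 < r \<Longrightarrow> area (nbhd (koch_arc B C) r) \<le> D2 * r powr (2 - koch_dim) * (1 + r) powr koch_dim" by blast
  from area_nbhd_koch_arc_ball[OF ne(3)] obtain D3 where D3: "0 < D3" 
    "\<And>r z t. 0 < r \<Longrightarrow> 0 < t \<Longrightarrow> t \<le> 1 \<Longrightarrow> area (nbhd (koch_arc C A) r \<inter> ball z t) \<le> D3 * r powr (2 - koch_dim) * t powr koch_dim"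
    "\<And>r. 0 < r \<Longrightarrow> area (nbhd (koch_arc C A) r) \<le> D3 * r powr (2 - koch_dim) * (1 + r) powr koch_dim" by blast
  have bd: "bounded (nbhd (koch_arc A B) r)" "bounded (nbhd (koch_arc B C) r)" "bounded (nbhd (koch_arc C A) r)" for r
    using bounded_nbhd_koch_arc ne by auto
  have sub: "area ((S1 \<union> S2 \<union> S3) \<inter> B) \<le> area (S1 \<inter> B) + area (S2 \<inter> B) + area (S3 \<inter> B)"
    if "open S1" "open S2" "open S3" "open B" "bounded S1" "bounded S2" "bounded S3" for S1 S2 S3 B :: "(real^2) set"
    using area_Un4_le[of "S1 \<inter> B" "S2 \<inter> B" "S3 \<inter> B" "{}"] that by (simp add: Int_Un_distrib2 bounded_Int)
  show thesis
  proof (rule that[of "D1 + D2 + D3"])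
    show "0 < D1 + D2 + D3" using D1(1) D2(1) D3(1) by simp
    show "area (nbhd (snowflake_curve A B C) r \<inter> ball z t) \<le> (D1 + D2 + D3) * r powr (2 - koch_dim) * t powr koch_dim"
      if "0 < r" "0 < t" "t \<le> 1" for r z t
      using D1(2)[OF that, of z] D2(2)[OF that, of z] D3(2)[OF that, of z] 
        sub[OF open_nbhd open_nbhd open_nbhd open_ball bd, of r r r z t]
      unfolding snowflake_curve_def nbhd_Un distrib_right by linarith
    show "area (nbhd (snowflake_curve A B C) r) \<le> (D1 + D2 + D3) * r powr (2 - koch_dim) * (1 + r) powr koch_dim"
      if "0 < r" for r
      using D1(3)[OF that] D2(3)[OF that] D3(3)[OF that] 
        sub[OF open_nbhd open_nbhd open_nbhd open_UNIV bd, of r r r]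
      unfolding snowflake_curve_def nbhd_Un distrib_right by simp
  qed
qed

section \<open>Schwartz functions\<close>

lemma schwartz_differentiable: "f \<in> schwartz \<Longrightarrow> iter_partial is f differentiable (at x)"
  by (simp add: schwartz_def)

lemma schwartz_decay:
  assumes "f \<in> schwartz"
  obtains C where "0 < C" "\<And>x. (1 + norm x) ^ m * norm (iter_partial is f x) \<le> C"
proof -
  have "bdd_above (range (\<lambda>x. (1 + norm x) ^ m * norm (iter_partial is f x)))"
    using assms by (simp add: schwartz_def)
  then obtain C where C: "\<And>x. (1 + norm x) ^ m * norm (iter_partial is f x) \<le> C"
    unfolding bdd_above_def by auto
  show thesis
  proof (rule that[of "\<bar>C\<bar> + 1"])
    show "(1 + norm x) ^ m * norm (iter_partial is f x) \<le> \<bar>C\<bar> + 1" for x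
      using C[of x] abs_ge_self[of C] by linarith
  qed simp
qed

lemma schwartzI:
  assumes "\<And>is x. iter_partial is f differentiable (at x)"
    and "\<And>is m. \<exists>C. \<forall>x. (1 + norm x) ^ m * norm (iter_partial is f x) \<le> C"
  shows "f \<in> schwartz"
  using assms unfolding schwartz_def bdd_above_def by fastforce

lemma partial_deriv_eq:
  assumes "(f has_derivative f') (at x)"
  shows "partial_deriv i f x = f' (axis i 1)"
  unfolding partial_deriv_def using frechet_derivative_at[OF assms] by simp

lemma iter_partial_lincomb:
  assumes "f \<in> schwartz" "g \<in> schwartz"
  shows "iter_partial is (\<lambda>x. a * f x + b * g x) = (\<lambda>x. a * iter_partial is f x + b * iter_partial is g x)"
proof (induction "is")
  case (Cons i js)
  have "partial_deriv i (\<lambda>x. a * iter_partial js f x + b * iter_partial js g x) x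
      = a * partial_deriv i (iter_partial js f) x + b * partial_deriv i (iter_partial js g) x" for x
    unfolding partial_deriv_def[of i "iter_partial js f"] partial_deriv_def[of i "iter_partial js g"]
    by (rule partial_deriv_eq)
      (intro derivative_intros; use frechet_derivative_works schwartz_differentiable assms in blast)
  then show ?case by (simp add: Cons.IH)
qed simp

lemma schwartz_lincomb:
  assumes "f \<in> schwartz" "g \<in> schwartz"
  shows "(\<lambda>x. a * f x + b * g x) \<in> schwartz"
proof (rule schwartzI)
  show "iter_partial is (\<lambda>x. a * f x + b * g x) differentiable at x" for "is" x
    unfolding iter_partial_lincomb[OF assms]
    using schwartz_differentiable[OF assms(1)] schwartz_differentiable[OF assms(2)]
    by (intro derivative_intros) auto
next
  fix "is" m
  obtain C D where C: "\<And>x. (1 + norm x) ^ m * norm (iter_partial is f x) \<le> C"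
    and D: "\<And>x. (1 + norm x) ^ m * norm (iter_partial is g x) \<le> D"
    using schwartz_decay[OF assms(1)] schwartz_decay[OF assms(2)] by metis
  have "(1 + norm x) ^ m * norm (a * iter_partial is f x + b * iter_partial is g x) \<le> norm a * C + norm b * D" for x
  proof -
    have "(1 + norm x) ^ m * norm (a * iter_partial is f x + b * iter_partial is g x)
      \<le> (1 + norm x) ^ m * (norm a * norm (iter_partial is f x) + norm b * norm (iter_partial is g x))"
      by (intro mult_left_mono order_trans[OF norm_triangle_ineq]) (auto simp: norm_mult)
    also have "\<dots> = norm a * ((1 + norm x) ^ m * norm (iter_partial is f x))
        + norm b * ((1 + norm x) ^ m * norm (iter_partial is g x))" by (simp add: algebra_simps)
    also have "\<dots> \<le> norm a * C + norm b * D"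
      by (intro add_mono mult_left_mono C D) auto
    finally show ?thesis .
  qed
  then show "\<exists>C. \<forall>x. (1 + norm x) ^ m * norm (iter_partial is (\<lambda>x. a * f x + b * g x) x) \<le> C"
    unfolding iter_partial_lincomb[OF assms] by blast
qed

text \<open>A closed form for all iterated derivatives at once, from which smoothness and the
  seminorm bounds of the affine images follow.\<close>

lemma iter_partial_reflect_scale:
  fixes f :: "real^'n::finite \<Rightarrow> complex"
  assumes "f \<in> schwartz"
  shows "iter_partial is (\<lambda>y. f (z - c *\<^sub>R y)) = (\<lambda>y. of_real ((- c) ^ length is) * iter_partial is f (z - c *\<^sub>R y))"
proof (induction "is")
  case (Cons i js)
  have "partial_deriv i (\<lambda>y. of_real ((- c) ^ length js) * iter_partial js f (z - c *\<^sub>R y)) y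
      = of_real ((- c) ^ length (i # js)) * partial_deriv i (iter_partial js f) (z - c *\<^sub>R y)" for y
  proof -
    let ?F = "frechet_derivative (iter_partial js f) (at (z - c *\<^sub>R y))"
    have F: "(iter_partial js f has_derivative ?F) (at (z - c *\<^sub>R y))"
      using frechet_derivative_works schwartz_differentiable[OF assms] by blast
    have "((\<lambda>y. iter_partial js f (z - c *\<^sub>R y)) has_derivative (\<lambda>h. ?F (- (c *\<^sub>R h)))) (at y)"
      by (rule has_derivative_compose[of "\<lambda>y. z - c *\<^sub>R y" "\<lambda>h. - (c *\<^sub>R h)"])
        (auto intro!: derivative_eq_intros simp: F)
    then have "((\<lambda>y. of_real ((- c) ^ length js) * iter_partial js f (z - c *\<^sub>R y)) has_derivative
        (\<lambda>h. of_real ((- c) ^ length js) * ?F (- (c *\<^sub>R h)))) (at y)"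
      by (intro derivative_intros)
    from partial_deriv_eq[OF this] have "partial_deriv i (\<lambda>y. of_real ((- c) ^ length js) * iter_partial js f (z - c *\<^sub>R y)) y
       = of_real ((- c) ^ length js) * ?F ((- c) *\<^sub>R axis i 1)" by simp
    also have "?F ((- c) *\<^sub>R axis i 1) = (- c) *\<^sub>R ?F (axis i 1)"
      using F by (intro linear_scale has_derivative_linear)
    finally show ?thesis by (simp add: partial_deriv_def scaleR_conv_of_real)
  qed
  then show ?case by (simp add: Cons.IH)
qed simp

lemma schwartz_reflect_scale:
  fixes f :: "real^'n::finite \<Rightarrow> complex"
  assumes "f \<in> schwartz" "c \<noteq> 0"
  shows "(\<lambda>y. f (z - c *\<^sub>R y)) \<in> schwartz"
proof (rule schwartzI)
  show "iter_partial is (\<lambda>y. f (z - c *\<^sub>R y)) differentiable at x" for "is" x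
  proof -
    have "(iter_partial is f \<circ> (\<lambda>y. z - c *\<^sub>R y)) differentiable at x"
      by (intro differentiable_chain_at schwartz_differentiable[OF assms(1)] derivative_intros)
    then show ?thesis
      unfolding iter_partial_reflect_scale[OF assms(1)] o_def by (intro derivative_intros) auto
  qed
next
  fix "is" m
  obtain C where C: "0 < C" "\<And>x. (1 + norm x) ^ m * norm (iter_partial is f x) \<le> C"
    using schwartz_decay[OF assms(1)] by metis
  \<comment> \<open>Makes \<open>1 + norm y \<le> a * (1 + norm (z - c *\<^sub>R y))\<close>, which
    compares the polynomial weights before and after the affine change.\<close>
  define a where "a = 1 + (1 + norm z) / \<bar>c\<bar>"
  have "(1 + norm y) ^ m * norm (of_real ((- c) ^ length is) * iter_partial is f (z - c *\<^sub>R y))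
    \<le> a ^ m * (\<bar>c\<bar> ^ length is * C)" for y
  proof -
    have "\<bar>c\<bar> * norm y = norm (c *\<^sub>R y)" by simp
    also have "\<dots> \<le> norm z + norm (z - c *\<^sub>R y)"
      using norm_triangle_ineq4[of z "z - c *\<^sub>R y"] by simp
    finally have "norm y \<le> (norm z + norm (z - c *\<^sub>R y)) / \<bar>c\<bar>"
      using assms(2) by (simp add: field_simps)
    also have "\<dots> \<le> (1 + norm z) / \<bar>c\<bar> * (1 + norm (z - c *\<^sub>R y))"
      using assms(2) by (simp add: field_simps)
    finally have "1 + norm y \<le> a * (1 + norm (z - c *\<^sub>R y))"
      unfolding a_def using norm_ge_zero[of "z - c *\<^sub>R y"] by (simp only: distrib_right mult_1_left)
    then have "(1 + norm y) ^ m \<le> (a * (1 + norm (z - c *\<^sub>R y))) ^ m" by (intro power_mono) auto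
    then have "(1 + norm y) ^ m * norm (iter_partial is f (z - c *\<^sub>R y)) \<le>
        (a * (1 + norm (z - c *\<^sub>R y))) ^ m * norm (iter_partial is f (z - c *\<^sub>R y))"
      by (intro mult_right_mono) auto
    also have "\<dots> = a ^ m * ((1 + norm (z - c *\<^sub>R y)) ^ m * norm (iter_partial is f (z - c *\<^sub>R y)))"
      by (simp add: power_mult_distrib)
    also have "\<dots> \<le> a ^ m * C" by (intro mult_left_mono C(2)) (auto simp: a_def)
    finally have "\<bar>c\<bar> ^ length is * ((1 + norm y) ^ m * norm (iter_partial is f (z - c *\<^sub>R y))) \<le> \<bar>c\<bar> ^ length is * (a ^ m * C)"
      by (intro mult_left_mono) auto
    then show ?thesis by (simp add: norm_mult norm_power mult_ac)
  qed
  then show "\<exists>C. \<forall>x. (1 + norm x) ^ m * norm (iter_partial is (\<lambda>y. f (z - c *\<^sub>R y)) x) \<le> C"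
    unfolding iter_partial_reflect_scale[OF assms(1)] by blast
qed

lemma schwartz_cmult: "f \<in> schwartz \<Longrightarrow> (\<lambda>x. a * f x) \<in> schwartz"
  using schwartz_lincomb[of f f a 0] by simp

text \<open>\<open>regular_distribution\<close> is restricted to \<open>schwartz\<close>, so a
  convolution unfolds to an integral only once the reflected translates of the kernels are known to
  be test functions.\<close>

lemma schwartz_dyadic_resolution:
  assumes "\<phi>\<^sub>0 \<in> schwartz" "\<phi> \<in> schwartz"
  shows "(\<lambda>y. dyadic_resolution \<phi>\<^sub>0 \<phi> j (x - y)) \<in> schwartz"
proof (cases "j = 0")
  case True
  then show ?thesis
    using schwartz_reflect_scale[OF assms(1), of 1 x] by (simp add: dyadic_resolution_def)
next
  case False
  then show ?thesis
    using schwartz_cmult[OF schwartz_reflect_scale[OF assms(2), of "2 ^ j" "2 ^ j *\<^sub>R x"]]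
    by (simp add: dyadic_resolution_def scaleR_diff_right)
qed

lemma schwartz_continuous: "f \<in> schwartz \<Longrightarrow> continuous_on S f"
  using schwartz_differentiable[of f "[]"]
  by (auto simp: continuous_on_eq_continuous_within intro: differentiable_imp_continuous_within continuous_within_subset)

lemma schwartz_measurable: "f \<in> schwartz \<Longrightarrow> f \<in> borel_measurable borel"
  by (intro borel_measurable_continuous_onI schwartz_continuous)

lemma schwartz_bound:
  assumes "f \<in> schwartz"
  obtains C where "0 < C" "\<And>x. norm (f x) \<le> C * (1 / (1 + norm x)) ^ N"
proof -
  obtain C where C: "0 < C" "\<And>x. (1 + norm x) ^ N * norm (iter_partial [] f x) \<le> C"
    using schwartz_decay[OF assms] by metis
  have "norm (f x) \<le> C * (1 / (1 + norm x)) ^ N" for x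
  proof -
    have p: "(1 + norm x) ^ N > 0" by (intro zero_less_power) (auto intro: add_pos_nonneg)
    show ?thesis using C(2)[of x] p by (simp add: field_simps)
  qed
  then show thesis using C(1) that by blast
qed

section \<open>The characteristic function as a tempered distribution\<close>

lemma indicator_tempered:
  fixes \<Omega> :: "(real^'n::finite) set"
  assumes "bounded \<Omega>" "\<Omega> \<in> sets borel"
  shows "regular_distribution (indicator \<Omega>) \<in> tempered_distributions"
proof -
  have em: "emeasure lborel \<Omega> < \<infinity>" by (rule emeasure_bounded_finite[OF assms(1)])
  have int: "integrable lborel (\<lambda>x. indicator \<Omega> x * f x)" and le: "norm (LINT x|lborel. indicator \<Omega> x * f x) \<le> C * measure lborel \<Omega>"
    if "f \<in> schwartz" "\<And>x. norm (f x) \<le> C" for f :: "real^'n \<Rightarrow> complex" and C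
  proof -
    have 1: "integrable lborel (\<lambda>x. C * indicat_real \<Omega> x)"
      using em assms(2) by (intro integrable_mult_right) simp
    show 2: "integrable lborel (\<lambda>x. indicator \<Omega> x * f x)"
    proof (rule Bochner_Integration.integrable_bound[OF 1])
      show "(\<lambda>x. indicator \<Omega> x * f x) \<in> borel_measurable lborel"
        using schwartz_measurable[OF that(1)] assms(2) by (auto intro!: borel_measurable_times)
      show "AE x in lborel. norm (indicator \<Omega> x * f x) \<le> norm (C * indicat_real \<Omega> x)"
      proof (rule AE_I2)
        fix x show "norm (indicator \<Omega> x * f x) \<le> norm (C * indicat_real \<Omega> x)"
          using that(2)[of x] by (cases "x \<in> \<Omega>") auto
      qed
    qed
    have "norm (LINT x|lborel. indicator \<Omega> x * f x) \<le> (LINT x|lborel. C * indicat_real \<Omega> x)"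
    proof (rule order_trans[OF integral_norm_bound integral_mono[OF integrable_norm[OF 2] 1]])
      fix x show "norm (indicator \<Omega> x * f x) \<le> C * indicat_real \<Omega> x"
        using that(2)[of x] by (cases "x \<in> \<Omega>") auto
    qed
    then show "norm (LINT x|lborel. indicator \<Omega> x * f x) \<le> C * measure lborel \<Omega>" by simp
  qed
  have bdd: "norm (f x) \<le> schwartz_seminorm 0 [] f" if "f \<in> schwartz" for f :: "real^'n \<Rightarrow> complex" and x
  proof -
    have "bdd_above (range (\<lambda>x. (1 + norm x) ^ m * norm (iter_partial is f x)))" for m "is"
      using that by (simp add: schwartz_def)
    from this[of 0 "[]"] have "(1 + norm x) ^ 0 * norm (iter_partial [] f x) \<le> schwartz_seminorm 0 [] f"
      unfolding schwartz_seminorm_def by (intro cSUP_upper) auto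
    then show ?thesis by simp
  qed
  \<comment> \<open>Seminorms of order 0 suffice, and the only multi-index of length 0 is the empty
    list.\<close>
  have "{is :: 'n list. length is \<le> 0} = {[]}" by auto
  then have norm: "norm (regular_distribution (indicator \<Omega>) f) \<le> measure lborel \<Omega> * (\<Sum>is | length is \<le> 0. schwartz_seminorm 0 is f)"
    if "f \<in> schwartz" for f :: "real^'n \<Rightarrow> complex"
    using le[OF that bdd[OF that]] that by (simp add: regular_distribution_def mult.commute)
  have lin: "regular_distribution (indicator \<Omega>) (\<lambda>x. a * f x + b * g x)
      = a * regular_distribution (indicator \<Omega>) f + b * regular_distribution (indicator \<Omega>) g"
    if fg: "f \<in> schwartz" "g \<in> schwartz" for f g :: "real^'n \<Rightarrow> complex" and a b
  proof -
    have "(LINT x|lborel. indicator \<Omega> x * (a * f x + b * g x))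
        = (LINT x|lborel. a * (indicator \<Omega> x * f x) + b * (indicator \<Omega> x * g x))"
      by (simp add: algebra_simps)
    also have "\<dots> = a * (LINT x|lborel. indicator \<Omega> x * f x) + b * (LINT x|lborel. indicator \<Omega> x * g x)"
      using int[OF fg(1) bdd[OF fg(1)]] int[OF fg(2) bdd[OF fg(2)]] by simp
    finally show ?thesis using fg schwartz_lincomb[OF fg] by (simp add: regular_distribution_def)
  qed
  have "regular_distribution (indicator \<Omega> :: real^'n \<Rightarrow> complex) \<in> extensional schwartz"
    by (simp add: regular_distribution_def)
  then show ?thesis
    unfolding tempered_distributions_def using norm lin by blast
qed

section \<open>Convolutions of the characteristic function\<close>

lemma nn_integral_lborel_affine:
  fixes t :: "'a::euclidean_space"
  assumes [measurable]: "f \<in> borel_measurable borel" and "c \<noteq> 0"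
  shows "(\<integral>\<^sup>+x. f x \<partial>lborel) = ennreal (\<bar>c\<bar> ^ DIM('a)) * (\<integral>\<^sup>+x. f (t + c *\<^sub>R x) \<partial>lborel)"
  by (subst lborel_affine[OF assms(2), of t])
    (simp add: nn_integral_density nn_integral_distr nn_integral_cmult)

lemma integral_lborel_affine:
  fixes t :: "'a::euclidean_space" and f :: "'a \<Rightarrow> 'b::{banach, second_countable_topology}"
  assumes [measurable]: "f \<in> borel_measurable borel" and "c \<noteq> 0"
  shows "(LINT x|lborel. f x) = (\<bar>c\<bar> ^ DIM('a)) *\<^sub>R (LINT x|lborel. f (t + c *\<^sub>R x))"
  by (subst lborel_affine[OF assms(2), of t]) (simp add: integral_density integral_distr)

lemma ennreal_mult3:
  "0 \<le> a \<Longrightarrow> 0 \<le> b \<Longrightarrow> 0 \<le> c \<Longrightarrow> ennreal a * (ennreal b * ennreal c) = ennreal (a * (b * c))"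
  by (simp add: ennreal_mult)

lemma two_power_square: "((2::real) ^ j)\<^sup>2 = 4 ^ j"
  by (simp add: power2_eq_square flip: power_mult_distrib)

lemma nn_integral_lborel_reflect:
  fixes x :: "'a::euclidean_space"
  assumes "f \<in> borel_measurable borel"
  shows "(\<integral>\<^sup>+y. f (x - y) \<partial>lborel) = (\<integral>\<^sup>+y. f y \<partial>lborel)"
  using nn_integral_lborel_affine[OF assms, of "-1" x] by simp

text \<open>The first \<open>k\<close> with \<open>u < 2 ^ k\<close> alone suffices: unless
  \<open>k = 0\<close>, it satisfies \<open>2 ^ (k - 1) \<le> u\<close>, and the factor
  \<open>2 ^ N\<close> pays for the shift by one.\<close>

lemma inverse_power_le_layers:
  fixes u :: real
  assumes "0 \<le> u"
  shows "ennreal ((1 / (1 + u)) ^ N) \<le> (\<Sum>k. ennreal (2 ^ N * (1 / 2 ^ N) ^ k) * indicator {x. x < 2 ^ k} u)"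
proof -
  have "\<exists>k. u < 2 ^ k" using real_arch_pow[of 2 u] by auto
  then obtain k where k: "u < 2 ^ k" "\<And>i. i < k \<Longrightarrow> \<not> u < 2 ^ i"
    using exists_least_iff[of "\<lambda>k. u < 2 ^ k"] by auto
  have "(1 / (1 + u)) ^ N \<le> 2 ^ N * (1 / 2 ^ N) ^ k"
  proof (cases k)
    case 0
    have "(1 / (1 + u)) ^ N \<le> 1" using assms by (intro power_le_one) auto
    also have "1 \<le> (2::real) ^ N" by (rule two_realpow_ge_one)
    finally show ?thesis using 0 by simp
  next
    case (Suc i)
    have "2 ^ i \<le> 1 + u" using k(2)[of i] Suc by simp
    then have "(1 / (1 + u)) ^ N \<le> (1 / 2 ^ i) ^ N"
      using assms by (intro power_mono divide_left_mono) auto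
    also have "\<dots> = 2 ^ N * (1 / 2 ^ N) ^ k"
      unfolding Suc by (simp add: power_divide mult.commute flip: power_mult)
    finally show ?thesis .
  qed
  then have "ennreal ((1 / (1 + u)) ^ N) \<le> (\<Sum>i\<in>{k}. ennreal (2 ^ N * (1 / 2 ^ N) ^ i) * indicator {x. x < 2 ^ i} u)"
    using k(1) by (simp add: ennreal_leI)
  also have "\<dots> \<le> (\<Sum>k. ennreal (2 ^ N * (1 / 2 ^ N) ^ k) * indicator {x. x < 2 ^ k} u)"
    by (intro sum_le_suminf) auto
  finally show ?thesis .
qed

lemma nn_integral_layers:
  assumes [measurable]: "u \<in> borel_measurable M" and "\<And>x. 0 \<le> u x" and [measurable]: "A \<in> sets M"
  shows "(\<integral>\<^sup>+x\<in>A. ennreal ((1 / (1 + u x)) ^ N) \<partial>M)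
    \<le> (\<Sum>k. ennreal (2 ^ N * (1 / 2 ^ N) ^ k) * emeasure M {x \<in> A. u x < 2 ^ k})"
proof -
  have A: "{x \<in> A. u x < 2 ^ k} \<in> sets M" for k
  proof -
    have "{x \<in> A. u x < 2 ^ k} = A \<inter> {x \<in> space M. u x < 2 ^ k}" using sets.sets_into_space[OF assms(3)] by auto
    then show ?thesis by simp
  qed
  have "(\<integral>\<^sup>+x\<in>A. ennreal ((1 / (1 + u x)) ^ N) \<partial>M)
    \<le> (\<integral>\<^sup>+x. (\<Sum>k. ennreal (2 ^ N * (1 / 2 ^ N) ^ k) * indicator {x \<in> A. u x < 2 ^ k} x) \<partial>M)"
  proof (rule nn_integral_mono)
    fix x
    show "ennreal ((1 / (1 + u x)) ^ N) * indicator A x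
      \<le> (\<Sum>k. ennreal (2 ^ N * (1 / 2 ^ N) ^ k) * indicator {x \<in> A. u x < 2 ^ k} x)"
      using inverse_power_le_layers[OF assms(2)[of x], of N]
      by (cases "x \<in> A") (auto simp: indicator_def)
  qed
  also have "\<dots> = (\<Sum>k. ennreal (2 ^ N * (1 / 2 ^ N) ^ k) * emeasure M {x \<in> A. u x < 2 ^ k})"
    using A by (subst nn_integral_suminf) (auto simp: nn_integral_cmult_indicator)
  finally show ?thesis .
qed

lemma suminf_geometric_ennreal_le:
  fixes f :: "nat \<Rightarrow> ennreal"
  assumes "\<And>k. f k \<le> ennreal (c * q ^ k)" "0 \<le> c" "0 \<le> q" "q < 1"
  shows "(\<Sum>k. f k) \<le> ennreal (c / (1 - q))"
proof -
  have "(\<lambda>k. c * q ^ k) sums (c * (1 / (1 - q)))"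
    using assms by (intro sums_mult geometric_sums) auto
  then have "(\<Sum>k. ennreal (c * q ^ k)) = ennreal (c / (1 - q))"
    using assms(2,3) by (subst suminf_ennreal_eq) auto
  moreover have "(\<Sum>k. f k) \<le> (\<Sum>k. ennreal (c * q ^ k))"
    by (intro suminf_le assms(1) summableI)
  ultimately show ?thesis by simp
qed

lemma emeasure_lborel_eq_area:
  "bounded S \<Longrightarrow> emeasure lborel S = ennreal (area S)"
  using emeasure_bounded_finite[of S] by (intro emeasure_eq_ennreal_measure) auto

text \<open>Layer \<open>k\<close> contributes \<open>8 * pi * (1/2) ^ k\<close>; 3 is the least
  integer exponent that is integrable in the plane.\<close>

lemma nn_integral_inverse_cube:
  "(\<integral>\<^sup>+x. ennreal ((1 / (1 + norm (x::real^2))) ^ 3) \<partial>lborel) \<le> ennreal (16 * pi)"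
proof -
  have "(\<integral>\<^sup>+x\<in>UNIV. ennreal ((1 / (1 + norm (x::real^2))) ^ 3) \<partial>lborel)
    \<le> (\<Sum>k. ennreal (2 ^ 3 * (1 / 2 ^ 3) ^ k) * emeasure lborel {x\<in>UNIV. norm (x::real^2) < 2 ^ k})"
    by (rule nn_integral_layers) auto
  also have "\<dots> \<le> ennreal (8 * pi / (1 - 1/2))"
  proof (rule suminf_geometric_ennreal_le)
    fix k
    have "{x\<in>UNIV. norm (x::real^2) < 2 ^ k} = ball 0 (2 ^ k)" by auto
    then have "emeasure lborel {x\<in>UNIV. norm (x::real^2) < 2 ^ k} = ennreal (pi * 4 ^ k)"
      using emeasure_lborel_eq_area[OF bounded_ball, of 0 "2 ^ k"] area_ball[of "2 ^ k" 0]
      by (simp add: power2_eq_square flip: power_mult_distrib)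
    then have "ennreal (2 ^ 3 * (1 / 2 ^ 3) ^ k) * emeasure lborel {x\<in>UNIV. norm (x::real^2) < 2 ^ k}
      = ennreal (2 ^ 3 * (1 / 2 ^ 3) ^ k * (pi * 4 ^ k))" by (simp flip: ennreal_mult)
    also have "2 ^ 3 * (1 / 2 ^ 3) ^ k * (pi * 4 ^ k) = 8 * pi * (1/2::real) ^ k"
      by (simp flip: power_mult_distrib)
    finally show "ennreal (2 ^ 3 * (1 / 2 ^ 3) ^ k) * emeasure lborel {x\<in>UNIV. norm (x::real^2) < 2 ^ k} \<le> ennreal (8 * pi * (1/2) ^ k)"
      by simp
  qed auto
  finally show ?thesis by simp
qed

lemma schwartz_integrable:
  fixes f :: "real^2 \<Rightarrow> complex"
  assumes "f \<in> schwartz"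
  shows "integrable lborel f"
proof -
  obtain C where C: "0 < C" "\<And>x. norm (f x) \<le> C * (1 / (1 + norm x)) ^ 3"
    using schwartz_bound[OF assms] by metis
  have "(\<integral>\<^sup>+x. ennreal (norm (f x)) \<partial>lborel) \<le> (\<integral>\<^sup>+x. ennreal C * ennreal ((1 / (1 + norm (x::real^2))) ^ 3) \<partial>lborel)"
    by (intro nn_integral_mono) (use C in \<open>auto simp flip: ennreal_mult intro!: ennreal_leI\<close>)
  also have "\<dots> = ennreal C * (\<integral>\<^sup>+x. ennreal ((1 / (1 + norm (x::real^2))) ^ 3) \<partial>lborel)"
    by (intro nn_integral_cmult) auto
  also have "\<dots> \<le> ennreal C * ennreal (16 * pi)"
    by (intro mult_left_mono nn_integral_inverse_cube) simp
  also have "\<dots> < \<infinity>"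
    using C(1) by (simp flip: ennreal_mult)
  finally show ?thesis
    using schwartz_measurable[OF assms] by (intro integrableI_bounded) auto
qed

text \<open>The segment from \<open>x\<close> to \<open>y\<close> has to cross the frontier.\<close>

lemma infdist_frontier_le:
  fixes x :: "'a::real_normed_vector"
  assumes "(x \<in> S) \<noteq> (y \<in> S)"
  shows "infdist x (frontier S) \<le> dist x y"
proof -
  have "closed_segment x y \<inter> frontier S \<noteq> {}"
    using assms by (intro connected_Int_frontier) auto
  then obtain z where z: "z \<in> closed_segment x y" "z \<in> frontier S" by auto
  have "infdist x (frontier S) \<le> dist x z" using z(2) by (rule infdist_le)
  also have "\<dots> \<le> dist x y" using segment_bound(1)[OF z(1)] by (simp add: dist_norm norm_minus_commute)
  finally show ?thesis .
qed

section \<open>The pieces of the characteristic function\<close>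

locale snowflake_convolution =
  fixes \<phi>\<^sub>0 \<phi> :: "real^2 \<Rightarrow> complex" and \<Omega> :: "(real^2) set" and A B C :: "real^2"
  assumes admissible: "admissible_pair \<phi>\<^sub>0 \<phi>"
    and triangle: "ccw_equilateral_triangle A B C"
    and open_domain: "open \<Omega>" and bounded_domain: "bounded \<Omega>"
    and frontier_domain: "frontier \<Omega> = snowflake_curve A B C"
begin

abbreviation kernel :: "nat \<Rightarrow> real^2 \<Rightarrow> complex" where
  "kernel \<equiv> dyadic_resolution \<phi>\<^sub>0 \<phi>"

definition piece :: "nat \<Rightarrow> real^2 \<Rightarrow> complex" where
  "piece j x = conv_distribution (kernel j) (regular_distribution (indicator \<Omega>)) x"

abbreviation curve_dist :: "real^2 \<Rightarrow> real" where
  "curve_dist x \<equiv> infdist x (frontier \<Omega>)"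

lemma schwartz_pair: "\<phi>\<^sub>0 \<in> schwartz" "\<phi> \<in> schwartz"
  using admissible by (auto simp: admissible_pair_def)

lemma kernel_pos: "0 < j \<Longrightarrow> kernel j z = 4 ^ j * \<phi> (2 ^ j *\<^sub>R z)"
  by (simp add: dyadic_resolution_def mult.commute[of j] power_mult)

lemma kernel_0: "kernel 0 = \<phi>\<^sub>0"
  by (simp add: dyadic_resolution_def fun_eq_iff)

lemma kernel_reflect_schwartz: "(\<lambda>y. kernel j (x - y)) \<in> schwartz"
  by (rule schwartz_dyadic_resolution[OF schwartz_pair])

lemma kernel_measurable [measurable]: "kernel j \<in> borel_measurable borel"
proof -
  have [measurable]: "\<phi>\<^sub>0 \<in> borel_measurable borel" "\<phi> \<in> borel_measurable borel"
    using schwartz_measurable schwartz_pair by auto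
  show ?thesis unfolding dyadic_resolution_def by measurable
qed

lemma domain_measurable [measurable]: "\<Omega> \<in> sets borel"
  using open_domain by simp

lemma piece_eq: "piece j x = (LINT y|lborel. indicator \<Omega> y * kernel j (x - y))"
  unfolding piece_def conv_distribution_def regular_distribution_def
  using kernel_reflect_schwartz[of j x] by simp

lemma piece_measurable [measurable]: "piece j \<in> borel_measurable borel"
proof -
  have "(\<lambda>x. LINT y|lborel. indicator \<Omega> y * kernel j (x - y)) \<in> borel_measurable borel"
    by measurable
  then show ?thesis unfolding piece_eq[abs_def] .
qed

lemma frontier_nonempty: "frontier \<Omega> \<noteq> {}"
  using ends_in_koch_arc(1)[of A B] unfolding frontier_domain snowflake_curve_def by auto

lemma curve_dist_less: "curve_dist x < r \<Longrightarrow> x \<in> nbhd (snowflake_curve A B C) r"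
  using infdist_attains_inf[OF frontier_closed frontier_nonempty, of x]
  unfolding mem_nbhd frontier_domain by metis

lemma curve_dist_measurable [measurable]: "curve_dist \<in> borel_measurable borel"
  by (intro borel_measurable_continuous_onI continuous_on_infdist continuous_on_id)

text \<open>The spectral support of the mother kernel excludes the origin, and the transform at the
  origin is a multiple of the mean.\<close>

lemma integral_mother: "(LINT x|lborel. \<phi> x) = 0"
proof -
  have "0 \<notin> fourier_support \<phi>" using admissible by (auto simp: admissible_pair_def)
  then have "0 \<notin> {\<xi>. fourier \<phi> \<xi> \<noteq> 0}"
    unfolding fourier_support_def using subsetD[OF closure_subset] by metis
  then have "of_real ((2 * pi) powr (- real CARD(2) / 2)) * (LINT x|lborel. \<phi> x) = 0"
    by (simp only: fourier_def mem_Collect_eq not_not inner_zero_right minus_zero cis_zero mult_1_left)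
  moreover have "(2 * pi) powr (- real CARD(2) / 2) \<noteq> 0" by simp
  ultimately show ?thesis by (metis mult_eq_0_iff of_real_eq_0_iff)
qed

lemma kernel_integrable: "integrable lborel (\<lambda>y. kernel j (x - y))"
  by (rule schwartz_integrable[OF kernel_reflect_schwartz])

lemma integral_kernel:
  assumes "0 < j"
  shows "(LINT y|lborel. kernel j (x - y)) = 0"
proof -
  have [measurable]: "\<phi> \<in> borel_measurable borel" using schwartz_measurable schwartz_pair by auto
  have "(LINT y|lborel. \<phi> y) = 4 ^ j * (LINT y|lborel. \<phi> (2 ^ j *\<^sub>R x + (- (2 ^ j)) *\<^sub>R y))"
    by (subst integral_lborel_affine[of \<phi> "- (2 ^ j)" "2 ^ j *\<^sub>R x"])
      (simp_all add: two_power_square scaleR_conv_of_real)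
  then have "(LINT y|lborel. \<phi> (2 ^ j *\<^sub>R (x - y))) = 0"
    using integral_mother by (simp add: scaleR_diff_right)
  then show ?thesis using assms by (simp add: kernel_pos)
qed

text \<open>Because of the vanishing mean a point inside \<Omega> sees, up to a sign, only the
  complement. Hence on either side of the curve only \<open>y\<close> at distance at least
  \<open>curve_dist x\<close> matter.\<close>

lemma piece_complement:
  assumes "0 < j"
  shows "piece j x = - (LINT y|lborel. indicator (- \<Omega>) y * kernel j (x - y))"
proof -
  have "(LINT y|lborel. kernel j (x - y)) = (LINT y|lborel. indicator \<Omega> y * kernel j (x - y) + indicator (- \<Omega>) y * kernel j (x - y))"
    by (intro Bochner_Integration.integral_cong) (auto simp: indicator_def)
  also have "\<dots> = piece j x + (LINT y|lborel. indicator (- \<Omega>) y * kernel j (x - y))"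
    unfolding piece_eq
  proof (rule Bochner_Integration.integral_add)
    show "integrable lborel (\<lambda>y. indicator \<Omega> y * kernel j (x - y))"
      "integrable lborel (\<lambda>y. indicator (- \<Omega>) y * kernel j (x - y))"
      by (rule Bochner_Integration.integrable_bound[OF kernel_integrable[of j x]]; simp add: norm_mult indicator_def)+
  qed
  finally show ?thesis using integral_kernel[OF assms] by (simp add: eq_neg_iff_add_eq_0)
qed

lemma piece_le_kernel_tail:
  assumes "0 < j"
  shows "ennreal (norm (piece j x)) \<le> (\<integral>\<^sup>+y\<in>{y. curve_dist x \<le> dist x y}. ennreal (norm (kernel j (x - y))) \<partial>lborel)"
proof -
  have *: "ennreal (norm (LINT y|lborel. indicator S y * kernel j (x - y)))
     \<le> (\<integral>\<^sup>+y\<in>{y. curve_dist x \<le> dist x y}. ennreal (norm (kernel j (x - y))) \<partial>lborel)"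
    if S: "S \<in> sets borel" "\<And>y. y \<in> S \<Longrightarrow> curve_dist x \<le> dist x y" for S
  proof -
    have "integrable lborel (\<lambda>y. indicator S y * kernel j (x - y))"
      by (rule Bochner_Integration.integrable_bound[OF kernel_integrable[of j x]]) (use S(1) in \<open>auto simp: norm_mult indicator_def\<close>)
    then have "ennreal (norm (LINT y|lborel. indicator S y * kernel j (x - y))) \<le> (\<integral>\<^sup>+y. ennreal (norm (indicator S y * kernel j (x - y))) \<partial>lborel)"
      by (rule integral_norm_bound_ennreal)
    also have "\<dots> \<le> (\<integral>\<^sup>+y\<in>{y. curve_dist x \<le> dist x y}. ennreal (norm (kernel j (x - y))) \<partial>lborel)"
      using S(2) by (intro nn_integral_mono) (auto simp: norm_mult indicator_def)
    finally show ?thesis .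
  qed
  show ?thesis
  proof (cases "x \<in> \<Omega>")
    case True
    show ?thesis
      unfolding piece_complement[OF assms] norm_minus_cancel
      by (rule *) (use True infdist_frontier_le[of x \<Omega>] in auto)
  next
    case False
    show ?thesis
      unfolding piece_eq by (rule *) (use False infdist_frontier_le[of x \<Omega>] in auto)
  qed
qed

text \<open>Of the \<open>N + 3\<close> powers of kernel decay, \<open>N\<close> are bounded by
  their value at the distance to the curve and leave the integral; the other three keep it finite,
  uniformly in \<open>j\<close> by scaling.\<close>

lemma piece_decay:
  obtains c where "0 < c" "\<And>j x. 0 < j \<Longrightarrow> norm (piece j x) \<le> c * (1 / (1 + 2 ^ j * curve_dist x)) ^ N"
proof -
  obtain c where c: "0 < c" "\<And>x. norm (\<phi> x) \<le> c * (1 / (1 + norm x)) ^ (N + 3)"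
    using schwartz_bound[OF schwartz_pair(2)] by metis
  have "norm (piece j x) \<le> (c * (16 * pi)) * (1 / (1 + 2 ^ j * curve_dist x)) ^ N" if j: "0 < j" for j x
  proof -
    let ?d = "(1 / (1 + 2 ^ j * curve_dist x)) ^ N"
    define g where "g z = ennreal ((1 / (1 + norm z)) ^ 3)" for z :: "real^2"
    have d0: "0 \<le> c * ?d" using c(1) infdist_nonneg[of x "frontier \<Omega>"] by auto
    have g [measurable]: "g \<in> borel_measurable borel" unfolding g_def by measurable
    have "ennreal (norm (piece j x)) \<le> (\<integral>\<^sup>+y\<in>{y. curve_dist x \<le> dist x y}. ennreal (norm (kernel j (x - y))) \<partial>lborel)"
      by (rule piece_le_kernel_tail[OF j])
    also have "\<dots> \<le> (\<integral>\<^sup>+y. ennreal (c * ?d) * (ennreal (4 ^ j) * g (2 ^ j *\<^sub>R x + (- (2 ^ j)) *\<^sub>R y)) \<partial>lborel)"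
    proof (rule nn_integral_mono)
      fix y
      have "norm (kernel j (x - y)) \<le> c * ?d * (4 ^ j * (1 / (1 + norm (2 ^ j *\<^sub>R (x - y)))) ^ 3)" if le: "curve_dist x \<le> dist x y"
      proof -
        have "norm (kernel j (x - y)) = 4 ^ j * norm (\<phi> (2 ^ j *\<^sub>R (x - y)))"
          using kernel_pos[OF j] by (simp add: norm_mult norm_power)
        also have "\<dots> \<le> 4 ^ j * (c * (1 / (1 + norm (2 ^ j *\<^sub>R (x - y)))) ^ (N + 3))"
          by (intro mult_left_mono c(2)) auto
        also have "\<dots> = c * (1 / (1 + norm (2 ^ j *\<^sub>R (x - y)))) ^ N * (4 ^ j * (1 / (1 + norm (2 ^ j *\<^sub>R (x - y)))) ^ 3)"
          by (simp add: power_add)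
        also have "\<dots> \<le> c * ?d * (4 ^ j * (1 / (1 + norm (2 ^ j *\<^sub>R (x - y)))) ^ 3)"
        proof -
          have "1 / (1 + norm (2 ^ j *\<^sub>R (x - y))) \<le> 1 / (1 + 2 ^ j * curve_dist x)"
            using le infdist_nonneg[of x "frontier \<Omega>"]
            by (intro divide_left_mono) (auto simp: dist_norm intro!: mult_pos_pos add_pos_nonneg)
          then have "(1 / (1 + norm (2 ^ j *\<^sub>R (x - y)))) ^ N \<le> ?d"
            by (rule power_mono) simp
          then show ?thesis
            using c(1) by (intro mult_right_mono mult_left_mono) auto
        qed
        finally show ?thesis .
      qed
      moreover have "2 ^ j *\<^sub>R x + (- (2 ^ j)) *\<^sub>R y = 2 ^ j *\<^sub>R (x - y)" by (simp add: scaleR_diff_right)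
      moreover have "ennreal (c * ?d) * (ennreal (4 ^ j) * g (2 ^ j *\<^sub>R (x - y)))
        = ennreal (c * ?d * (4 ^ j * (1 / (1 + norm (2 ^ j *\<^sub>R (x - y)))) ^ 3))"
        unfolding g_def by (rule ennreal_mult3) (use d0 in auto)
      ultimately show "ennreal (norm (kernel j (x - y))) * indicator {y. curve_dist x \<le> dist x y} y
        \<le> ennreal (c * ?d) * (ennreal (4 ^ j) * g (2 ^ j *\<^sub>R x + (- (2 ^ j)) *\<^sub>R y))"
        by (cases "curve_dist x \<le> dist x y") (simp_all only: indicator_def mem_Collect_eq if_True if_False
            of_bool_eq mult_1_right mult_zero_right zero_le ennreal_leI)
    qed
    also have "\<dots> = ennreal (c * ?d) * (\<integral>\<^sup>+y. g y \<partial>lborel)"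
      by (subst nn_integral_lborel_affine[OF g, of "- (2 ^ j)" "2 ^ j *\<^sub>R x"])
        (simp_all add: nn_integral_cmult two_power_square)
    also have "\<dots> \<le> ennreal (c * ?d) * ennreal (16 * pi)"
      unfolding g_def by (intro mult_left_mono nn_integral_inverse_cube) auto
    also have "\<dots> = ennreal (c * ?d * (16 * pi))"
      by (rule ennreal_mult[symmetric]) (use d0 in auto)
    finally have "norm (piece j x) \<le> c * ?d * (16 * pi)"
      by (rule ennreal_le_iff[THEN iffD1, rotated]) (use d0 in auto)
    then show ?thesis by (simp only: mult.assoc mult.commute[of ?d])
  qed
  then show thesis using c(1) by (intro that[of "c * (16 * pi)"]) auto
qed

text \<open>Level 0 lacks the vanishing mean and is bounded separately, by the integral of the
  modulus of its kernel.\<close>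

lemma piece_bounded:
  obtains c where "0 < c" "\<And>j x. norm (piece j x) \<le> c"
proof -
  obtain c where c: "0 < c" "\<And>j x. 0 < j \<Longrightarrow> norm (piece j x) \<le> c * (1 / (1 + 2 ^ j * curve_dist x)) ^ 0"
    using piece_decay[of 0] by blast
  define c0 where "c0 = (LINT z|lborel. norm (\<phi>\<^sub>0 z))"
  have [measurable]: "\<phi>\<^sub>0 \<in> borel_measurable borel" using schwartz_measurable schwartz_pair by auto
  have "norm (piece 0 x) \<le> c0" for x
  proof -
    have i: "integrable lborel (\<lambda>y. indicator \<Omega> y * kernel 0 (x - y))"
      by (rule Bochner_Integration.integrable_bound[OF kernel_integrable[of 0 x]]) (auto simp: norm_mult indicator_def)
    have "ennreal (norm (piece 0 x)) \<le> (\<integral>\<^sup>+y. ennreal (norm (indicator \<Omega> y * kernel 0 (x - y))) \<partial>lborel)"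
      unfolding piece_eq by (rule integral_norm_bound_ennreal[OF i])
    also have "\<dots> \<le> (\<integral>\<^sup>+y. ennreal (norm (\<phi>\<^sub>0 (x - y))) \<partial>lborel)"
      by (intro nn_integral_mono) (auto simp: norm_mult indicator_def kernel_0)
    also have "\<dots> = (\<integral>\<^sup>+y. ennreal (norm (\<phi>\<^sub>0 y)) \<partial>lborel)"
      by (rule nn_integral_lborel_reflect) measurable
    also have "\<dots> = ennreal c0"
      unfolding c0_def by (intro nn_integral_eq_integral integrable_norm schwartz_integrable schwartz_pair) auto
    finally show ?thesis by (simp add: c0_def)
  qed
  then have "norm (piece j x) \<le> c + \<bar>c0\<bar>" for j x
    using c(1) c(2)[of j x] abs_ge_self[of c0] order_trans[of "norm (piece 0 x)" c0 "\<bar>c0\<bar>"]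
    by (cases "j = 0") (simp_all add: add_increasing add_increasing2)
  then show thesis using c(1) by (intro that[of "c + \<bar>c0\<bar>"]) auto
qed


text \<open>Layer \<open>k\<close> has weight \<open>16 * (1/16) ^ k\<close>, while its area grows
  at most like \<open>2 ^ k * (4 * 4 ^ k)\<close>, by \<open>2 - koch_dim < 1\<close> and
  \<open>koch_dim < 2\<close>. The exponent 4 thus leaves a series of ratio 1/2.\<close>

lemma nn_integral_curve_layers:
  assumes [measurable]: "S \<in> sets borel" and "0 \<le> D"
    and D: "\<And>r. 0 < r \<Longrightarrow> emeasure lborel {x \<in> S. curve_dist x < r} \<le> ennreal (D * r powr (2 - koch_dim) * (1 + r) powr koch_dim)"
  shows "(\<integral>\<^sup>+x\<in>S. ennreal ((1 / (1 + 2 ^ j * curve_dist x)) ^ 4) \<partial>lborel) \<le> ennreal (128 * D * (1 / 2 ^ j) powr (2 - koch_dim))"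
proof -
  define b where "b = (1 / 2 ^ j :: real) powr (2 - koch_dim)"
  have b: "0 \<le> b" by (simp add: b_def)
  have "(\<integral>\<^sup>+x\<in>S. ennreal ((1 / (1 + 2 ^ j * curve_dist x)) ^ 4) \<partial>lborel)
    \<le> (\<Sum>k. ennreal (2 ^ 4 * (1 / 2 ^ 4) ^ k) * emeasure lborel {x \<in> S. 2 ^ j * curve_dist x < 2 ^ k})"
    by (rule nn_integral_layers) (auto intro!: infdist_nonneg mult_nonneg_nonneg)
  also have "\<dots> \<le> ennreal (64 * D * b / (1 - 1/2))"
  proof (rule suminf_geometric_ennreal_le)
    fix k
    define r :: real where "r = 2 ^ k * (1 / 2 ^ j)"
    have r: "0 < r" by (simp add: r_def)
    have "{x \<in> S. 2 ^ j * curve_dist x < 2 ^ k} = {x \<in> S. curve_dist x < r}"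
      by (auto simp: r_def field_simps)
    then have "emeasure lborel {x \<in> S. 2 ^ j * curve_dist x < 2 ^ k} \<le> ennreal (D * r powr (2 - koch_dim) * (1 + r) powr koch_dim)"
      using D[OF r] by simp
    also have "D * r powr (2 - koch_dim) * (1 + r) powr koch_dim \<le> D * (2 ^ k * b) * (4 * 4 ^ k)"
    proof (intro mult_mono mult_left_mono)
      have "((2::real) ^ k) powr (2 - koch_dim) \<le> (2 ^ k) powr 1"
        using koch_dim_bounds by (intro powr_mono) auto
      then show "r powr (2 - koch_dim) \<le> 2 ^ k * b"
        unfolding r_def b_def by (subst powr_mult) (auto intro!: mult_right_mono)
      have "r \<le> 2 ^ k * 1" unfolding r_def by (intro mult_left_mono) auto
      moreover have "(1::real) \<le> 2 ^ k" by (rule two_realpow_ge_one)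
      ultimately have "1 + r \<le> 2 * 2 ^ k" by argo
      then have "(1 + r) powr koch_dim \<le> (2 * 2 ^ k) powr koch_dim"
        using r koch_dim_bounds by (intro powr_mono2) auto
      also have "\<dots> \<le> (2 * 2 ^ k) powr 2"
      proof (rule powr_mono)
        show "(1::real) \<le> 2 * 2 ^ k" using two_realpow_ge_one[of "Suc k"] by simp
      qed (use koch_dim_bounds in simp)
      also have "\<dots> = 4 * 4 ^ k" by (simp add: power_mult_distrib two_power_square)
      finally show "(1 + r) powr koch_dim \<le> 4 * 4 ^ k" .
    qed (use assms(2) b in auto)
    finally have "emeasure lborel {x \<in> S. 2 ^ j * curve_dist x < 2 ^ k} \<le> ennreal (D * (2 ^ k * b) * (4 * 4 ^ k))"
      by (simp add: ennreal_leI)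
    then have "ennreal (2 ^ 4 * (1 / 2 ^ 4) ^ k) * emeasure lborel {x \<in> S. 2 ^ j * curve_dist x < 2 ^ k}
      \<le> ennreal (2 ^ 4 * (1 / 2 ^ 4) ^ k) * ennreal (D * (2 ^ k * b) * (4 * 4 ^ k))"
      by (rule mult_left_mono) simp
    also have "\<dots> = ennreal ((2 ^ 4 * (1 / 2 ^ 4) ^ k) * (D * (2 ^ k * b) * (4 * 4 ^ k)))"
      by (rule ennreal_mult[symmetric]) (use assms(2) b in auto)
    also have "(2 ^ 4 * (1 / 2 ^ 4) ^ k) * (D * (2 ^ k * b) * (4 * 4 ^ k)) = 64 * D * b * ((1 / 2 ^ 4) ^ k * 2 ^ k * 4 ^ k)"
      by simp
    also have "(1 / 2 ^ 4) ^ k * 2 ^ k * 4 ^ k = (1/2 :: real) ^ k"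
      by (simp flip: power_mult_distrib)
    finally show "ennreal (2 ^ 4 * (1 / 2 ^ 4) ^ k) * emeasure lborel {x \<in> S. 2 ^ j * curve_dist x < 2 ^ k}
      \<le> ennreal (64 * D * b * (1/2) ^ k)" .
  qed (use assms(2) b in auto)
  finally show ?thesis by (simp add: b_def mult.assoc)
qed

lemma curve_integrals:
  obtains c where "0 < c"
    "\<And>j. (\<integral>\<^sup>+x. ennreal ((1 / (1 + 2 ^ j * curve_dist x)) ^ 4) \<partial>lborel) \<le> ennreal (c * (1 / 2 ^ j) powr (2 - koch_dim))"
    "\<And>j z t. 0 < t \<Longrightarrow> t \<le> 1 \<Longrightarrow> (\<integral>\<^sup>+x\<in>ball z t. ennreal ((1 / (1 + 2 ^ j * curve_dist x)) ^ 4) \<partial>lborel)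
       \<le> ennreal (c * (1 / 2 ^ j) powr (2 - koch_dim) * t powr koch_dim)"
    "\<And>r. 0 < r \<Longrightarrow> emeasure lborel {x. curve_dist x < r} \<le> ennreal (c * r powr (2 - koch_dim) * (1 + r) powr koch_dim)"
proof -
  obtain D where D: "0 < D"
    "\<And>r z t. 0 < r \<Longrightarrow> 0 < t \<Longrightarrow> t \<le> 1 \<Longrightarrow>
       area (nbhd (snowflake_curve A B C) r \<inter> ball z t) \<le> D * r powr (2 - koch_dim) * t powr koch_dim"
    "\<And>r. 0 < r \<Longrightarrow> area (nbhd (snowflake_curve A B C) r) \<le> D * r powr (2 - koch_dim) * (1 + r) powr koch_dim"
    by (rule area_nbhd_snowflake[OF triangle]) (rule that; assumption)
  have bd: "bounded (nbhd (snowflake_curve A B C) r)" for r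
    using bounded_nbhd_koch_arc ccw_third_vertex(1)[OF triangle] ccw_third_vertex(1)[OF ccw_rotate[OF triangle]]
      ccw_third_vertex(1)[OF ccw_rotate[OF ccw_rotate[OF triangle]]]
    unfolding snowflake_curve_def nbhd_Un by (metis bounded_Un)
  have em: "emeasure lborel {x \<in> S. curve_dist x < r} \<le> ennreal (area (nbhd (snowflake_curve A B C) r \<inter> S))" if "open S" for S r
  proof -
    have "emeasure lborel {x \<in> S. curve_dist x < r} \<le> emeasure lborel (nbhd (snowflake_curve A B C) r \<inter> S)"
      using that by (intro emeasure_mono) (auto intro: curve_dist_less)
    then show ?thesis by (simp add: emeasure_lborel_eq_area bounded_Int bd)
  qed
  show thesis
  proof (rule that[of "128 * D"])
    show "0 < 128 * D" using D(1) by simp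
    have g: "emeasure lborel {x \<in> UNIV. curve_dist x < r} \<le> ennreal (D * r powr (2 - koch_dim) * (1 + r) powr koch_dim)" if "0 < r" for r
      using order_trans[OF em[of UNIV r]] D(3)[OF that] by (auto intro!: ennreal_leI)
    show "(\<integral>\<^sup>+x. ennreal ((1 / (1 + 2 ^ j * curve_dist x)) ^ 4) \<partial>lborel) \<le> ennreal (128 * D * (1 / 2 ^ j) powr (2 - koch_dim))" for j
      using nn_integral_curve_layers[of UNIV D j] g D(1) by simp
    show "emeasure lborel {x. curve_dist x < r} \<le> ennreal (128 * D * r powr (2 - koch_dim) * (1 + r) powr koch_dim)" if "0 < r" for r
    proof -
      have "D * (r powr (2 - koch_dim) * (1 + r) powr koch_dim) \<le> 128 * D * (r powr (2 - koch_dim) * (1 + r) powr koch_dim)"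
        using D(1) by (intro mult_right_mono) auto
      then show ?thesis using order_trans[OF g[OF that]] by (auto intro!: ennreal_leI simp: mult.assoc)
    qed
    show "(\<integral>\<^sup>+x\<in>ball z t. ennreal ((1 / (1 + 2 ^ j * curve_dist x)) ^ 4) \<partial>lborel)
       \<le> ennreal (128 * D * (1 / 2 ^ j) powr (2 - koch_dim) * t powr koch_dim)" if t: "0 < t" "t \<le> 1" for j z t
    proof -
      have "(\<integral>\<^sup>+x\<in>ball z t. ennreal ((1 / (1 + 2 ^ j * curve_dist x)) ^ 4) \<partial>lborel)
        \<le> ennreal (128 * (D * t powr koch_dim) * (1 / 2 ^ j) powr (2 - koch_dim))"
      proof (rule nn_integral_curve_layers)
        fix r :: real assume r: "0 < r"
        have "area (nbhd (snowflake_curve A B C) r \<inter> ball z t) \<le> (D * t powr koch_dim) * r powr (2 - koch_dim) * 1"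
          using D(2)[OF r t, of z] by (simp add: mult_ac)
        also have "\<dots> \<le> (D * t powr koch_dim) * r powr (2 - koch_dim) * (1 + r) powr koch_dim"
          using D(1) r koch_dim_bounds by (intro mult_left_mono ge_one_powr_ge_zero) auto
        finally show "emeasure lborel {x \<in> ball z t. curve_dist x < r} \<le> ennreal (D * t powr koch_dim * r powr (2 - koch_dim) * (1 + r) powr koch_dim)"
          using order_trans[OF em[of "ball z t" r]] by (auto intro!: ennreal_leI)
      qed (use D(1) in auto)
      then show ?thesis by (simp add: mult_ac)
    qed
  qed
qed

text \<open>From level 1 on the decay off the curve is integrated over layers. At level 0 Fubini
  gives \<open>area \<Omega>\<close> times the mass of the kernel instead; this carries no power of
  the radius, so the local bound starts at level 1.\<close>

lemma piece_L1:
  obtains c where "0 < c"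
    "\<And>j. (\<integral>\<^sup>+x. ennreal (norm (piece j x)) \<partial>lborel) \<le> ennreal (c * (1 / 2 ^ j) powr (2 - koch_dim))"
    "\<And>j z t. 0 < j \<Longrightarrow> 0 < t \<Longrightarrow> t \<le> 1 \<Longrightarrow> (\<integral>\<^sup>+x\<in>ball z t. ennreal (norm (piece j x)) \<partial>lborel)
       \<le> ennreal (c * (1 / 2 ^ j) powr (2 - koch_dim) * t powr koch_dim)"
proof -
  obtain c1 where c1: "0 < c1" "\<And>j x. 0 < j \<Longrightarrow> norm (piece j x) \<le> c1 * (1 / (1 + 2 ^ j * curve_dist x)) ^ 4"
    by (rule piece_decay[of 4]) (rule that; assumption)
  obtain c2 where c2: "0 < c2"
    "\<And>j. (\<integral>\<^sup>+x. ennreal ((1 / (1 + 2 ^ j * curve_dist x)) ^ 4) \<partial>lborel) \<le> ennreal (c2 * (1 / 2 ^ j) powr (2 - koch_dim))"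
    "\<And>j z t. 0 < t \<Longrightarrow> t \<le> 1 \<Longrightarrow> (\<integral>\<^sup>+x\<in>ball z t. ennreal ((1 / (1 + 2 ^ j * curve_dist x)) ^ 4) \<partial>lborel)
       \<le> ennreal (c2 * (1 / 2 ^ j) powr (2 - koch_dim) * t powr koch_dim)"
    by (rule curve_integrals) (rule that; assumption)
  have pos: "(\<integral>\<^sup>+x\<in>S. ennreal (norm (piece j x)) \<partial>lborel) \<le> ennreal (c1 * b)"
    if "0 < j" "S \<in> sets borel" "0 \<le> b"
      "(\<integral>\<^sup>+x\<in>S. ennreal ((1 / (1 + 2 ^ j * curve_dist x)) ^ 4) \<partial>lborel) \<le> ennreal b" for j S b
  proof -
    have "(\<integral>\<^sup>+x\<in>S. ennreal (norm (piece j x)) \<partial>lborel)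
        \<le> (\<integral>\<^sup>+x. ennreal c1 * (ennreal ((1 / (1 + 2 ^ j * curve_dist x)) ^ 4) * indicator S x) \<partial>lborel)"
    proof (rule nn_integral_mono)
      fix x
      have "ennreal (norm (piece j x)) \<le> ennreal c1 * ennreal ((1 / (1 + 2 ^ j * curve_dist x)) ^ 4)"
        using c1(1) c1(2)[OF that(1), of x] infdist_nonneg[of x "frontier \<Omega>"]
        by (subst ennreal_mult[symmetric]) (auto intro!: ennreal_leI)
      then show "ennreal (norm (piece j x)) * indicator S x
        \<le> ennreal c1 * (ennreal ((1 / (1 + 2 ^ j * curve_dist x)) ^ 4) * indicator S x)"
        by (cases "x \<in> S") auto
    qed
    also have "\<dots> = ennreal c1 * (\<integral>\<^sup>+x\<in>S. ennreal ((1 / (1 + 2 ^ j * curve_dist x)) ^ 4) \<partial>lborel)"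
      using that(2) by (intro nn_integral_cmult) auto
    also have "\<dots> \<le> ennreal c1 * ennreal b" using that(4) by (intro mult_left_mono) auto
    also have "\<dots> = ennreal (c1 * b)" using c1(1) that(3) by (simp add: ennreal_mult)
    finally show ?thesis .
  qed
  define c0 where "c0 = area \<Omega> * (LINT z|lborel. norm (\<phi>\<^sub>0 z))"
  have c0: "0 \<le> c0" unfolding c0_def by (intro mult_nonneg_nonneg Bochner_Integration.integral_nonneg) auto
  have [measurable]: "\<phi>\<^sub>0 \<in> borel_measurable borel" using schwartz_measurable schwartz_pair by auto
  have zero: "(\<integral>\<^sup>+x. ennreal (norm (piece 0 x)) \<partial>lborel) \<le> ennreal c0"
  proof -
    have "ennreal (norm (piece 0 x)) \<le> (\<integral>\<^sup>+y. indicator \<Omega> y * ennreal (norm (\<phi>\<^sub>0 (x - y))) \<partial>lborel)" for x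
    proof -
      have i: "integrable lborel (\<lambda>y. indicator \<Omega> y * kernel 0 (x - y))"
        by (rule Bochner_Integration.integrable_bound[OF kernel_integrable[of 0 x]]) (auto simp: norm_mult indicator_def)
      have "ennreal (norm (piece 0 x)) \<le> (\<integral>\<^sup>+y. ennreal (norm (indicator \<Omega> y * kernel 0 (x - y))) \<partial>lborel)"
        unfolding piece_eq by (rule integral_norm_bound_ennreal[OF i])
      also have "\<dots> = (\<integral>\<^sup>+y. indicator \<Omega> y * ennreal (norm (\<phi>\<^sub>0 (x - y))) \<partial>lborel)"
        by (intro nn_integral_cong) (auto simp: norm_mult indicator_def kernel_0)
      finally show ?thesis .
    qed
    then have "(\<integral>\<^sup>+x. ennreal (norm (piece 0 x)) \<partial>lborel)
        \<le> (\<integral>\<^sup>+x. (\<integral>\<^sup>+y. indicator \<Omega> y * ennreal (norm (\<phi>\<^sub>0 (x - y))) \<partial>lborel) \<partial>lborel)"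
      by (rule nn_integral_mono)
    also have "\<dots> = (\<integral>\<^sup>+y. (\<integral>\<^sup>+x. indicator \<Omega> y * ennreal (norm (\<phi>\<^sub>0 (x - y))) \<partial>lborel) \<partial>lborel)"
      by (rule lborel_pair.Fubini') measurable
    also have "\<dots> = (\<integral>\<^sup>+y. indicator \<Omega> y * (\<integral>\<^sup>+x. ennreal (norm (\<phi>\<^sub>0 x)) \<partial>lborel) \<partial>lborel)"
    proof (rule nn_integral_cong)
      fix y
      have "(\<integral>\<^sup>+x. indicator \<Omega> y * ennreal (norm (\<phi>\<^sub>0 (x - y))) \<partial>lborel) = indicator \<Omega> y * (\<integral>\<^sup>+x. ennreal (norm (\<phi>\<^sub>0 (x - y))) \<partial>lborel)"
        by (intro nn_integral_cmult) measurable
      also have "(\<integral>\<^sup>+x. ennreal (norm (\<phi>\<^sub>0 (x - y))) \<partial>lborel) = (\<integral>\<^sup>+x. ennreal (norm (\<phi>\<^sub>0 x)) \<partial>lborel)"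
        using nn_integral_lborel_affine[of "\<lambda>x. ennreal (norm (\<phi>\<^sub>0 x))" 1 "- y"] by simp
      finally show "(\<integral>\<^sup>+x. indicator \<Omega> y * ennreal (norm (\<phi>\<^sub>0 (x - y))) \<partial>lborel)
        = indicator \<Omega> y * (\<integral>\<^sup>+x. ennreal (norm (\<phi>\<^sub>0 x)) \<partial>lborel)" .
    qed
    also have "(\<integral>\<^sup>+x. ennreal (norm (\<phi>\<^sub>0 x)) \<partial>lborel) = ennreal (LINT z|lborel. norm (\<phi>\<^sub>0 z))"
      by (intro nn_integral_eq_integral integrable_norm schwartz_integrable schwartz_pair) auto
    also have "(\<integral>\<^sup>+y. indicator \<Omega> y * ennreal (LINT z|lborel. norm (\<phi>\<^sub>0 z)) \<partial>lborel)
        = emeasure lborel \<Omega> * ennreal (LINT z|lborel. norm (\<phi>\<^sub>0 z))"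
      by (subst nn_integral_multc) auto
    also have "\<dots> = ennreal c0"
      unfolding c0_def emeasure_lborel_eq_area[OF bounded_domain]
      by (intro ennreal_mult[symmetric] Bochner_Integration.integral_nonneg) auto
    finally show ?thesis .
  qed
  show thesis
  proof (rule that[of "c1 * c2 + c0"])
    show "0 < c1 * c2 + c0" using c1(1) c2(1) c0 by (simp add: add_pos_nonneg)
    show "(\<integral>\<^sup>+x. ennreal (norm (piece j x)) \<partial>lborel) \<le> ennreal ((c1 * c2 + c0) * (1 / 2 ^ j) powr (2 - koch_dim))" for j
    proof (cases "j = 0")
      case True
      have "ennreal c0 \<le> ennreal (c1 * c2 + c0)" using c1(1) c2(1) by (intro ennreal_leI) simp
      then show ?thesis using order_trans[OF zero] True by simp
    next
      case False
      then have "(\<integral>\<^sup>+x. ennreal (norm (piece j x)) \<partial>lborel) \<le> ennreal (c1 * (c2 * (1 / 2 ^ j) powr (2 - koch_dim)))"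
        using pos[of j UNIV] c2(1) c2(2)[of j] by simp
      also have "\<dots> \<le> ennreal ((c1 * c2 + c0) * (1 / 2 ^ j) powr (2 - koch_dim))"
        using c0 by (intro ennreal_leI) (simp add: distrib_right mult.assoc)
      finally show ?thesis .
    qed
    show "(\<integral>\<^sup>+x\<in>ball z t. ennreal (norm (piece j x)) \<partial>lborel)
       \<le> ennreal ((c1 * c2 + c0) * (1 / 2 ^ j) powr (2 - koch_dim) * t powr koch_dim)" if "0 < j" "0 < t" "t \<le> 1" for j z t
    proof -
      have "(\<integral>\<^sup>+x\<in>ball z t. ennreal (norm (piece j x)) \<partial>lborel)
        \<le> ennreal (c1 * (c2 * (1 / 2 ^ j) powr (2 - koch_dim) * t powr koch_dim))"
        using c2(1) by (intro pos c2(3) that) auto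
      also have "\<dots> \<le> ennreal ((c1 * c2 + c0) * (1 / 2 ^ j) powr (2 - koch_dim) * t powr koch_dim)"
        using c0 by (intro ennreal_leI) (simp add: distrib_right mult.assoc)
      finally show ?thesis .
    qed
  qed
qed

end

section \<open>Dyadic cubes\<close>

text \<open>The inclusion in a ball lets the area estimates, which are proved for balls, serve for
  cubes.\<close>

lemma dyadic_cube_measurable [measurable, simp]: "dyadic_cube i (k :: int^2) \<in> sets borel"
  and emeasure_dyadic_cube: "emeasure lborel (dyadic_cube i (k :: int^2)) = ennreal ((2 powi (- i))\<^sup>2)"
  and dyadic_cube_subset_ball: "dyadic_cube i (k :: int^2) \<subseteq> ball (2 powi (- i) *\<^sub>R (\<chi> m. real_of_int (k $ m))) (2 * 2 powi (- i))"
proof -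
  define s :: real where "s = 2 powi (- i)"
  define t :: "real^2" where "t = s *\<^sub>R (\<chi> m. real_of_int (k $ m))"
  define Q where "Q = {x :: real^2. \<forall>m. 0 \<le> x $ m \<and> x $ m < 1}"
  have s: "s > 0" by (simp add: s_def)
  have Q: "Q \<in> sets borel"
  proof -
    have "Q = {x. 0 \<le> x $ 1} \<inter> {x. x $ 1 < 1} \<inter> {x. 0 \<le> x $ 2} \<inter> {x. x $ 2 < 1}"
      unfolding Q_def by (auto simp: forall_2)
    then show ?thesis
      by (auto intro!: sets.Int borel_closed borel_open closed_Collect_le open_Collect_less continuous_intros)
  qed
  have mem: "x \<in> dyadic_cube i k \<longleftrightarrow> (1 / s) *\<^sub>R (x - t) \<in> Q" for x
  proof
    assume "x \<in> dyadic_cube i k"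
    then obtain y where "y \<in> Q" "x = s *\<^sub>R y + t"
      unfolding dyadic_cube_def Q_def s_def t_def by (auto simp: scaleR_add_right)
    then show "(1 / s) *\<^sub>R (x - t) \<in> Q" using s by simp
  next
    assume *: "(1 / s) *\<^sub>R (x - t) \<in> Q"
    have "x = s *\<^sub>R ((1 / s) *\<^sub>R (x - t) + (\<chi> m. real_of_int (k $ m)))"
      using s by (simp add: scaleR_add_right t_def)
    then show "x \<in> dyadic_cube i k"
      using * unfolding dyadic_cube_def Q_def s_def by blast
  qed
  have "(\<lambda>x. (1 / s) *\<^sub>R (x - t)) -` Q \<inter> space borel \<in> sets borel"
    by (rule measurable_sets[OF _ Q]) measurable
  moreover have "dyadic_cube i k = (\<lambda>x. (1 / s) *\<^sub>R (x - t)) -` Q \<inter> space borel" using mem by auto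
  ultimately show meas: "dyadic_cube i k \<in> sets borel" by simp
  have Q1: "emeasure lborel Q = 1"
  proof (rule antisym)
    \<comment> \<open>The half-open unit cube lies between an open and a closed box of equal
      measure.\<close>
    define w where "w = ((\<chi> m. 1) :: real^2)"
    have w: "w \<bullet> b = 1" if "b \<in> Basis" for b using that by (auto simp: w_def Basis_vec_def inner_axis)
    have "Q \<subseteq> cbox 0 w" "box 0 w \<subseteq> Q"
      unfolding Q_def w_def by (auto simp: mem_box_cart) (meson less_imp_le)+
    then have "emeasure lborel Q \<le> emeasure lborel (cbox 0 w)" "emeasure lborel (box 0 w) \<le> emeasure lborel Q"
      using Q by (auto intro!: emeasure_mono)
    moreover have "emeasure lborel (cbox 0 w) = 1" "emeasure lborel (box 0 w) = 1"
      by (simp_all add: emeasure_lborel_cbox_eq emeasure_lborel_box_eq w)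
    ultimately show "emeasure lborel Q \<le> 1" "1 \<le> emeasure lborel Q" by auto
  qed
  have "emeasure lborel (dyadic_cube i k) = (\<integral>\<^sup>+x. indicator (dyadic_cube i k) x \<partial>lborel)"
    using meas by simp
  also have "\<dots> = ennreal (\<bar>s\<bar> ^ DIM(real^2)) * (\<integral>\<^sup>+x. indicator (dyadic_cube i k) (t + s *\<^sub>R x) \<partial>lborel)"
    using meas s by (intro nn_integral_lborel_affine) auto
  also have "(\<lambda>x. indicator (dyadic_cube i k) (t + s *\<^sub>R x) :: ennreal) = indicator Q"
    using s by (auto simp: mem indicator_def)
  finally show "emeasure lborel (dyadic_cube i k) = ennreal ((2 powi (- i))\<^sup>2)"
    using Q Q1 s by (simp add: s_def)
  show "dyadic_cube i k \<subseteq> ball (2 powi (- i) *\<^sub>R (\<chi> m. real_of_int (k $ m))) (2 * 2 powi (- i))"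
  proof
    fix x assume "x \<in> dyadic_cube i k"
    then have *: "(1 / s) *\<^sub>R (x - t) \<in> Q" by (simp add: mem)
    have "norm ((1 / s) *\<^sub>R (x - t)) \<le> \<bar>((1 / s) *\<^sub>R (x - t)) $ 1\<bar> + \<bar>((1 / s) *\<^sub>R (x - t)) $ 2\<bar>"
      using norm_le_l1_cart[of "(1 / s) *\<^sub>R (x - t)"] by (simp add: sum_2)
    also have "\<dots> < 2" using * unfolding Q_def by (auto simp: forall_2)
    finally have "norm (x - t) / s < 2" unfolding norm_scaleR using s by simp
    then have "norm (x - t) < 2 * s" using s by (simp add: field_simps)
    then show "x \<in> ball (2 powi (- i) *\<^sub>R (\<chi> m. real_of_int (k $ m))) (2 * 2 powi (- i))"
      by (simp add: dist_norm norm_minus_commute t_def s_def)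
  qed
qed

lemma measure_dyadic_cube: "measure lborel (dyadic_cube i (k :: int^2)) = (2 powi (- i))\<^sup>2"
  unfolding measure_def emeasure_dyadic_cube by simp

section \<open>Membership\<close>

lemma epowr_ennreal: "0 \<le> a \<Longrightarrow> epowr (ennreal a) r = ennreal (a powr r)"
  by (simp add: epowr_def)

lemma epowr_mono:
  assumes "x \<le> y" "0 \<le> r"
  shows "epowr x r \<le> epowr y r"
proof (cases "y = \<infinity>")
  case False
  then have "x \<noteq> \<infinity>" "enn2real x \<le> enn2real y"
    using assms(1) by (auto intro!: enn2real_mono simp: less_top[symmetric] top_unique)
  then show ?thesis using False assms(2) by (auto simp: epowr_def intro!: ennreal_leI powr_mono2)
qed (simp add: epowr_def)

lemma epowr_le: "x \<le> ennreal a \<Longrightarrow> 0 \<le> a \<Longrightarrow> 0 \<le> r \<Longrightarrow> epowr x r \<le> ennreal (a powr r)"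
  using epowr_mono[of x "ennreal a" r] by (simp add: epowr_ennreal)

lemma Lp_norm_on_ennreal:
  "0 \<le> p \<Longrightarrow> Lp_norm_on (ennreal p) P g = epowr (\<integral>\<^sup>+x\<in>P. epowr (g x) p \<partial>lborel) (1 / p)"
  by (simp add: Lp_norm_on_def)

text \<open>Uniform in \<open>q\<close>: a power of at least 1 only improves the ratio, and the
  final root of \<open>1 / (1 - \<rho>)\<close> does not exceed that number itself.\<close>

lemma lq_norm_from_geometric:
  assumes "0 \<le> R" "0 \<le> \<rho>" "\<rho> < 1" "1 \<le> q" and a: "\<And>i. a (J + i) \<le> ennreal (R * \<rho> ^ i)"
  shows "lq_norm_from q J a \<le> ennreal (R / (1 - \<rho>))"
proof (cases "q = \<infinity>")
  case True
  have "a j \<le> ennreal (R / (1 - \<rho>))" if "J \<le> j" for j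
  proof -
    have "R * \<rho> ^ (j - J) \<le> R * 1" using assms by (intro mult_left_mono power_le_one) auto
    also have "\<dots> \<le> R / (1 - \<rho>)" using assms mult_left_mono[of "1 - \<rho>" 1 R] by (simp add: field_simps)
    finally show ?thesis using order_trans[OF a[of "j - J"]] that by (auto intro: ennreal_leI)
  qed
  then show ?thesis using True by (auto simp: lq_norm_from_def intro!: SUP_least)
next
  case False
  define r where "r = enn2real q"
  have r: "1 \<le> r" using enn2real_mono[of 1 q] assms(4) False by (simp add: r_def less_top)
  have "(\<Sum>i. epowr (a (J + i)) r) \<le> ennreal (R powr r / (1 - \<rho>))"
  proof (rule suminf_geometric_ennreal_le)
    fix i
    have "epowr (a (J + i)) r \<le> ennreal ((R * \<rho> ^ i) powr r)"
      using a assms r by (intro epowr_le) auto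
    also have "(R * \<rho> ^ i) powr r = R powr r * (\<rho> ^ i) powr r" using assms by (simp add: powr_mult)
    also have "\<dots> \<le> R powr r * (\<rho> ^ i) powr 1"
      using assms r by (intro mult_left_mono powr_mono' power_le_one) auto
    finally show "epowr (a (J + i)) r \<le> ennreal (R powr r * \<rho> ^ i)"
      using assms by (simp add: ennreal_leI)
  qed (use assms in auto)
  then have "lq_norm_from q J a \<le> ennreal ((R powr r / (1 - \<rho>)) powr (1 / r))"
    unfolding lq_norm_from_def r_def[symmetric] using False r assms by (simp add: epowr_le)
  also have "(R powr r / (1 - \<rho>)) powr (1 / r) = R * (1 / (1 - \<rho>)) powr (1 / r)"
    using assms r by (simp add: powr_divide powr_powr)
  also have "\<dots> \<le> R * (1 / (1 - \<rho>)) powr 1"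
    using assms r by (intro mult_left_mono powr_mono) auto
  finally show ?thesis using assms by (simp add: ennreal_leI)
qed

text \<open>Gives up smoothness \<epsilon> to exchange the inner \<open>q\<close>-norm for a
  \<open>p\<close>-sum: every term is at most the root of the \<open>p\<close>-sum times a geometric
  factor, which controls any \<open>q\<close>. The \<open>p\<close>-sum can then be integrated term
  by term.\<close>

lemma lq_norm_from_weighted_le:
  fixes b :: "nat \<Rightarrow> real"
  assumes "0 < \<epsilon>" "1 \<le> p" "1 \<le> q" "\<And>j. 0 \<le> b j"
  shows "epowr (lq_norm_from q J (\<lambda>j. ennreal (2 powr (real j * s)) * ennreal (b j))) p
    \<le> ennreal ((1 / (1 - 2 powr (- \<epsilon>))) powr p) * (\<Sum>i. ennreal ((2 powr (real (J + i) * (s + \<epsilon>)) * b (J + i)) powr p))"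
proof -
  define S where "S = (\<Sum>i. ennreal ((2 powr (real (J + i) * (s + \<epsilon>)) * b (J + i)) powr p))"
  define \<rho> :: real where "\<rho> = 2 powr (- \<epsilon>)"
  have \<rho>: "0 < \<rho>" "\<rho> < 1" using assms(1) powr_less_mono[of "- \<epsilon>" 0 2] by (auto simp: \<rho>_def)
  show ?thesis
  proof (cases "S = \<infinity>")
    case True
    have "(1 / (1 - \<rho>)) powr p > 0" using \<rho> by simp
    then show ?thesis using True unfolding S_def \<rho>_def by (simp add: ennreal_mult_top)
  next
    case False
    define \<sigma> where "\<sigma> = enn2real S"
    have S: "S = ennreal \<sigma>" "0 \<le> \<sigma>" using False by (auto simp: \<sigma>_def less_top)
    have "ennreal (2 powr (real (J + i) * s)) * ennreal (b (J + i)) \<le> ennreal (\<sigma> powr (1 / p) * \<rho> ^ i)" for i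
    proof -
      define x where "x = 2 powr (real (J + i) * (s + \<epsilon>)) * b (J + i)"
      have x: "0 \<le> x" using assms(4) by (simp add: x_def)
      have "(\<Sum>i\<in>{i}. ennreal ((2 powr (real (J + i) * (s + \<epsilon>)) * b (J + i)) powr p)) \<le> S"
        unfolding S_def by (rule sum_le_suminf) auto
      then have "x powr p \<le> \<sigma>" using S by (simp add: x_def)
      then have "(x powr p) powr (1 / p) \<le> \<sigma> powr (1 / p)" using assms(2) by (intro powr_mono2) auto
      then have le: "x \<le> \<sigma> powr (1 / p)" using assms(2) x by (simp add: powr_powr)
      have "2 powr (real (J + i) * s) * b (J + i) = x * \<rho> ^ (J + i)"
        unfolding x_def \<rho>_def by (simp add: powr_realpow[symmetric] powr_powr mult_ac flip: powr_add) (simp add: algebra_simps flip: powr_add)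
      also have "\<dots> \<le> \<sigma> powr (1 / p) * \<rho> ^ i"
        using le x \<rho> by (intro mult_mono power_decreasing) auto
      finally show ?thesis using assms(4) by (simp add: ennreal_leI flip: ennreal_mult)
    qed
    then have "lq_norm_from q J (\<lambda>j. ennreal (2 powr (real j * s)) * ennreal (b j)) \<le> ennreal (\<sigma> powr (1 / p) / (1 - \<rho>))"
      using \<rho> assms(3) by (intro lq_norm_from_geometric) auto
    then have "epowr (lq_norm_from q J (\<lambda>j. ennreal (2 powr (real j * s)) * ennreal (b j))) p
      \<le> ennreal ((\<sigma> powr (1 / p) / (1 - \<rho>)) powr p)"
      using \<rho> assms(2) by (intro epowr_le) auto
    also have "(\<sigma> powr (1 / p) / (1 - \<rho>)) powr p = (1 / (1 - \<rho>)) powr p * \<sigma>"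
      using \<rho> assms(2) S(2) by (simp add: powr_divide powr_powr)
    also have "ennreal \<dots> = ennreal ((1 / (1 - \<rho>)) powr p) * S"
      using S by (simp add: ennreal_mult)
    finally show ?thesis unfolding S_def \<rho>_def .
  qed
qed

text \<open>For small cubes \<open>\<tau> \<le> koch_dim / (2 * p)\<close> says that the local gain
  \<open>l powr (koch_dim / p)\<close> pays for the normalisation; for large cubes the normalising
  factor is itself at most 1.\<close>

lemma cube_normalization:
  assumes "0 < l" "1 \<le> p" "0 \<le> \<tau>" "\<tau> \<le> koch_dim / (2 * p)"
  shows "1 / (l\<^sup>2) powr \<tau> * (min 1 l powr koch_dim) powr (1 / p) \<le> 1"
proof (cases "l \<ge> 1")
  case True
  then have "1 \<le> (l\<^sup>2) powr \<tau>" using assms by (intro ge_one_powr_ge_zero) auto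
  then show ?thesis using True by simp
next
  case False
  have "(min 1 l powr koch_dim) powr (1 / p) = l powr (koch_dim / p)"
    using False by (simp add: powr_powr)
  also have "\<dots> \<le> l powr (2 * \<tau>)"
    using False assms by (intro powr_mono') (auto simp: field_simps)
  also have "\<dots> = (l\<^sup>2) powr \<tau>"
    using assms(1) by (simp add: powr_powr flip: powr_numeral)
  finally show ?thesis using assms(1) by (simp add: field_simps)
qed

section \<open>The two memberships\<close>

context snowflake_convolution
begin

text \<open>Uniform boundedness reduces the power \<open>p\<close> to the first power. A cube with
  \<open>i > 0\<close> lies in a ball of radius at most 1 and involves only levels
  \<open>j > 0\<close>, so the local bound applies; all larger cubes use the global one.\<close>

lemma piece_Lp_cube:
  assumes "1 \<le> p"
  obtains c where "0 < c"
    "\<And>i k j. nat i \<le> j \<Longrightarrow> (\<integral>\<^sup>+x\<in>dyadic_cube i k. ennreal (norm (piece j x) powr p) \<partial>lborel)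
       \<le> ennreal (c * (1 / 2 ^ j) powr (2 - koch_dim) * min 1 (2 powi (- i)) powr koch_dim)"
proof -
  obtain c0 where c0: "0 < c0" "\<And>j x. norm (piece j x) \<le> c0"
    by (rule piece_bounded) (rule that; assumption)
  obtain c1 where c1: "0 < c1"
    "\<And>j. (\<integral>\<^sup>+x. ennreal (norm (piece j x)) \<partial>lborel) \<le> ennreal (c1 * (1 / 2 ^ j) powr (2 - koch_dim))"
    "\<And>j z t. 0 < j \<Longrightarrow> 0 < t \<Longrightarrow> t \<le> 1 \<Longrightarrow> (\<integral>\<^sup>+x\<in>ball z t. ennreal (norm (piece j x)) \<partial>lborel)
       \<le> ennreal (c1 * (1 / 2 ^ j) powr (2 - koch_dim) * t powr koch_dim)"
    by (rule piece_L1) (rule that; assumption)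
  have pw: "norm (piece j x) powr p \<le> c0 powr (p - 1) * norm (piece j x)" for j x
  proof (cases "piece j x = 0")
    case False
    then have "norm (piece j x) powr p = norm (piece j x) powr (p - 1) * norm (piece j x)"
      by (simp add: powr_diff)
    also have "\<dots> \<le> c0 powr (p - 1) * norm (piece j x)"
      using c0(2)[of j x] assms by (intro mult_right_mono powr_mono2) auto
    finally show ?thesis .
  qed simp
  have L1: "(\<integral>\<^sup>+x\<in>S. ennreal (norm (piece j x) powr p) \<partial>lborel) \<le> ennreal (c0 powr (p - 1) * b)"
    if "S \<subseteq> T" "T \<in> sets borel" "(\<integral>\<^sup>+x\<in>T. ennreal (norm (piece j x)) \<partial>lborel) \<le> ennreal b" "0 \<le> b" for S T j b
  proof -
    have "(\<integral>\<^sup>+x\<in>S. ennreal (norm (piece j x) powr p) \<partial>lborel)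
      \<le> (\<integral>\<^sup>+x. ennreal (c0 powr (p - 1)) * (ennreal (norm (piece j x)) * indicator T x) \<partial>lborel)"
    proof (rule nn_integral_mono)
      fix x
      have "ennreal (norm (piece j x) powr p) \<le> ennreal (c0 powr (p - 1)) * ennreal (norm (piece j x))"
        using pw[of j x] by (simp add: ennreal_leI flip: ennreal_mult)
      then show "ennreal (norm (piece j x) powr p) * indicator S x \<le> ennreal (c0 powr (p - 1)) * (ennreal (norm (piece j x)) * indicator T x)"
        using that(1) by (cases "x \<in> S") auto
    qed
    also have "\<dots> = ennreal (c0 powr (p - 1)) * (\<integral>\<^sup>+x\<in>T. ennreal (norm (piece j x)) \<partial>lborel)"
      using that(2) by (intro nn_integral_cmult) auto
    also have "\<dots> \<le> ennreal (c0 powr (p - 1)) * ennreal b" using that(3) by (intro mult_left_mono) auto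
    also have "\<dots> = ennreal (c0 powr (p - 1) * b)" using that(4) by (simp add: ennreal_mult)
    finally show ?thesis .
  qed
  show thesis
  proof (rule that[of "c0 powr (p - 1) * (4 * c1)"])
    show "0 < c0 powr (p - 1) * (4 * c1)" using c0(1) c1(1) by simp
    fix i :: int and k :: "int^2" and j :: nat assume j: "nat i \<le> j"
    define l :: real where "l = 2 powi (- i)"
    have l: "0 < l" by (simp add: l_def)
    show "(\<integral>\<^sup>+x\<in>dyadic_cube i k. ennreal (norm (piece j x) powr p) \<partial>lborel)
       \<le> ennreal (c0 powr (p - 1) * (4 * c1) * (1 / 2 ^ j) powr (2 - koch_dim) * min 1 (2 powi (- i)) powr koch_dim)"
    proof (cases "i \<le> 0")
      case True
      then have "l \<ge> 1" unfolding l_def by (intro one_le_power_int) auto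
      then have m: "min 1 (2 powi (- i)) powr koch_dim = 1" by (simp add: l_def)
      have "(\<integral>\<^sup>+x\<in>dyadic_cube i k. ennreal (norm (piece j x) powr p) \<partial>lborel)
         \<le> ennreal (c0 powr (p - 1) * (c1 * (1 / 2 ^ j) powr (2 - koch_dim)))"
        by (rule L1[of _ UNIV]) (use c1 in auto)
      also have "\<dots> \<le> ennreal (c0 powr (p - 1) * (4 * c1) * (1 / 2 ^ j) powr (2 - koch_dim) * min 1 (2 powi (- i)) powr koch_dim)"
        unfolding m using c1(1) by (intro ennreal_leI) (simp add: mult_left_mono mult_right_mono mult.assoc)
      finally show ?thesis .
    next
      case False
      then have "nat i > 0" by simp
      then have jpos: "0 < j" using j by linarith
      have "l = 1 / 2 ^ nat i" using False by (simp add: l_def power_int_def power_one_over inverse_eq_divide)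
      also have "\<dots> \<le> 1 / 2 ^ 1" using \<open>nat i > 0\<close> by (intro divide_left_mono power_increasing) auto
      finally have l2: "2 * l \<le> 1" by simp
      have "(\<integral>\<^sup>+x\<in>dyadic_cube i k. ennreal (norm (piece j x) powr p) \<partial>lborel)
         \<le> ennreal (c0 powr (p - 1) * (c1 * (1 / 2 ^ j) powr (2 - koch_dim) * (2 * l) powr koch_dim))"
        by (rule L1[OF dyadic_cube_subset_ball[of i k]]) (use c1(3)[OF jpos _ l2] c1(1) l in \<open>auto simp: l_def\<close>)
      also have "(2 * l) powr koch_dim \<le> 4 * l powr koch_dim"
      proof -
        have "2 powr koch_dim \<le> (2::real) powr 2" using koch_dim_bounds by (intro powr_mono) auto
        then show ?thesis using l by (simp add: powr_mult)
      qed
      also have "l powr koch_dim = min 1 (2 powi (- i)) powr koch_dim" using l2 l by (simp add: l_def)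
      finally show ?thesis using c0(1) c1(1) by (simp add: ennreal_leI mult_left_mono mult_ac)
    qed
  qed
qed

text \<open>The weight of level \<open>j\<close> exactly cancels the decay of the norm of its piece.
  Nothing is left for a sum over the levels, but their supremum is bounded.\<close>

lemma indicator_in_besov:
  assumes "1 \<le> p"
  shows "regular_distribution (indicator \<Omega>) \<in> besov_type_space \<phi>\<^sub>0 \<phi> ((2 - koch_dim) / p) (koch_dim / (2 * p)) (ennreal p) \<infinity>"
proof -
  obtain c where c: "0 < c"
    "\<And>i k j. nat i \<le> j \<Longrightarrow> (\<integral>\<^sup>+x\<in>dyadic_cube i k. ennreal (norm (piece j x) powr p) \<partial>lborel)
       \<le> ennreal (c * (1 / 2 ^ j) powr (2 - koch_dim) * min 1 (2 powi (- i)) powr koch_dim)"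
    by (rule piece_Lp_cube[OF assms]) (rule that; assumption)
  let ?\<tau> = "koch_dim / (2 * p)"
  have "ennreal (1 / measure lborel (dyadic_cube i k) powr ?\<tau>) *
      lq_norm_from \<infinity> (nat i) (\<lambda>j. ennreal (2 powr (real j * ((2 - koch_dim) / p))) *
          Lp_norm_on (ennreal p) (dyadic_cube i k) (\<lambda>x. ennreal (norm (piece j x)))) \<le> ennreal (c powr (1 / p))" for i and k :: "int^2"
  proof -
    define l :: real where "l = 2 powi (- i)"
    have l: "0 < l" by (simp add: l_def)
    define w where "w = min 1 l powr koch_dim"
    have "ennreal (2 powr (real j * ((2 - koch_dim) / p))) * Lp_norm_on (ennreal p) (dyadic_cube i k) (\<lambda>x. ennreal (norm (piece j x)))
      \<le> ennreal (c powr (1 / p) * w powr (1 / p))" if "nat i \<le> j" for j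
    proof -
      have "Lp_norm_on (ennreal p) (dyadic_cube i k) (\<lambda>x. ennreal (norm (piece j x)))
        = epowr (\<integral>\<^sup>+x\<in>dyadic_cube i k. ennreal (norm (piece j x) powr p) \<partial>lborel) (1 / p)"
        using assms by (simp add: Lp_norm_on_ennreal epowr_ennreal)
      also have "\<dots> \<le> ennreal ((c * (1 / 2 ^ j) powr (2 - koch_dim) * w) powr (1 / p))"
        using c(2)[OF that, of k] c(1) assms by (intro epowr_le) (auto simp: w_def l_def)
      also have "(c * (1 / 2 ^ j) powr (2 - koch_dim) * w) powr (1 / p)
        = c powr (1 / p) * w powr (1 / p) / 2 powr (real j * ((2 - koch_dim) / p))"
        using c(1) by (simp add: powr_mult powr_powr w_def powr_divide powr_realpow[symmetric])
      finally have "ennreal (2 powr (real j * ((2 - koch_dim) / p))) * Lp_norm_on (ennreal p) (dyadic_cube i k) (\<lambda>x. ennreal (norm (piece j x)))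
        \<le> ennreal (2 powr (real j * ((2 - koch_dim) / p))) * ennreal (c powr (1 / p) * w powr (1 / p) / 2 powr (real j * ((2 - koch_dim) / p)))"
        by (intro mult_left_mono) auto
      also have "\<dots> = ennreal (2 powr (real j * ((2 - koch_dim) / p)) * (c powr (1 / p) * w powr (1 / p) / 2 powr (real j * ((2 - koch_dim) / p))))"
        by (rule ennreal_mult[symmetric]) auto
      finally show ?thesis by simp
    qed
    then have "lq_norm_from \<infinity> (nat i) (\<lambda>j. ennreal (2 powr (real j * ((2 - koch_dim) / p))) *
          Lp_norm_on (ennreal p) (dyadic_cube i k) (\<lambda>x. ennreal (norm (piece j x)))) \<le> ennreal (c powr (1 / p) * w powr (1 / p))"
      by (auto simp: lq_norm_from_def intro!: SUP_least)
    then have "ennreal (1 / measure lborel (dyadic_cube i k) powr ?\<tau>) *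
      lq_norm_from \<infinity> (nat i) (\<lambda>j. ennreal (2 powr (real j * ((2 - koch_dim) / p))) *
          Lp_norm_on (ennreal p) (dyadic_cube i k) (\<lambda>x. ennreal (norm (piece j x))))
       \<le> ennreal (1 / measure lborel (dyadic_cube i k) powr ?\<tau>) * ennreal (c powr (1 / p) * w powr (1 / p))"
      by (rule mult_left_mono) simp
    also have "\<dots> = ennreal (c powr (1 / p) * (1 / (l\<^sup>2) powr ?\<tau> * w powr (1 / p)))"
      unfolding measure_dyadic_cube l_def by (subst ennreal_mult[symmetric]) auto
    also have "\<dots> \<le> ennreal (c powr (1 / p) * 1)"
      unfolding w_def using l assms koch_dim_bounds by (intro ennreal_leI mult_left_mono cube_normalization) auto
    finally show ?thesis by simp
  qed
  then have "besov_type_norm \<phi>\<^sub>0 \<phi> ((2 - koch_dim) / p) ?\<tau> (ennreal p) \<infinity> (regular_distribution (indicator \<Omega>)) \<le> ennreal (c powr (1 / p))"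
    unfolding besov_type_norm_def piece_def[symmetric] by (auto intro!: SUP_least)
  then show ?thesis
    unfolding besov_type_space_def using indicator_tempered[OF bounded_domain domain_measurable]
    by (auto intro: le_less_trans)
qed

lemma indicator_in_triebel_lizorkin:
  assumes p: "1 \<le> p" and q: "1 \<le> q" and \<tau>: "0 \<le> \<tau>" "\<tau> \<le> koch_dim / (2 * p)" and s: "s < (2 - koch_dim) / p"
  shows "regular_distribution (indicator \<Omega>) \<in> triebel_lizorkin_type_space \<phi>\<^sub>0 \<phi> s \<tau> (ennreal p) q"
proof -
  obtain c where c: "0 < c"
    "\<And>i k j. nat i \<le> j \<Longrightarrow> (\<integral>\<^sup>+x\<in>dyadic_cube i k. ennreal (norm (piece j x) powr p) \<partial>lborel)
       \<le> ennreal (c * (1 / 2 ^ j) powr (2 - koch_dim) * min 1 (2 powi (- i)) powr koch_dim)"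
    by (rule piece_Lp_cube[OF p]) (rule that; assumption)
  \<comment> \<open>Half of the margin pays for the passage to a \<open>p\<close>-sum, the other
    half makes \<gamma> less than 1.\<close>
  define \<epsilon> where "\<epsilon> = ((2 - koch_dim) / p - s) / 2"
  have \<epsilon>: "0 < \<epsilon>" using s by (simp add: \<epsilon>_def)
  define \<gamma> :: real where "\<gamma> = 2 powr ((s + \<epsilon>) * p - (2 - koch_dim))"
  have "(s + \<epsilon>) * p < (2 - koch_dim)"
  proof -
    have "s + \<epsilon> < (2 - koch_dim) / p" using s unfolding \<epsilon>_def by argo
    then show ?thesis using p by (simp add: field_simps)
  qed
  then have \<gamma>: "0 < \<gamma>" "\<gamma> < 1" using powr_less_mono[of "(s + \<epsilon>) * p - (2 - koch_dim)" 0 2] by (auto simp: \<gamma>_def)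
  define K where "K = (1 / (1 - 2 powr (- \<epsilon>))) powr p"
  have K: "0 \<le> K" by (simp add: K_def)
  define M where "M = K * (c / (1 - \<gamma>))"
  have M: "0 \<le> M" using K c(1) \<gamma> by (simp add: M_def)
  have "ennreal (1 / measure lborel (dyadic_cube i k) powr \<tau>) *
        Lp_norm_on (ennreal p) (dyadic_cube i k) (\<lambda>x.
          lq_norm_from q (nat i) (\<lambda>j. ennreal (2 powr (real j * s)) * ennreal (norm (piece j x)))) \<le> ennreal (M powr (1 / p))" for i and k :: "int^2"
  proof -
    define l :: real where "l = 2 powi (- i)"
    have l: "0 < l" by (simp add: l_def)
    define w where "w = min 1 l powr koch_dim"
    have w: "0 \<le> w" by (simp add: w_def)
    define J where "J = nat i"
    define h where "h n x = (2 powr (real (J + n) * (s + \<epsilon>)) * norm (piece (J + n) x)) powr p" for n x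
    have [measurable]: "h n \<in> borel_measurable borel" for n unfolding h_def by measurable
    have "(\<integral>\<^sup>+x\<in>dyadic_cube i k. epowr (lq_norm_from q J (\<lambda>j. ennreal (2 powr (real j * s)) * ennreal (norm (piece j x)))) p \<partial>lborel)
      \<le> (\<integral>\<^sup>+x. ennreal K * (\<Sum>n. ennreal (h n x) * indicator (dyadic_cube i k) x) \<partial>lborel)"
    proof (rule nn_integral_mono)
      fix x
      have "epowr (lq_norm_from q J (\<lambda>j. ennreal (2 powr (real j * s)) * ennreal (norm (piece j x)))) p \<le> ennreal K * (\<Sum>n. ennreal (h n x))"
        unfolding K_def h_def by (rule lq_norm_from_weighted_le[OF \<epsilon> p q norm_ge_zero])
      then show "epowr (lq_norm_from q J (\<lambda>j. ennreal (2 powr (real j * s)) * ennreal (norm (piece j x)))) p * indicator (dyadic_cube i k) x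
         \<le> ennreal K * (\<Sum>n. ennreal (h n x) * indicator (dyadic_cube i k) x)"
        by (cases "x \<in> dyadic_cube i k") auto
    qed
    also have "\<dots> = ennreal K * (\<integral>\<^sup>+x. (\<Sum>n. ennreal (h n x) * indicator (dyadic_cube i k) x) \<partial>lborel)"
      by (rule nn_integral_cmult) measurable
    also have "(\<integral>\<^sup>+x. (\<Sum>n. ennreal (h n x) * indicator (dyadic_cube i k) x) \<partial>lborel)
        = (\<Sum>n. \<integral>\<^sup>+x\<in>dyadic_cube i k. ennreal (h n x) \<partial>lborel)"
      by (rule nn_integral_suminf) measurable
    finally have le: "(\<integral>\<^sup>+x\<in>dyadic_cube i k. epowr (lq_norm_from q J (\<lambda>j. ennreal (2 powr (real j * s)) * ennreal (norm (piece j x)))) p \<partial>lborel)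
        \<le> ennreal K * (\<Sum>n. \<integral>\<^sup>+x\<in>dyadic_cube i k. ennreal (h n x) \<partial>lborel)" .
    have "(\<Sum>n. \<integral>\<^sup>+x\<in>dyadic_cube i k. ennreal (h n x) \<partial>lborel) \<le> ennreal (c * w / (1 - \<gamma>))"
    proof (rule suminf_geometric_ennreal_le)
      fix n
      define D where "D = 2 powr (real (J + n) * (s + \<epsilon>) * p)"
      have "(\<integral>\<^sup>+x\<in>dyadic_cube i k. ennreal (h n x) \<partial>lborel)
         = (\<integral>\<^sup>+x. ennreal D * (ennreal (norm (piece (J + n) x) powr p) * indicator (dyadic_cube i k) x) \<partial>lborel)"
      proof (rule nn_integral_cong)
        fix x
        have "h n x = D * norm (piece (J + n) x) powr p"
          unfolding h_def D_def powr_mult powr_powr ..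
        then show "ennreal (h n x) * indicator (dyadic_cube i k) x
            = ennreal D * (ennreal (norm (piece (J + n) x) powr p) * indicator (dyadic_cube i k) x)"
          by (simp add: ennreal_mult D_def mult.assoc)
      qed
      also have "\<dots> = ennreal D * (\<integral>\<^sup>+x\<in>dyadic_cube i k. ennreal (norm (piece (J + n) x) powr p) \<partial>lborel)"
        by (intro nn_integral_cmult) auto
      also have "\<dots> \<le> ennreal D * ennreal (c * (1 / 2 ^ (J + n)) powr (2 - koch_dim) * w)"
        using c(2)[of i "J + n" k] by (intro mult_left_mono) (auto simp: J_def w_def l_def)
      also have "\<dots> = ennreal (D * (c * (1 / 2 ^ (J + n)) powr (2 - koch_dim) * w))"
        using c(1) w by (intro ennreal_mult[symmetric]) (auto simp: D_def)
      also have "D * (c * (1 / 2 ^ (J + n)) powr (2 - koch_dim) * w) = c * w * \<gamma> ^ (J + n)"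
      proof -
        have "\<gamma> ^ (J + n) = 2 powr (real (J + n) * ((s + \<epsilon>) * p - (2 - koch_dim)))"
          using \<gamma>(1) unfolding powr_realpow[symmetric, OF \<gamma>(1)] unfolding \<gamma>_def powr_powr by (simp add: mult.commute)
        also have "\<dots> = D * 2 powr (- (real (J + n) * (2 - koch_dim)))"
          unfolding D_def powr_add[symmetric] by (rule arg_cong[of _ _ "(powr) 2"]) (simp add: algebra_simps)
        also have "2 powr (- (real (J + n) * (2 - koch_dim))) = (1 / 2 ^ (J + n)) powr (2 - koch_dim)"
        proof -
          have "(1 / 2 ^ (J + n)) powr (2 - koch_dim) = 1 / (2 powr real (J + n)) powr (2 - koch_dim)"
            by (simp only: powr_realpow zero_less_numeral powr_divide powr_one_eq_one)
          then show ?thesis unfolding powr_powr powr_minus_divide by simp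
        qed
        finally show ?thesis by simp
      qed
      also have "\<dots> \<le> c * w * \<gamma> ^ n"
        using c(1) w \<gamma> by (intro mult_left_mono power_decreasing) auto
      finally show "(\<integral>\<^sup>+x\<in>dyadic_cube i k. ennreal (h n x) \<partial>lborel) \<le> ennreal (c * w * \<gamma> ^ n)"
        by (simp add: ennreal_leI)
    qed (use c(1) w \<gamma> in auto)
    then have "ennreal K * (\<Sum>n. \<integral>\<^sup>+x\<in>dyadic_cube i k. ennreal (h n x) \<partial>lborel) \<le> ennreal K * ennreal (c * w / (1 - \<gamma>))"
      by (rule mult_left_mono) simp
    also have "\<dots> = ennreal (K * (c * w / (1 - \<gamma>)))"
      using K c(1) w \<gamma> by (intro ennreal_mult[symmetric]) auto
    also have "K * (c * w / (1 - \<gamma>)) = M * w" by (simp add: M_def)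
    finally have "(\<integral>\<^sup>+x\<in>dyadic_cube i k. epowr (lq_norm_from q J (\<lambda>j. ennreal (2 powr (real j * s)) * ennreal (norm (piece j x)))) p \<partial>lborel)
        \<le> ennreal (M * w)" using le by (rule order_trans[rotated])
    then have "Lp_norm_on (ennreal p) (dyadic_cube i k) (\<lambda>x. lq_norm_from q J (\<lambda>j. ennreal (2 powr (real j * s)) * ennreal (norm (piece j x))))
      \<le> ennreal ((M * w) powr (1 / p))"
      using p M w by (subst Lp_norm_on_ennreal) (auto intro!: epowr_le)
    then have "ennreal (1 / measure lborel (dyadic_cube i k) powr \<tau>) *
        Lp_norm_on (ennreal p) (dyadic_cube i k) (\<lambda>x. lq_norm_from q J (\<lambda>j. ennreal (2 powr (real j * s)) * ennreal (norm (piece j x))))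
       \<le> ennreal (1 / measure lborel (dyadic_cube i k) powr \<tau>) * ennreal ((M * w) powr (1 / p))"
      by (rule mult_left_mono) simp
    also have "\<dots> = ennreal (M powr (1 / p) * (1 / (l\<^sup>2) powr \<tau> * w powr (1 / p)))"
      unfolding measure_dyadic_cube l_def using M w by (subst ennreal_mult[symmetric]) (auto simp: powr_mult)
    also have "\<dots> \<le> ennreal (M powr (1 / p) * 1)"
      unfolding w_def using l p \<tau> by (intro ennreal_leI mult_left_mono cube_normalization) auto
    finally show ?thesis by (simp add: J_def)
  qed
  then have "triebel_lizorkin_type_norm \<phi>\<^sub>0 \<phi> s \<tau> (ennreal p) q (regular_distribution (indicator \<Omega>)) \<le> ennreal (M powr (1 / p))"
    unfolding triebel_lizorkin_type_norm_def piece_def[symmetric] by (auto intro!: SUP_least)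
  then show ?thesis
    unfolding triebel_lizorkin_type_space_def using indicator_tempered[OF bounded_domain domain_measurable]
    by (auto intro: le_less_trans)
qed

end

section \<open>Gaussian means of the Fourier transform\<close>

lemma cis_measurable [measurable]: "cis \<in> borel_measurable borel"
  by (intro borel_measurable_continuous_onI continuous_intros continuous_on_cis)

lemma cnj_measurable [measurable]: "cnj \<in> borel_measurable borel"
  by (intro borel_measurable_continuous_onI continuous_intros)

text \<open>Read off from the characteristic function of the standard normal distribution.\<close>

lemma gauss_1d:
  shows "integrable lborel (\<lambda>x. cis (t * x) * complex_of_real (exp (- x\<^sup>2 / 2)))"
    and "(LINT x|lborel. cis (t * x) * complex_of_real (exp (- x\<^sup>2 / 2))) = complex_of_real (sqrt (2 * pi) * exp (- t\<^sup>2 / 2))"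
proof -
  have "integrable lborel (\<lambda>x. sqrt (2 * pi) * (std_normal_density x * x ^ 0))"
    by (intro integrable_mult_right integrable_std_normal_moment)
  then have "integrable lborel (\<lambda>x :: real. exp (- x\<^sup>2 / 2) :: real)"
    by (simp add: std_normal_density_def)
  then show "integrable lborel (\<lambda>x. cis (t * x) * complex_of_real (exp (- x\<^sup>2 / 2)))"
    by (rule Bochner_Integration.integrable_bound) (auto simp: norm_mult)
  have "char std_normal_distribution t = (LINT x|lborel. std_normal_density x *\<^sub>R iexp (t * x))"
    unfolding char_def by (subst integral_density) auto
  also have "\<dots> = (LINT x|lborel. complex_of_real (1 / sqrt (2 * pi)) * (cis (t * x) * complex_of_real (exp (- x\<^sup>2 / 2))))"
    by (intro Bochner_Integration.integral_cong) (simp_all add: std_normal_density_def cis_conv_exp scaleR_conv_of_real)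
  also have "\<dots> = complex_of_real (1 / sqrt (2 * pi)) * (LINT x|lborel. cis (t * x) * complex_of_real (exp (- x\<^sup>2 / 2)))"
    by simp
  finally have "complex_of_real (1 / sqrt (2 * pi)) * (LINT x|lborel. cis (t * x) * complex_of_real (exp (- x\<^sup>2 / 2))) = complex_of_real (exp (- t\<^sup>2 / 2))"
    by (simp only: char_std_normal_distribution)
  then show "(LINT x|lborel. cis (t * x) * complex_of_real (exp (- x\<^sup>2 / 2))) = complex_of_real (sqrt (2 * pi) * exp (- t\<^sup>2 / 2))"
    by (simp add: field_simps)
qed

lemma integral_lborel_prod:
  fixes g :: "'a::euclidean_space \<Rightarrow> real \<Rightarrow> 'b::{real_normed_field, banach, second_countable_topology}"
  assumes "\<And>b. b \<in> Basis \<Longrightarrow> integrable lborel (g b)"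
  shows "integrable lborel (\<lambda>y. \<Prod>b\<in>Basis. g b (y \<bullet> b))"
    and "(LINT y|lborel. (\<Prod>b\<in>Basis. g b (y \<bullet> b))) = (\<Prod>b\<in>Basis. (LINT x|lborel. g b x))"
proof -
  interpret product_sigma_finite "\<lambda>b :: 'a. lborel :: real measure" ..
  have [measurable]: "g b \<in> borel_measurable borel" if "b \<in> Basis" for b
    using borel_measurable_integrable[OF assms[OF that]] by simp
  have m: "(\<lambda>y :: 'a. \<Prod>b\<in>Basis. g b (y \<bullet> b)) \<in> borel_measurable borel"
    by (intro borel_measurable_prod) measurable
  have d: "(\<lambda>f. \<Sum>b\<in>Basis. f b *\<^sub>R b :: 'a) \<in> measurable (Pi\<^sub>M Basis (\<lambda>b. lborel)) borel"
    by measurable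
  have "integrable (Pi\<^sub>M Basis (\<lambda>b :: 'a. lborel)) (\<lambda>f. \<Prod>b\<in>Basis. g b (f b))"
    using assms by (intro product_integrable_prod) auto
  then have "integrable (distr (Pi\<^sub>M Basis (\<lambda>b. lborel)) borel (\<lambda>f. \<Sum>b\<in>Basis. f b *\<^sub>R b)) (\<lambda>y :: 'a. \<Prod>b\<in>Basis. g b (y \<bullet> b))"
    by (subst integrable_distr_eq[OF d m]) (simp cong: prod.cong)
  then show "integrable lborel (\<lambda>y :: 'a. \<Prod>b\<in>Basis. g b (y \<bullet> b))"
    by (simp only: lborel_eq[symmetric])
  have "(LINT y|distr (Pi\<^sub>M Basis (\<lambda>b. lborel)) borel (\<lambda>f. \<Sum>b\<in>Basis. f b *\<^sub>R b). (\<Prod>b\<in>Basis. g b (y \<bullet> b)))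
      = (LINT f|Pi\<^sub>M Basis (\<lambda>b :: 'a. lborel). (\<Prod>b\<in>Basis. g b (f b)))"
    by (subst integral_distr[OF d m]) (simp cong: prod.cong)
  also have "\<dots> = (\<Prod>b\<in>Basis. (LINT x|lborel. g b x))"
    using assms by (intro product_integral_prod) auto
  finally show "(LINT y|lborel. (\<Prod>b\<in>Basis. g b (y \<bullet> b))) = (\<Prod>b\<in>Basis. (LINT x|lborel. g b x))"
    by (simp only: lborel_eq[symmetric])
qed

lemma gauss_plane:
  fixes z :: "real^2"
  shows "integrable lborel (\<lambda>y. cis (z \<bullet> y) * complex_of_real (exp (- (norm y)\<^sup>2 / 2)))"
    and "(LINT y|lborel. cis (z \<bullet> y) * complex_of_real (exp (- (norm y)\<^sup>2 / 2))) = complex_of_real (2 * pi * exp (- (norm z)\<^sup>2 / 2))"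
proof -
  have n: "(norm y)\<^sup>2 = (\<Sum>b\<in>Basis. (y \<bullet> b)\<^sup>2)" for y :: "real^2"
    unfolding power2_norm_eq_inner by (subst euclidean_inner) (simp add: power2_eq_square)
  have eq: "cis (z \<bullet> y) * complex_of_real (exp (- (norm y)\<^sup>2 / 2))
      = (\<Prod>b\<in>Basis. cis ((z \<bullet> b) * (y \<bullet> b)) * complex_of_real (exp (- (y \<bullet> b)\<^sup>2 / 2)))" for y :: "real^2"
  proof -
    have "cis (z \<bullet> y) = (\<Prod>b\<in>Basis. cis ((z \<bullet> b) * (y \<bullet> b)))"
      unfolding euclidean_inner[of z y] cis_conv_exp by (simp add: sum_distrib_left exp_sum)
    moreover have "exp (- (norm y)\<^sup>2 / 2) = (\<Prod>b\<in>Basis. exp (- (y \<bullet> b)\<^sup>2 / 2))"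
      unfolding n by (simp add: exp_sum[symmetric] sum_negf sum_divide_distrib)
    ultimately show ?thesis by (simp add: prod.distrib)
  qed
  show "integrable lborel (\<lambda>y. cis (z \<bullet> y) * complex_of_real (exp (- (norm y)\<^sup>2 / 2)))"
    unfolding eq by (rule integral_lborel_prod(1)[OF gauss_1d(1)])
  have "(LINT y|lborel. cis (z \<bullet> y) * complex_of_real (exp (- (norm y)\<^sup>2 / 2)))
      = (\<Prod>b\<in>(Basis :: (real^2) set). complex_of_real (sqrt (2 * pi) * exp (- (z \<bullet> b)\<^sup>2 / 2)))"
    unfolding eq by (subst integral_lborel_prod(2)[OF gauss_1d(1)]) (simp only: gauss_1d(2))
  also have "\<dots> = complex_of_real (\<Prod>b\<in>(Basis :: (real^2) set). sqrt (2 * pi) * exp (- (z \<bullet> b)\<^sup>2 / 2))"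
    by (simp only: of_real_prod)
  also have "(\<Prod>b\<in>(Basis :: (real^2) set). sqrt (2 * pi) * exp (- (z \<bullet> b)\<^sup>2 / 2)) = 2 * pi * exp (- (norm z)\<^sup>2 / 2)"
    unfolding n prod.distrib by (simp add: exp_sum[symmetric] sum_negf sum_divide_distrib)
  finally show "(LINT y|lborel. cis (z \<bullet> y) * complex_of_real (exp (- (norm y)\<^sup>2 / 2))) = complex_of_real (2 * pi * exp (- (norm z)\<^sup>2 / 2))" .
qed

text \<open>The density of the centred normal distribution in the plane with standard deviation
  \<open>e\<close> in each coordinate; equivalently the heat kernel at time
  \<open>e\<^sup>2 / 2\<close>.\<close>

definition gauss :: "real \<Rightarrow> real^2 \<Rightarrow> real" where
  "gauss e z = exp (- (norm z / e)\<^sup>2 / 2) / (2 * pi * e\<^sup>2)"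

lemma gauss_measurable [measurable]: "gauss e \<in> borel_measurable borel"
  unfolding gauss_def by measurable

lemma gauss_nonneg [simp]: "0 \<le> gauss e z" by (simp add: gauss_def)

lemma gauss_minus [simp]: "gauss e (- z) = gauss e z" by (simp add: gauss_def)

lemma gauss_fourier:
  fixes z :: "real^2"
  assumes "0 < e"
  shows "integrable lborel (\<lambda>y. cis (z \<bullet> y) * complex_of_real (exp (- (e * norm y)\<^sup>2 / 2)))"
    and "(LINT y|lborel. cis (z \<bullet> y) * complex_of_real (exp (- (e * norm y)\<^sup>2 / 2))) = complex_of_real ((2 * pi)\<^sup>2 * gauss e z)"
proof -
  let ?F = "\<lambda>y. cis (z \<bullet> y) * complex_of_real (exp (- (e * norm y)\<^sup>2 / 2))"
  have [measurable]: "?F \<in> borel_measurable borel"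
    by measurable
  have F: "?F (0 + (1 / e) *\<^sub>R y) = cis (((1 / e) *\<^sub>R z) \<bullet> y) * complex_of_real (exp (- (norm y)\<^sup>2 / 2))" for y
    using assms by simp
  have "integrable lborel (\<lambda>y. ?F (0 + (1 / e) *\<^sub>R y))"
    unfolding F by (rule gauss_plane)
  then have "integrable (density (distr lborel borel (\<lambda>x. 0 + (1 / e) *\<^sub>R x)) (\<lambda>_. \<bar>1 / e\<bar> ^ DIM(real^2))) ?F"
    by (subst integrable_density) (auto simp: integrable_distr_eq)
  then show "integrable lborel ?F"
    using assms lborel_affine[of "1 / e" "0 :: real^2"] by simp
  have "(LINT y|lborel. ?F y) = (\<bar>1 / e\<bar> ^ DIM(real^2)) *\<^sub>R (LINT y|lborel. ?F (0 + (1 / e) *\<^sub>R y))"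
    using assms by (intro integral_lborel_affine) auto
  also have "\<dots> = complex_of_real ((2 * pi)\<^sup>2 * gauss e z)"
  proof -
    have nz: "norm ((1 / e) *\<^sub>R z) = norm z / e" using assms by simp
    show ?thesis
      unfolding F gauss_plane(2) nz gauss_def scaleR_conv_of_real[where 'a = complex]
      using assms by (simp add: power2_eq_square field_simps)
  qed
  finally show "(LINT y|lborel. ?F y) = complex_of_real ((2 * pi)\<^sup>2 * gauss e z)" .
qed

lemma gauss_exp_integrable:
  assumes "0 < e"
  shows "integrable lborel (\<lambda>y :: real^2. exp (- (e * norm y)\<^sup>2 / 2))"
  using integrable_norm[OF gauss_fourier(1)[OF assms, of 0]] by simp

lemma gauss_integral:
  assumes "0 < e"
  shows "integrable lborel (gauss e)" and "(LINT z|lborel. gauss e z) = 1"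
proof -
  have eq: "gauss e z = exp (- ((1 / e) * norm z)\<^sup>2 / 2) * (1 / (2 * pi * e\<^sup>2))" for z by (simp add: gauss_def)
  show "integrable lborel (gauss e)"
    unfolding eq[abs_def] using gauss_exp_integrable[of "1 / e"] assms by (intro integrable_mult_left) auto
  have "complex_of_real (LINT y|lborel. exp (- ((1 / e) * norm (y :: real^2))\<^sup>2 / 2)) = complex_of_real ((2 * pi)\<^sup>2 * gauss (1 / e) 0)"
    using gauss_fourier(2)[of "1 / e" 0] assms unfolding integral_complex_of_real[symmetric] by simp
  then have "(LINT y|lborel. exp (- ((1 / e) * norm (y :: real^2))\<^sup>2 / 2)) = (2 * pi)\<^sup>2 * gauss (1 / e) 0"
    by (simp only: of_real_eq_iff)
  then have "(LINT y|lborel. exp (- ((1 / e) * norm (y :: real^2))\<^sup>2 / 2) * (1 / (2 * pi * e\<^sup>2))) = (2 * pi)\<^sup>2 * gauss (1 / e) 0 * (1 / (2 * pi * e\<^sup>2))"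
    by simp
  also have "\<dots> = 1" using assms by (simp add: gauss_def power2_eq_square field_simps)
  finally show "(LINT z|lborel. gauss e z) = 1"
    unfolding eq .
qed

section \<open>Fourier energies with a Gaussian weight\<close>

definition ft :: "(real^2 \<Rightarrow> complex) \<Rightarrow> real^2 \<Rightarrow> complex" where
  "ft u \<xi> = (LINT x|lborel. cis (- (x \<bullet> \<xi>)) * u x)"

lemma fourier_eq_ft: "fourier u \<xi> = complex_of_real (1 / (2 * pi)) * ft u \<xi>"
  by (simp add: fourier_def ft_def powr_minus_divide)

lemma ft_integrand:
  assumes "integrable lborel u"
  shows "integrable lborel (\<lambda>x. cis (- (x \<bullet> \<xi>)) * u x)"
  using borel_measurable_integrable[OF assms] 
  by (intro Bochner_Integration.integrable_bound[OF assms]) (auto simp: norm_mult)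

lemma ft_measurable [measurable]:
  assumes [measurable]: "u \<in> borel_measurable borel"
  shows "ft u \<in> borel_measurable borel"
proof -
  have "(\<lambda>\<xi>. LINT x|lborel. cis (- (x \<bullet> \<xi>)) * u x) \<in> borel_measurable borel"
    by measurable
  then show ?thesis unfolding ft_def[abs_def] .
qed

lemma norm_ft_le:
  assumes "integrable lborel u"
  shows "norm (ft u \<xi>) \<le> (LINT x|lborel. norm (u x))"
  unfolding ft_def using integral_norm_bound[of lborel "\<lambda>x. cis (- (x \<bullet> \<xi>)) * u x"] by (simp add: norm_mult)

lemma (in pair_sigma_finite) integral_product:
  fixes f :: "'a \<Rightarrow> 'c::{real_normed_field, banach, second_countable_topology}" and g :: "'b \<Rightarrow> 'c"
  assumes f: "integrable M1 f" and g: "integrable M2 g"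
  shows "integrable (M1 \<Otimes>\<^sub>M M2) (\<lambda>p. f (fst p) * g (snd p))"
    and "(LINT p|(M1 \<Otimes>\<^sub>M M2). f (fst p) * g (snd p)) = (LINT x|M1. f x) * (LINT y|M2. g y)"
proof -
  have [measurable]: "f \<in> borel_measurable M1" "g \<in> borel_measurable M2" using f g by auto
  show i: "integrable (M1 \<Otimes>\<^sub>M M2) (\<lambda>p. f (fst p) * g (snd p))"
  proof (rule Fubini_integrable)
    show "integrable M1 (\<lambda>x. \<integral>y. norm (f (fst (x, y)) * g (snd (x, y))) \<partial>M2)"
      using f by (simp add: norm_mult)
    show "AE x in M1. integrable M2 (\<lambda>y. f (fst (x, y)) * g (snd (x, y)))"
      using g by simp
  qed measurable
  show "(LINT p|(M1 \<Otimes>\<^sub>M M2). f (fst p) * g (snd p)) = (LINT x|M1. f x) * (LINT y|M2. g y)"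
    using integral_fst'[OF i] by simp
qed

text \<open>Writing the squared modulus as a double integral and integrating in \<open>\<xi>\<close> first.\<close>

lemma ft_energy:
  assumes u: "integrable lborel u" and e: "0 < e"
  shows "integrable lborel (\<lambda>\<xi>. (norm (ft u \<xi>))\<^sup>2 * exp (- (e * norm \<xi>)\<^sup>2 / 2))"
    and "integrable (lborel \<Otimes>\<^sub>M lborel) (\<lambda>p. u (fst p) * cnj (u (snd p)) * complex_of_real (gauss e (fst p - snd p)))"
    and "complex_of_real (LINT \<xi>|lborel. (norm (ft u \<xi>))\<^sup>2 * exp (- (e * norm \<xi>)\<^sup>2 / 2))
      = complex_of_real ((2 * pi)\<^sup>2) * (LINT p|(lborel \<Otimes>\<^sub>M lborel). u (fst p) * cnj (u (snd p)) * complex_of_real (gauss e (fst p - snd p)))"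
proof -
  let ?G = "\<lambda>\<xi> :: real^2. exp (- (e * norm \<xi>)\<^sup>2 / 2)"
  let ?P = "lborel \<Otimes>\<^sub>M lborel :: ((real^2) \<times> (real^2)) measure"
  have [measurable]: "u \<in> borel_measurable borel" using borel_measurable_integrable[OF u] by simp
  have cu: "integrable lborel (\<lambda>y. cnj (u y))" using u by simp
  have uu: "integrable ?P (\<lambda>p. u (fst p) * cnj (u (snd p)))"
    by (rule lborel_pair.integral_product(1)[OF u cu])
  show "integrable lborel (\<lambda>\<xi>. (norm (ft u \<xi>))\<^sup>2 * ?G \<xi>)"
  proof (rule Bochner_Integration.integrable_bound)
    show "integrable lborel (\<lambda>\<xi>. (LINT x|lborel. norm (u x))\<^sup>2 * ?G \<xi>)"
      by (intro integrable_mult_right gauss_exp_integrable e)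
    show "AE \<xi> in lborel. norm ((norm (ft u \<xi>))\<^sup>2 * ?G \<xi>) \<le> norm ((LINT x|lborel. norm (u x))\<^sup>2 * ?G \<xi>)"
      using norm_ft_le[OF u] by (auto simp: abs_mult intro!: mult_right_mono power_mono)
  qed measurable
  have gb: "gauss e z \<le> 1 / (2 * pi * e\<^sup>2)" for z
    unfolding gauss_def by (intro divide_right_mono) auto
  show "integrable ?P (\<lambda>p. u (fst p) * cnj (u (snd p)) * complex_of_real (gauss e (fst p - snd p)))"
  proof (rule Bochner_Integration.integrable_bound)
    show "integrable ?P (\<lambda>p. u (fst p) * cnj (u (snd p)) * complex_of_real (1 / (2 * pi * e\<^sup>2)))"
      using uu by (rule integrable_mult_left)
    show "AE p in ?P. norm (u (fst p) * cnj (u (snd p)) * complex_of_real (gauss e (fst p - snd p)))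
        \<le> norm (u (fst p) * cnj (u (snd p)) * complex_of_real (1 / (2 * pi * e\<^sup>2)))"
      by (intro AE_I2) (simp only: norm_mult norm_of_real, intro mult_left_mono, use gb in \<open>auto simp: abs_of_nonneg\<close>)
  qed measurable
  interpret P: sigma_finite_measure ?P by (rule lborel_pair.sigma_finite_measure_axioms)
  interpret Q: pair_sigma_finite "lborel :: (real^2) measure" ?P ..
  let ?W = "\<lambda>\<xi> p. cis (- ((fst p - snd p) \<bullet> \<xi>)) * complex_of_real (?G \<xi>) * (u (fst p) * cnj (u (snd p)))"
  \<comment> \<open>The modulus of the integrand is a Gaussian in the frequency times an integrable
    function of the pair, which justifies Fubini below.\<close>
  have W: "integrable (lborel \<Otimes>\<^sub>M ?P) (\<lambda>(\<xi>, p). ?W \<xi> p)"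
  proof (rule Bochner_Integration.integrable_bound)
    have "integrable lborel (\<lambda>\<xi>. complex_of_real (?G \<xi>))"
      using gauss_exp_integrable[OF e] by simp
    from Q.integral_product(1)[OF this uu]
    show "integrable (lborel \<Otimes>\<^sub>M ?P) (\<lambda>q. complex_of_real (?G (fst q)) * (u (fst (snd q)) * cnj (u (snd (snd q)))))" .
    show "AE q in lborel \<Otimes>\<^sub>M ?P. norm (case q of (\<xi>, p) \<Rightarrow> ?W \<xi> p)
        \<le> norm (complex_of_real (?G (fst q)) * (u (fst (snd q)) * cnj (u (snd (snd q)))))"
      by (intro AE_I2) (simp add: case_prod_beta norm_mult)
  qed measurable
  have 1: "(LINT p|?P. ?W \<xi> p) = complex_of_real ((norm (ft u \<xi>))\<^sup>2 * ?G \<xi>)" for \<xi>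
  proof -
    have "(LINT p|?P. ?W \<xi> p) = (LINT p|?P. complex_of_real (?G \<xi>) * ((cis (- (fst p \<bullet> \<xi>)) * u (fst p)) * cnj (cis (- (snd p \<bullet> \<xi>)) * u (snd p))))"
    proof (rule Bochner_Integration.integral_cong)
      fix p :: "(real^2) \<times> (real^2)"
      have "cis (- ((fst p - snd p) \<bullet> \<xi>)) = cis (- (fst p \<bullet> \<xi>)) * cnj (cis (- (snd p \<bullet> \<xi>)))"
        unfolding cis_cnj[symmetric] by (simp add: cis_mult inner_diff_left cis_cnj)
      then show "?W \<xi> p = complex_of_real (?G \<xi>) * ((cis (- (fst p \<bullet> \<xi>)) * u (fst p)) * cnj (cis (- (snd p \<bullet> \<xi>)) * u (snd p)))"
        by (simp add: mult_ac)
    qed simp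
    also have "\<dots> = complex_of_real (?G \<xi>) * (ft u \<xi> * cnj (ft u \<xi>))"
    proof -
      have "integrable lborel (\<lambda>y. cnj (cis (- (y \<bullet> \<xi>)) * u y))"
        using ft_integrand[OF u] by (simp only: complex_integrable_cnj)
      note lborel_pair.integral_product(2)[OF ft_integrand[OF u, of \<xi>] this]
      then show ?thesis by (simp only: integral_mult_right_zero ft_def Bochner_Integration.integral_cnj)
    qed
    also have "ft u \<xi> * cnj (ft u \<xi>) = complex_of_real ((norm (ft u \<xi>))\<^sup>2)"
      by (rule complex_norm_square[symmetric])
    finally show ?thesis by (simp add: mult.commute)
  qed
  have 2: "(LINT \<xi>|lborel. ?W \<xi> p) = complex_of_real ((2 * pi)\<^sup>2) * (u (fst p) * cnj (u (snd p)) * complex_of_real (gauss e (fst p - snd p)))" for p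
  proof -
    have "(LINT \<xi>|lborel. ?W \<xi> p) = (LINT \<xi>|lborel. cis ((- (fst p - snd p)) \<bullet> \<xi>) * complex_of_real (?G \<xi>)) * (u (fst p) * cnj (u (snd p)))"
      by (simp only: inner_minus_left integral_mult_left_zero)
    then show ?thesis unfolding gauss_fourier(2)[OF e] gauss_minus by (simp add: mult_ac)
  qed
  have "complex_of_real (LINT \<xi>|lborel. (norm (ft u \<xi>))\<^sup>2 * ?G \<xi>) = (LINT \<xi>|lborel. complex_of_real ((norm (ft u \<xi>))\<^sup>2 * ?G \<xi>))"
    by (rule integral_complex_of_real[symmetric])
  also have "\<dots> = (LINT \<xi>|lborel. LINT p|?P. ?W \<xi> p)" unfolding 1 ..
  also have "\<dots> = (LINT p|?P. LINT \<xi>|lborel. ?W \<xi> p)"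
    by (rule Q.Fubini_integral[OF W, symmetric])
  also have "\<dots> = complex_of_real ((2 * pi)\<^sup>2) * (LINT p|?P. u (fst p) * cnj (u (snd p)) * complex_of_real (gauss e (fst p - snd p)))"
    unfolding 2 by (rule integral_mult_right_zero)
  finally show "complex_of_real (LINT \<xi>|lborel. (norm (ft u \<xi>))\<^sup>2 * ?G \<xi>)
      = complex_of_real ((2 * pi)\<^sup>2) * (LINT p|?P. u (fst p) * cnj (u (snd p)) * complex_of_real (gauss e (fst p - snd p)))" .
qed

lemma gauss_nn_integral:
  assumes "0 < e"
  shows "(\<integral>\<^sup>+y. ennreal (gauss e (x - y)) \<partial>lborel) = 1"
proof -
  have "(\<integral>\<^sup>+y. ennreal (gauss e (x - y)) \<partial>lborel) = (\<integral>\<^sup>+y. ennreal (gauss e y) \<partial>lborel)"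
    by (rule nn_integral_lborel_reflect) measurable
  also have "\<dots> = 1" using gauss_integral[OF assms] by (subst nn_integral_eq_integral) auto
  finally show ?thesis .
qed

text \<open>Takes the place of Plancherel: in the double integral the product of two values of
  \<open>u\<close> is at most the mean of their squares, and since the Gaussian has mass one each
  square integrates to the squared norm. The right-hand side may be infinite.\<close>

lemma ft_energy_le:
  assumes u: "integrable lborel u" and e: "0 < e"
  shows "(\<integral>\<^sup>+\<xi>. ennreal ((norm (ft u \<xi>))\<^sup>2 * exp (- (e * norm \<xi>)\<^sup>2 / 2)) \<partial>lborel)
    \<le> ennreal ((2 * pi)\<^sup>2) * (\<integral>\<^sup>+x. ennreal ((norm (u x))\<^sup>2) \<partial>lborel)"
proof -
  have [measurable]: "u \<in> borel_measurable borel" using borel_measurable_integrable[OF u] by simp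
  let ?P = "lborel \<Otimes>\<^sub>M lborel :: ((real^2) \<times> (real^2)) measure"
  let ?I = "LINT p|?P. u (fst p) * cnj (u (snd p)) * complex_of_real (gauss e (fst p - snd p))"
  let ?N = "\<integral>\<^sup>+x. ennreal ((norm (u x))\<^sup>2) \<partial>lborel"
  have r: "ennreal (1/2) * (ennreal a * ennreal g) + ennreal (1/2) * (ennreal b * ennreal g) = ennreal ((1/2 * a + 1/2 * b) * g)"
    if "0 \<le> a" "0 \<le> b" "0 \<le> g" for a b g :: real
  proof -
    have h: "(0::real) \<le> 1/2" by simp
    have "ennreal (1/2 * (a * g)) + ennreal (1/2 * (b * g)) = ennreal (1/2 * (a * g) + 1/2 * (b * g))"
      by (rule ennreal_plus[symmetric]) (use that in auto)
    then show ?thesis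
      unfolding ennreal_mult3[OF h that(1,3)] ennreal_mult3[OF h that(2,3)] by (simp only: distrib_right mult.assoc)
  qed
  define R where "R = (LINT \<xi>|lborel. (norm (ft u \<xi>))\<^sup>2 * exp (- (e * norm \<xi>)\<^sup>2 / 2))"
  have R: "0 \<le> R" unfolding R_def by (intro Bochner_Integration.integral_nonneg) auto
  have "R = norm (complex_of_real R)" using R by simp
  also have "\<dots> = (2 * pi)\<^sup>2 * norm ?I"
    unfolding R_def ft_energy(3)[OF u e] by (simp add: norm_mult norm_power)
  finally have "ennreal R = ennreal ((2 * pi)\<^sup>2) * ennreal (norm ?I)" by (simp add: ennreal_mult)
  also have "ennreal (norm ?I) \<le> ?N"
  proof -
    have m1: "(\<lambda>p. ennreal ((norm (u (fst p)))\<^sup>2) * ennreal (gauss e (fst p - snd p))) \<in> borel_measurable ?P"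
      and m2: "(\<lambda>p. ennreal ((norm (u (snd p)))\<^sup>2) * ennreal (gauss e (fst p - snd p))) \<in> borel_measurable ?P"
      by measurable
    have "ennreal (norm ?I) \<le> (\<integral>\<^sup>+p. ennreal (norm (u (fst p) * cnj (u (snd p)) * complex_of_real (gauss e (fst p - snd p)))) \<partial>?P)"
      by (rule integral_norm_bound_ennreal[OF ft_energy(2)[OF u e]])
    also have "\<dots> \<le> (\<integral>\<^sup>+p. ennreal (1/2) * (ennreal ((norm (u (fst p)))\<^sup>2) * ennreal (gauss e (fst p - snd p)))
        + ennreal (1/2) * (ennreal ((norm (u (snd p)))\<^sup>2) * ennreal (gauss e (fst p - snd p))) \<partial>?P)"
    proof (rule nn_integral_mono)
      fix p :: "(real^2) \<times> (real^2)"
      have "2 * (norm (u (fst p)) * norm (u (snd p))) \<le> (norm (u (fst p)))\<^sup>2 + (norm (u (snd p)))\<^sup>2"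
        using sum_squares_bound[of "norm (u (fst p))" "norm (u (snd p))"] by (simp add: mult.assoc)
      then have "norm (u (fst p)) * norm (u (snd p)) \<le> 1/2 * (norm (u (fst p)))\<^sup>2 + 1/2 * (norm (u (snd p)))\<^sup>2" by argo
      then have "norm (u (fst p)) * norm (u (snd p)) * gauss e (fst p - snd p)
        \<le> (1/2 * (norm (u (fst p)))\<^sup>2 + 1/2 * (norm (u (snd p)))\<^sup>2) * gauss e (fst p - snd p)"
        by (rule mult_right_mono) simp
      then show "ennreal (norm (u (fst p) * cnj (u (snd p)) * complex_of_real (gauss e (fst p - snd p))))
        \<le> ennreal (1/2) * (ennreal ((norm (u (fst p)))\<^sup>2) * ennreal (gauss e (fst p - snd p)))
        + ennreal (1/2) * (ennreal ((norm (u (snd p)))\<^sup>2) * ennreal (gauss e (fst p - snd p)))"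
        unfolding r[OF zero_le_power2 zero_le_power2 gauss_nonneg]
        by (simp only: norm_mult complex_mod_cnj norm_of_real abs_of_nonneg[OF gauss_nonneg] ennreal_leI)
    qed
    also have "\<dots> = ennreal (1/2) * (\<integral>\<^sup>+p. ennreal ((norm (u (fst p)))\<^sup>2) * ennreal (gauss e (fst p - snd p)) \<partial>?P)
        + ennreal (1/2) * (\<integral>\<^sup>+p. ennreal ((norm (u (snd p)))\<^sup>2) * ennreal (gauss e (fst p - snd p)) \<partial>?P)"
      using m1 m2 by (simp only: nn_integral_add nn_integral_cmult borel_measurable_times_ennreal borel_measurable_const)
    also have "(\<integral>\<^sup>+p. ennreal ((norm (u (fst p)))\<^sup>2) * ennreal (gauss e (fst p - snd p)) \<partial>?P)
        = (\<integral>\<^sup>+x. \<integral>\<^sup>+y. ennreal ((norm (u x))\<^sup>2) * ennreal (gauss e (x - y)) \<partial>lborel \<partial>lborel)"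
      by (subst lborel.nn_integral_fst[OF m1, symmetric]) simp
    also have "\<dots> = ?N"
      by (intro nn_integral_cong) (simp add: nn_integral_cmult gauss_nn_integral[OF e])
    also have "(\<integral>\<^sup>+p. ennreal ((norm (u (snd p)))\<^sup>2) * ennreal (gauss e (fst p - snd p)) \<partial>?P)
        = (\<integral>\<^sup>+y. \<integral>\<^sup>+x. ennreal ((norm (u y))\<^sup>2) * ennreal (gauss e (x - y)) \<partial>lborel \<partial>lborel)"
      by (subst lborel_pair.nn_integral_snd[symmetric]) (use m2 in simp_all)
    also have "\<dots> = ?N"
    proof (rule nn_integral_cong)
      fix y
      have "gauss e (x - y) = gauss e (y - x)" for x by (metis gauss_minus minus_diff_eq)
      then have "(\<integral>\<^sup>+x. ennreal ((norm (u y))\<^sup>2) * ennreal (gauss e (x - y)) \<partial>lborel)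
          = (\<integral>\<^sup>+x. ennreal ((norm (u y))\<^sup>2) * ennreal (gauss e (y - x)) \<partial>lborel)" by simp
      also have "\<dots> = ennreal ((norm (u y))\<^sup>2) * (\<integral>\<^sup>+x. ennreal (gauss e (y - x)) \<partial>lborel)"
        by (rule nn_integral_cmult) measurable
      finally show "(\<integral>\<^sup>+x. ennreal ((norm (u y))\<^sup>2) * ennreal (gauss e (x - y)) \<partial>lborel) = ennreal ((norm (u y))\<^sup>2)"
        by (simp add: gauss_nn_integral[OF e])
    qed
    also have "ennreal (1/2) * ?N + ennreal (1/2) * ?N = ?N"
    proof -
      have "ennreal (1/2 + 1/2) = ennreal (1/2) + ennreal (1/2)" by (rule ennreal_plus) auto
      then have "ennreal (1/2) + ennreal (1/2) = 1" by (metis field_sum_of_halves ennreal_1)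
      then show ?thesis unfolding distrib_right[symmetric] by simp
    qed
    finally show ?thesis .
  qed
  finally have "ennreal R \<le> ennreal ((2 * pi)\<^sup>2) * ?N" by (simp add: mult_left_mono)
  moreover have "(\<integral>\<^sup>+\<xi>. ennreal ((norm (ft u \<xi>))\<^sup>2 * exp (- (e * norm \<xi>)\<^sup>2 / 2)) \<partial>lborel) = ennreal R"
    unfolding R_def by (intro nn_integral_eq_integral ft_energy(1)[OF u e]) auto
  ultimately show ?thesis by simp
qed

section \<open>The energy gap of the domain\<close>

context snowflake_convolution
begin

section \<open>Transforms of the kernels and of the pieces\<close>

lemma kernel_schwartz: "kernel j \<in> schwartz"
  using schwartz_reflect_scale[OF kernel_reflect_schwartz[of j 0], of 1 0] by simp

lemma kernel_shift_integrable: "integrable lborel (\<lambda>x. kernel j (x - y))"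
  using schwartz_integrable[OF schwartz_reflect_scale[OF kernel_schwartz[of j], of "-1" "- y"]] by simp

lemma ft_kernel_shift: "(LINT x|lborel. cis (- (x \<bullet> \<xi>)) * kernel j (x - y)) = cis (- (y \<bullet> \<xi>)) * ft (kernel j) \<xi>"
proof -
  have "(LINT x|lborel. cis (- (x \<bullet> \<xi>)) * kernel j (x - y)) = (LINT x|lborel. cis (- ((y + x) \<bullet> \<xi>)) * kernel j x)"
    by (subst integral_lborel_affine[of _ 1 y]) auto
  also have "\<dots> = (LINT x|lborel. cis (- (y \<bullet> \<xi>)) * (cis (- (x \<bullet> \<xi>)) * kernel j x))"
    by (intro Bochner_Integration.integral_cong) (simp_all add: inner_add_left cis_mult)
  also have "\<dots> = cis (- (y \<bullet> \<xi>)) * ft (kernel j) \<xi>" unfolding ft_def by (rule integral_mult_right_zero)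
  finally show ?thesis .
qed

lemma indicator_integrable: "integrable lborel (indicator \<Omega> :: real^2 \<Rightarrow> complex)"
proof -
  have "integrable lborel (\<lambda>x. complex_of_real (indicat_real \<Omega> x))"
    using emeasure_bounded_finite[OF bounded_domain] by (intro integrable_of_real integrable_real_indicator) auto
  moreover have "(\<lambda>x. complex_of_real (indicat_real \<Omega> x)) = indicator \<Omega>" by (auto simp: indicator_def)
  ultimately show ?thesis by simp
qed

lemma piece_integrable: "integrable lborel (piece j)"
proof -
  obtain c where "\<And>j. (\<integral>\<^sup>+x. ennreal (norm (piece j x)) \<partial>lborel) \<le> ennreal (c * (1 / 2 ^ j) powr (2 - koch_dim))"
    by (rule piece_L1) (rule that; assumption)
  from this[of j] show ?thesis
    by (intro integrableI_bounded) (auto intro: le_less_trans)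
qed

text \<open>The convolution theorem; Fubini applies because \<Omega> has finite measure and the
  kernel is integrable.\<close>

lemma ft_piece: "ft (piece j) \<xi> = ft (kernel j) \<xi> * ft (indicator \<Omega>) \<xi>"
proof -
  let ?V = "\<lambda>y x. cis (- (x \<bullet> \<xi>)) * (indicator \<Omega> y * kernel j (x - y))"
  have V: "integrable (lborel \<Otimes>\<^sub>M lborel) (\<lambda>(y, x). ?V y x)"
  proof (rule lborel_pair.Fubini_integrable)
    have "(LINT x|lborel. norm (kernel j (x - y))) = (LINT x|lborel. norm (kernel j x))" for y
      by (subst integral_lborel_affine[of _ 1 y]) auto
    then have "(\<lambda>y. LINT x|lborel. norm (case (y, x) of (y, x) \<Rightarrow> ?V y x)) = (\<lambda>y. indicator \<Omega> y * (LINT x|lborel. norm (kernel j x)))"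
      by (auto simp: norm_mult indicator_def)
    then show "integrable lborel (\<lambda>y. LINT x|lborel. norm (case (y, x) of (y, x) \<Rightarrow> ?V y x))"
      using emeasure_bounded_finite[OF bounded_domain] by (auto intro!: integrable_mult_left integrable_real_indicator)
    have "integrable lborel (\<lambda>x. ?V y x)" for y
      by (rule Bochner_Integration.integrable_bound[OF kernel_shift_integrable[of j y]]) (auto simp: norm_mult indicator_def)
    then show "AE y in lborel. integrable lborel (\<lambda>x. case (y, x) of (y, x) \<Rightarrow> ?V y x)" by simp
  qed measurable
  have "ft (piece j) \<xi> = (LINT x|lborel. LINT y|lborel. ?V y x)"
    unfolding ft_def piece_eq by (simp only: integral_mult_right_zero)
  also have "\<dots> = (LINT y|lborel. LINT x|lborel. ?V y x)"
    by (rule lborel_pair.Fubini_integral[OF V])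
  also have "\<dots> = (LINT y|lborel. indicator \<Omega> y * (cis (- (y \<bullet> \<xi>)) * ft (kernel j) \<xi>))"
  proof (rule Bochner_Integration.integral_cong)
    fix y
    have "(LINT x|lborel. ?V y x) = (LINT x|lborel. indicator \<Omega> y * (cis (- (x \<bullet> \<xi>)) * kernel j (x - y)))"
      by (simp only: mult.left_commute)
    then show "(LINT x|lborel. ?V y x) = indicator \<Omega> y * (cis (- (y \<bullet> \<xi>)) * ft (kernel j) \<xi>)"
      by (simp only: integral_mult_right_zero ft_kernel_shift)
  qed simp
  also have "\<dots> = (LINT y|lborel. ft (kernel j) \<xi> * (cis (- (y \<bullet> \<xi>)) * indicator \<Omega> y))"
    by (simp only: mult.commute mult.left_commute)
  also have "\<dots> = ft (kernel j) \<xi> * ft (indicator \<Omega>) \<xi>"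
    unfolding ft_def by (rule integral_mult_right_zero)
  finally show ?thesis .
qed

lemma ft_kernel_pos:
  assumes "0 < j"
  shows "ft (kernel j) \<xi> = ft \<phi> ((1 / 2 ^ j) *\<^sub>R \<xi>)"
proof -
  have [measurable]: "\<phi> \<in> borel_measurable borel" using schwartz_measurable schwartz_pair by auto
  have "ft \<phi> ((1 / 2 ^ j) *\<^sub>R \<xi>) = (\<bar>2 ^ j\<bar> ^ DIM(real^2)) *\<^sub>R (LINT x|lborel. cis (- ((0 + 2 ^ j *\<^sub>R x) \<bullet> ((1 / 2 ^ j) *\<^sub>R \<xi>))) * \<phi> (0 + 2 ^ j *\<^sub>R x))"
    unfolding ft_def by (rule integral_lborel_affine) auto
  also have "\<dots> = (LINT x|lborel. 4 ^ j * (cis (- (x \<bullet> \<xi>)) * \<phi> (2 ^ j *\<^sub>R x)))"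
    by (simp add: two_power_square scaleR_conv_of_real[where 'a = complex])
  also have "\<dots> = ft (kernel j) \<xi>"
    unfolding ft_def kernel_pos[OF assms] by (simp only: mult.left_commute)
  finally show ?thesis ..
qed

text \<open>The dilated annuli and the central disc cover the plane: the least \<open>j\<close> with
  \<open>norm \<xi> \<le> 5/3 * 2 ^ j\<close>, if positive, has \<open>norm \<xi>\<close> above
  \<open>5/6 * 2 ^ j\<close>, hence above \<open>3/5 * 2 ^ j\<close>.\<close>

lemma ft_kernel_cover:
  obtains c where "0 < c" "\<And>\<xi>. \<exists>j. c \<le> norm (ft (kernel j) \<xi>) \<and> norm \<xi> \<le> 2 * 2 ^ j"
proof -
  obtain c0 where c0: "0 < c0" "\<And>\<xi>. norm \<xi> \<le> 5/3 \<Longrightarrow> c0 \<le> norm (fourier \<phi>\<^sub>0 \<xi>)"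
    using admissible unfolding admissible_pair_def by blast
  obtain c1 where c1: "0 < c1" "\<And>\<xi>. 3/5 \<le> norm \<xi> \<Longrightarrow> norm \<xi> \<le> 5/3 \<Longrightarrow> c1 \<le> norm (fourier \<phi> \<xi>)"
    using admissible unfolding admissible_pair_def by blast
  \<comment> \<open>The normalising factor \<open>1 / (2 * pi)\<close> is below 1, so lower bounds
    carry over to \<open>ft\<close>.\<close>
  have f: "norm (fourier u \<xi>) \<le> norm (ft u \<xi>)" for u \<xi>
  proof -
    have "1 / (2 * pi) * norm (ft u \<xi>) \<le> 1 * norm (ft u \<xi>)"
      using pi_ge_two by (intro mult_right_mono) (auto simp: field_simps)
    then show ?thesis by (simp add: fourier_eq_ft norm_mult norm_divide)
  qed
  show thesis
  proof (rule that[of "min c0 c1"])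
    show "0 < min c0 c1" using c0 c1 by simp
    fix \<xi> :: "real^2"
    show "\<exists>j. min c0 c1 \<le> norm (ft (kernel j) \<xi>) \<and> norm \<xi> \<le> 2 * 2 ^ j"
    proof (cases "norm \<xi> \<le> 5/3")
      case True
      then have "min c0 c1 \<le> norm (ft (kernel 0) \<xi>)"
        using c0(2)[OF True] f[of \<phi>\<^sub>0 \<xi>] unfolding kernel_0 by (simp add: min_le_iff_disj)
      then show ?thesis using True by (intro exI[of _ 0]) simp
    next
      case False
      obtain n where "norm \<xi> / (5/3) < 2 ^ n" using real_arch_pow[of 2] by fastforce
      then have "\<exists>n. norm \<xi> \<le> 5/3 * 2 ^ n" by (intro exI[of _ n]) (simp add: field_simps)
      then obtain j where j: "norm \<xi> \<le> 5/3 * 2 ^ j" "\<And>i. i < j \<Longrightarrow> \<not> norm \<xi> \<le> 5/3 * 2 ^ i"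
        using exists_least_iff[of "\<lambda>j. norm \<xi> \<le> 5/3 * 2 ^ j"] by auto
      have "j \<noteq> 0" using j(1) False by (cases j) auto
      then obtain i where i: "j = Suc i" by (cases j) auto
      have "5/3 * 2 ^ i < norm \<xi>" using j(2)[of i] i by simp
      then have "3/5 \<le> norm ((1 / 2 ^ j) *\<^sub>R \<xi>)" "norm ((1 / 2 ^ j) *\<^sub>R \<xi>) \<le> 5/3"
        using j(1) i by (simp_all add: field_simps)
      then have "c1 \<le> norm (ft (kernel j) \<xi>)"
        unfolding ft_kernel_pos[of j, OF \<open>j \<noteq> 0\<close>[unfolded neq0_conv]] using c1(2) f order_trans by blast
      moreover have "norm \<xi> \<le> 2 * 2 ^ j" using j(1) by (rule order_trans) simp
      ultimately show ?thesis by (intro exI[of _ j]) (simp add: min_le_iff_disj)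
    qed
  qed
qed

text \<open>The chance that a Gaussian step of width \<open>e\<close> from \<open>x\<close> ends
  outside \<Omega>. Integrated over \<Omega> it becomes \<open>gap e\<close>, the heat found outside
  \<Omega> at time \<open>e\<^sup>2 / 2\<close> if \<Omega> starts at temperature one and the rest
  of the plane at zero.\<close>

definition outer :: "real \<Rightarrow> real^2 \<Rightarrow> ennreal" where
  "outer e x = (\<integral>\<^sup>+y. indicator (- \<Omega>) y * ennreal (gauss e (x - y)) \<partial>lborel)"

definition inner_part :: "real \<Rightarrow> real^2 \<Rightarrow> ennreal" where
  "inner_part e x = (\<integral>\<^sup>+y. indicator \<Omega> y * ennreal (gauss e (x - y)) \<partial>lborel)"

definition gap :: "real \<Rightarrow> ennreal" where
  "gap e = (\<integral>\<^sup>+x. indicator \<Omega> x * outer e x \<partial>lborel)"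

definition self_energy :: "real \<Rightarrow> ennreal" where
  "self_energy e = (\<integral>\<^sup>+x. indicator \<Omega> x * inner_part e x \<partial>lborel)"

lemma outer_measurable [measurable]: "outer e \<in> borel_measurable borel"
  unfolding outer_def[abs_def] by measurable

lemma inner_part_measurable [measurable]: "inner_part e \<in> borel_measurable borel"
  unfolding inner_part_def[abs_def] by measurable

lemma inner_outer: "0 < e \<Longrightarrow> inner_part e x + outer e x = 1"
proof -
  assume e: "0 < e"
  have "inner_part e x + outer e x = (\<integral>\<^sup>+y. indicator \<Omega> y * ennreal (gauss e (x - y)) + indicator (- \<Omega>) y * ennreal (gauss e (x - y)) \<partial>lborel)"
    unfolding inner_part_def outer_def by (rule nn_integral_add[symmetric]) measurable
  also have "\<dots> = (\<integral>\<^sup>+y. ennreal (gauss e (x - y)) \<partial>lborel)"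
    by (intro nn_integral_cong) (auto simp: indicator_def)
  finally show ?thesis using gauss_nn_integral[OF e] by simp
qed

lemma energy_gap:
  assumes "0 < e"
  shows "self_energy e + gap e = ennreal (area \<Omega>)"
proof -
  have "self_energy e + gap e = (\<integral>\<^sup>+x. indicator \<Omega> x * inner_part e x + indicator \<Omega> x * outer e x \<partial>lborel)"
    unfolding self_energy_def gap_def by (rule nn_integral_add[symmetric]) measurable
  also have "\<dots> = (\<integral>\<^sup>+x. indicator \<Omega> x \<partial>lborel)"
    unfolding distrib_left[symmetric] inner_outer[OF assms] by simp
  also have "\<dots> = ennreal (area \<Omega>)" using emeasure_lborel_eq_area[OF bounded_domain] by simp
  finally show ?thesis .
qed

lemma self_energy_ft:
  assumes e: "0 < e"
  shows "(\<integral>\<^sup>+\<xi>. ennreal ((norm (ft (indicator \<Omega>) \<xi>))\<^sup>2 * exp (- (e * norm \<xi>)\<^sup>2 / 2)) \<partial>lborel) = ennreal ((2 * pi)\<^sup>2) * self_energy e"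
proof -
  let ?P = "lborel \<Otimes>\<^sub>M lborel :: ((real^2) \<times> (real^2)) measure"
  let ?f = "indicator \<Omega> :: real^2 \<Rightarrow> complex"
  define g where "g p = indicat_real \<Omega> (fst p) * (indicat_real \<Omega> (snd p) * gauss e (fst p - snd p))" for p
  have eq: "?f (fst p) * cnj (?f (snd p)) * complex_of_real (gauss e (fst p - snd p)) = complex_of_real (g p)" for p
    by (auto simp: g_def indicator_def)
  have g: "integrable ?P g"
    using integrable_bounded_linear[OF bounded_linear_Re ft_energy(2)[OF indicator_integrable e]] unfolding eq Re_complex_of_real .
  have "(LINT \<xi>|lborel. (norm (ft ?f \<xi>))\<^sup>2 * exp (- (e * norm \<xi>)\<^sup>2 / 2)) = (2 * pi)\<^sup>2 * (LINT p|?P. g p)"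
    using ft_energy(3)[OF indicator_integrable e] unfolding eq integral_complex_of_real of_real_mult[symmetric] of_real_eq_iff .
  moreover have "(\<integral>\<^sup>+\<xi>. ennreal ((norm (ft ?f \<xi>))\<^sup>2 * exp (- (e * norm \<xi>)\<^sup>2 / 2)) \<partial>lborel)
      = ennreal (LINT \<xi>|lborel. (norm (ft ?f \<xi>))\<^sup>2 * exp (- (e * norm \<xi>)\<^sup>2 / 2))"
    by (intro nn_integral_eq_integral ft_energy(1)[OF indicator_integrable e]) auto
  moreover have "ennreal (LINT p|?P. g p) = (\<integral>\<^sup>+p. ennreal (g p) \<partial>?P)"
    by (rule nn_integral_eq_integral[symmetric, OF g]) (auto simp: g_def)
  moreover have "(\<integral>\<^sup>+p. ennreal (g p) \<partial>?P) = (\<integral>\<^sup>+x. \<integral>\<^sup>+y. ennreal (g (x, y)) \<partial>lborel \<partial>lborel)"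
    using borel_measurable_integrable[OF g] by (subst lborel.nn_integral_fst[symmetric]) auto
  moreover have "(\<integral>\<^sup>+y. ennreal (g (x, y)) \<partial>lborel) = indicator \<Omega> x * inner_part e x" for x
  proof -
    have "(\<integral>\<^sup>+y. ennreal (g (x, y)) \<partial>lborel) = (\<integral>\<^sup>+y. indicator \<Omega> x * (indicator \<Omega> y * ennreal (gauss e (x - y))) \<partial>lborel)"
      by (intro nn_integral_cong) (auto simp: g_def indicator_def)
    also have "\<dots> = indicator \<Omega> x * inner_part e x"
      unfolding inner_part_def by (rule nn_integral_cmult) measurable
    finally show ?thesis .
  qed
  ultimately show ?thesis
    unfolding self_energy_def by (simp add: ennreal_mult')
qed

text \<open>Rescaling around \<open>x\<close> fixes the Gaussian and moves the scale into the
  indicator, which tends to 1 pointwise because \<Omega> is open.\<close>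

lemma inner_part_tendsto:
  assumes "x \<in> \<Omega>"
  shows "(\<lambda>n. inner_part (1 / real (Suc n)) x) \<longlonglongrightarrow> 1"
proof -
  have eq: "inner_part (1 / real (Suc n)) x = (\<integral>\<^sup>+w. indicator \<Omega> (x - (1 / real (Suc n)) *\<^sub>R w) * ennreal (gauss 1 w) \<partial>lborel)" for n
  proof -
    define e where "e = 1 / real (Suc n)"
    have e: "e > 0" by (simp add: e_def)
    have "inner_part e x = ennreal (\<bar>- e\<bar> ^ DIM(real^2)) * (\<integral>\<^sup>+w. indicator \<Omega> (x + (- e) *\<^sub>R w) * ennreal (gauss e (x - (x + (- e) *\<^sub>R w))) \<partial>lborel)"
      unfolding inner_part_def using e by (intro nn_integral_lborel_affine) auto
    also have "\<dots> = (\<integral>\<^sup>+w. ennreal (\<bar>- e\<bar> ^ DIM(real^2)) * (indicator \<Omega> (x + (- e) *\<^sub>R w) * ennreal (gauss e (x - (x + (- e) *\<^sub>R w)))) \<partial>lborel)"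
      by (rule nn_integral_cmult[symmetric]) measurable
    also have "\<dots> = (\<integral>\<^sup>+w. indicator \<Omega> (x - e *\<^sub>R w) * ennreal (gauss 1 w) \<partial>lborel)"
    proof (rule nn_integral_cong)
      fix w :: "real^2"
      have "e\<^sup>2 * gauss e (e *\<^sub>R w) = gauss 1 w" using e by (simp add: gauss_def)
      then have "ennreal (e\<^sup>2) * ennreal (gauss e (e *\<^sub>R w)) = ennreal (gauss 1 w)" by (simp flip: ennreal_mult)
      then show "ennreal (\<bar>- e\<bar> ^ DIM(real^2)) * (indicator \<Omega> (x + (- e) *\<^sub>R w) * ennreal (gauss e (x - (x + (- e) *\<^sub>R w))))
          = indicator \<Omega> (x - e *\<^sub>R w) * ennreal (gauss 1 w)"
        by (cases "x - e *\<^sub>R w \<in> \<Omega>") simp_all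
    qed
    finally show ?thesis by (simp add: e_def)
  qed
  have "(\<lambda>n. \<integral>\<^sup>+w. indicator \<Omega> (x - (1 / real (Suc n)) *\<^sub>R w) * ennreal (gauss 1 w) \<partial>lborel) \<longlonglongrightarrow> (\<integral>\<^sup>+w. ennreal (gauss 1 w) \<partial>lborel)"
  proof (rule nn_integral_dominated_convergence[where w = "\<lambda>w. ennreal (gauss 1 w)"])
    show "(\<integral>\<^sup>+w. ennreal (gauss 1 w) \<partial>lborel) < \<infinity>"
      using gauss_nn_integral[of 1 0] by simp
    show "AE w in lborel. (\<lambda>n. indicator \<Omega> (x - (1 / real (Suc n)) *\<^sub>R w) * ennreal (gauss 1 w)) \<longlonglongrightarrow> ennreal (gauss 1 w)"
    proof (intro AE_I2)
      fix w :: "real^2"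
      have "(\<lambda>n. (1 / real (Suc n)) *\<^sub>R w) \<longlonglongrightarrow> 0 *\<^sub>R w"
        using LIMSEQ_inverse_real_of_nat by (intro tendsto_scaleR tendsto_const) (simp add: inverse_eq_divide)
      then have "(\<lambda>n. x - (1 / real (Suc n)) *\<^sub>R w) \<longlonglongrightarrow> x - 0 *\<^sub>R w" by (intro tendsto_diff tendsto_const)
      then have "eventually (\<lambda>n. x - (1 / real (Suc n)) *\<^sub>R w \<in> \<Omega>) sequentially"
        using open_domain assms by (intro topological_tendstoD) auto
      then have "eventually (\<lambda>n. indicator \<Omega> (x - (1 / real (Suc n)) *\<^sub>R w) * ennreal (gauss 1 w) = ennreal (gauss 1 w)) sequentially"
        by eventually_elim simp
      then show "(\<lambda>n. indicator \<Omega> (x - (1 / real (Suc n)) *\<^sub>R w) * ennreal (gauss 1 w)) \<longlonglongrightarrow> ennreal (gauss 1 w)"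
        by (rule tendsto_eventually)
    qed
    show "AE w in lborel. indicator \<Omega> (x - (1 / real (Suc j)) *\<^sub>R w) * ennreal (gauss 1 w) \<le> ennreal (gauss 1 w)" for j
      by (intro AE_I2) (auto simp: indicator_def)
  qed measurable
  moreover have "(\<integral>\<^sup>+w. ennreal (gauss 1 w) \<partial>lborel) = 1"
    using gauss_nn_integral[of 1 0] by simp
  ultimately show ?thesis unfolding eq by simp
qed

text \<open>Recovers the squared norm of the indicator as a limit of weighted energies, in place of
  Plancherel for the indicator itself.\<close>

lemma self_energy_tendsto: "(\<lambda>n. self_energy (1 / real (Suc n))) \<longlonglongrightarrow> ennreal (area \<Omega>)"
proof -
  have "(\<lambda>n. self_energy (1 / real (Suc n))) \<longlonglongrightarrow> (\<integral>\<^sup>+x. indicator \<Omega> x \<partial>lborel)"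
    unfolding self_energy_def
  proof (rule nn_integral_dominated_convergence[where w = "indicator \<Omega>"])
    show "(\<integral>\<^sup>+x. indicator \<Omega> x \<partial>lborel) < \<infinity>" using emeasure_lborel_eq_area[OF bounded_domain] by simp
    show "AE x in lborel. indicator \<Omega> x * inner_part (1 / real (Suc j)) x \<le> indicator \<Omega> x" for j
    proof (intro AE_I2)
      fix x
      have "inner_part (1 / real (Suc j)) x \<le> 1"
        using inner_outer[of "1 / real (Suc j)" x] by (metis add_increasing2 le_iff_add of_nat_0_less_iff zero_less_Suc zero_less_divide_1_iff)
      then show "indicator \<Omega> x * inner_part (1 / real (Suc j)) x \<le> indicator \<Omega> x" by (cases "x \<in> \<Omega>") auto
    qed
    show "AE x in lborel. (\<lambda>n. indicator \<Omega> x * inner_part (1 / real (Suc n)) x) \<longlonglongrightarrow> indicator \<Omega> x"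
    proof (intro AE_I2)
      fix x show "(\<lambda>n. indicator \<Omega> x * inner_part (1 / real (Suc n)) x) \<longlonglongrightarrow> indicator \<Omega> x"
        using inner_part_tendsto[of x] by (cases "x \<in> \<Omega>") auto
    qed
  qed measurable
  then show ?thesis using emeasure_lborel_eq_area[OF bounded_domain] by simp
qed

text \<open>\<open>gap e\<close> is the limit of \<open>self_energy e' - self_energy e\<close> as e'
  tends to 0. At a frequency up to \<open>2 * 2 ^ j\<close> the two Gaussian weights differ by at
  most \<open>2 * min 1 (4 ^ j * e\<^sup>2)\<close> times the weight of e'; taking for
  \<open>j\<close> a level whose kernel is bounded below there charges the difference to a single
  piece.\<close>

lemma gap_le:
  obtains c where "0 < c"
    "\<And>e. 0 < e \<Longrightarrow> gap e \<le> (\<Sum>j. ennreal (c * min 1 (4 ^ j * e\<^sup>2)) * (\<integral>\<^sup>+x. ennreal ((norm (piece j x))\<^sup>2) \<partial>lborel))"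
proof -
  obtain c where c: "0 < c" "\<And>\<xi>. \<exists>j. c \<le> norm (ft (kernel j) \<xi>) \<and> norm \<xi> \<le> 2 * 2 ^ j"
    by (rule ft_kernel_cover) (rule that; assumption)
  let ?f = "indicator \<Omega> :: real^2 \<Rightarrow> complex"
  define m where "m e j = 2 / c\<^sup>2 * min 1 (4 ^ j * e\<^sup>2)" for e :: real and j :: nat
  have m: "0 \<le> m e j" for e j by (simp add: m_def)
  define a where "a j = (\<integral>\<^sup>+x. ennreal ((norm (piece j x))\<^sup>2) \<partial>lborel)" for j
  define E where "E e \<xi> = exp (- (e * norm \<xi>)\<^sup>2 / 2)" for e and \<xi> :: "real^2"
  have [measurable]: "E e \<in> borel_measurable borel" for e unfolding E_def by measurable
  \<comment> \<open>Keeping the weight \<open>E e'\<close> on the right makes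
    \<open>ft_energy_le\<close> applicable to every piece.\<close>
  have pt: "ennreal ((norm (ft ?f \<xi>))\<^sup>2 * E e' \<xi>)
      \<le> ennreal ((norm (ft ?f \<xi>))\<^sup>2 * E e \<xi>) + (\<Sum>j. ennreal (m e j) * ennreal ((norm (ft (piece j) \<xi>))\<^sup>2 * E e' \<xi>))"
    if e: "0 < e'" "e' < e" for e e' \<xi>
  proof -
    obtain j where j: "c \<le> norm (ft (kernel j) \<xi>)" "norm \<xi> \<le> 2 * 2 ^ j" using c(2) by blast
    define r where "r = (norm \<xi>)\<^sup>2"
    \<comment> \<open>This is \<open>1 + t \<le> exp t\<close> for the difference of the two
      exponents, after dropping the nonnegative term \<open>e'\<^sup>2 * r / 2\<close>.\<close>
    have "E e' \<xi> * (1 - e\<^sup>2 * r / 2) \<le> E e \<xi>"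
    proof -
      have "E e' \<xi> * (1 - e\<^sup>2 * r / 2) \<le> E e' \<xi> * exp (- (e\<^sup>2 - e'\<^sup>2) * r / 2)"
      proof (rule mult_left_mono)
        have "1 - e\<^sup>2 * r / 2 \<le> 1 + (- (e\<^sup>2 - e'\<^sup>2) * r / 2)"
        proof -
          have "0 \<le> e'\<^sup>2 * r" by (simp add: r_def)
          moreover have "- (e\<^sup>2 - e'\<^sup>2) * r / 2 = - (e\<^sup>2 * r / 2) + e'\<^sup>2 * r / 2"
            by (simp add: left_diff_distrib diff_divide_distrib)
          ultimately show ?thesis by argo
        qed
        also have "\<dots> \<le> exp (- (e\<^sup>2 - e'\<^sup>2) * r / 2)" by (rule exp_ge_add_one_self)
        finally show "1 - e\<^sup>2 * r / 2 \<le> exp (- (e\<^sup>2 - e'\<^sup>2) * r / 2)" .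
      qed (simp add: E_def)
      also have "\<dots> = E e \<xi>"
        unfolding E_def exp_add[symmetric] r_def by (simp add: power_mult_distrib algebra_simps diff_divide_distrib)
      finally show ?thesis .
    qed
    moreover have "e\<^sup>2 * r / 2 \<le> 2 * (4 ^ j * e\<^sup>2)"
    proof -
      have "r \<le> (2 * 2 ^ j)\<^sup>2" unfolding r_def using j(2) by (intro power_mono) auto
      then have "r \<le> 4 * 4 ^ j" by (simp add: power_mult_distrib two_power_square)
      then have "e\<^sup>2 * r \<le> e\<^sup>2 * (4 * 4 ^ j)" by (rule mult_left_mono) simp
      then show ?thesis by (simp add: mult_ac)
    qed
    moreover have "E e' \<xi> \<ge> 0" "E e \<xi> \<ge> 0" by (simp_all add: E_def)
    ultimately have "E e' \<xi> \<le> E e \<xi> + 2 * min 1 (4 ^ j * e\<^sup>2) * E e' \<xi>"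
    proof (cases "1 \<le> 4 ^ j * e\<^sup>2")
      case True
      then show ?thesis using \<open>E e' \<xi> \<ge> 0\<close> \<open>E e \<xi> \<ge> 0\<close> by simp
    next
      case False
      have "E e' \<xi> * (e\<^sup>2 * r / 2) \<le> E e' \<xi> * (2 * (4 ^ j * e\<^sup>2))"
        using \<open>e\<^sup>2 * r / 2 \<le> 2 * (4 ^ j * e\<^sup>2)\<close> \<open>E e' \<xi> \<ge> 0\<close> by (rule mult_left_mono)
      then show ?thesis
        using False \<open>E e' \<xi> * (1 - e\<^sup>2 * r / 2) \<le> E e \<xi>\<close> by (simp add: min_def right_diff_distrib mult_ac)
    qed
    then have "(norm (ft ?f \<xi>))\<^sup>2 * E e' \<xi> \<le> (norm (ft ?f \<xi>))\<^sup>2 * (E e \<xi> + 2 * min 1 (4 ^ j * e\<^sup>2) * E e' \<xi>)"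
      by (rule mult_left_mono) simp
    also have "\<dots> = (norm (ft ?f \<xi>))\<^sup>2 * E e \<xi> + 2 * min 1 (4 ^ j * e\<^sup>2) * E e' \<xi> * (norm (ft ?f \<xi>))\<^sup>2"
      by (simp add: algebra_simps)
    also have "2 * min 1 (4 ^ j * e\<^sup>2) * E e' \<xi> * (norm (ft ?f \<xi>))\<^sup>2 \<le> m e j * ((norm (ft (piece j) \<xi>))\<^sup>2 * E e' \<xi>)"
    proof -
      have "c\<^sup>2 * (norm (ft ?f \<xi>))\<^sup>2 \<le> (norm (ft (piece j) \<xi>))\<^sup>2"
        unfolding ft_piece norm_mult power_mult_distrib using j(1) c(1) by (intro mult_right_mono power_mono) auto
      then have "(norm (ft ?f \<xi>))\<^sup>2 \<le> (norm (ft (piece j) \<xi>))\<^sup>2 / c\<^sup>2" using c(1) by (simp add: field_simps)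
      then have "2 * min 1 (4 ^ j * e\<^sup>2) * E e' \<xi> * (norm (ft ?f \<xi>))\<^sup>2 \<le> 2 * min 1 (4 ^ j * e\<^sup>2) * E e' \<xi> * ((norm (ft (piece j) \<xi>))\<^sup>2 / c\<^sup>2)"
        using \<open>E e' \<xi> \<ge> 0\<close> by (intro mult_left_mono) auto
      then show ?thesis by (simp add: m_def mult_ac)
    qed
    finally have "ennreal ((norm (ft ?f \<xi>))\<^sup>2 * E e' \<xi>)
        \<le> ennreal ((norm (ft ?f \<xi>))\<^sup>2 * E e \<xi> + m e j * ((norm (ft (piece j) \<xi>))\<^sup>2 * E e' \<xi>))"
      by (simp add: ennreal_leI)
    also have "\<dots> = ennreal ((norm (ft ?f \<xi>))\<^sup>2 * E e \<xi>) + ennreal (m e j * ((norm (ft (piece j) \<xi>))\<^sup>2 * E e' \<xi>))"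
      using m by (intro ennreal_plus) (auto simp: E_def)
    also have "ennreal (m e j * ((norm (ft (piece j) \<xi>))\<^sup>2 * E e' \<xi>)) = (\<Sum>j\<in>{j}. ennreal (m e j) * ennreal ((norm (ft (piece j) \<xi>))\<^sup>2 * E e' \<xi>))"
      using m by (simp add: ennreal_mult E_def)
    also have "\<dots> \<le> (\<Sum>j. ennreal (m e j) * ennreal ((norm (ft (piece j) \<xi>))\<^sup>2 * E e' \<xi>))"
      by (rule sum_le_suminf) auto
    finally show ?thesis by (simp add: add_left_mono)
  qed
  have [measurable]: "ft (piece j) \<in> borel_measurable borel" "ft ?f \<in> borel_measurable borel" for j
    by (intro ft_measurable; measurable)+
  have step: "self_energy e' \<le> self_energy e + (\<Sum>j. ennreal (m e j) * a j)" if e: "0 < e'" "e' < e" for e e'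
  proof -
    let ?S = "\<Sum>j. ennreal (m e j) * a j"
    have e0: "0 < e" using e by simp
    have "ennreal ((2 * pi)\<^sup>2) * self_energy e' = (\<integral>\<^sup>+\<xi>. ennreal ((norm (ft ?f \<xi>))\<^sup>2 * E e' \<xi>) \<partial>lborel)"
      unfolding E_def using self_energy_ft[OF e(1)] by simp
    also have "\<dots> \<le> (\<integral>\<^sup>+\<xi>. ennreal ((norm (ft ?f \<xi>))\<^sup>2 * E e \<xi>)
        + (\<Sum>j. ennreal (m e j) * ennreal ((norm (ft (piece j) \<xi>))\<^sup>2 * E e' \<xi>)) \<partial>lborel)"
      by (intro nn_integral_mono pt e)
    also have "\<dots> = (\<integral>\<^sup>+\<xi>. ennreal ((norm (ft ?f \<xi>))\<^sup>2 * E e \<xi>) \<partial>lborel)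
        + (\<integral>\<^sup>+\<xi>. (\<Sum>j. ennreal (m e j) * ennreal ((norm (ft (piece j) \<xi>))\<^sup>2 * E e' \<xi>)) \<partial>lborel)"
      by (rule nn_integral_add) measurable
    also have "(\<integral>\<^sup>+\<xi>. ennreal ((norm (ft ?f \<xi>))\<^sup>2 * E e \<xi>) \<partial>lborel) = ennreal ((2 * pi)\<^sup>2) * self_energy e"
      unfolding E_def using self_energy_ft[OF e0] by simp
    also have "(\<integral>\<^sup>+\<xi>. (\<Sum>j. ennreal (m e j) * ennreal ((norm (ft (piece j) \<xi>))\<^sup>2 * E e' \<xi>)) \<partial>lborel)
        = (\<Sum>j. \<integral>\<^sup>+\<xi>. ennreal (m e j) * ennreal ((norm (ft (piece j) \<xi>))\<^sup>2 * E e' \<xi>) \<partial>lborel)"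
      by (rule nn_integral_suminf) measurable
    also have "\<dots> = (\<Sum>j. ennreal (m e j) * (\<integral>\<^sup>+\<xi>. ennreal ((norm (ft (piece j) \<xi>))\<^sup>2 * E e' \<xi>) \<partial>lborel))"
      by (intro suminf_cong nn_integral_cmult) measurable
    also have "\<dots> \<le> (\<Sum>j. ennreal ((2 * pi)\<^sup>2) * (ennreal (m e j) * a j))"
    proof (intro suminf_le summableI)
      fix j
      have "(\<integral>\<^sup>+\<xi>. ennreal ((norm (ft (piece j) \<xi>))\<^sup>2 * E e' \<xi>) \<partial>lborel) \<le> ennreal ((2 * pi)\<^sup>2) * a j"
        unfolding E_def a_def by (rule ft_energy_le[OF piece_integrable e(1)])
      then have "ennreal (m e j) * (\<integral>\<^sup>+\<xi>. ennreal ((norm (ft (piece j) \<xi>))\<^sup>2 * E e' \<xi>) \<partial>lborel) \<le> ennreal (m e j) * (ennreal ((2 * pi)\<^sup>2) * a j)"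
        by (rule mult_left_mono) simp
      then show "ennreal (m e j) * (\<integral>\<^sup>+\<xi>. ennreal ((norm (ft (piece j) \<xi>))\<^sup>2 * E e' \<xi>) \<partial>lborel) \<le> ennreal ((2 * pi)\<^sup>2) * (ennreal (m e j) * a j)"
        by (simp only: mult.left_commute)
    qed
    also have "\<dots> = ennreal ((2 * pi)\<^sup>2) * ?S" by (rule ennreal_suminf_cmult)
    finally have "ennreal ((2 * pi)\<^sup>2) * self_energy e' \<le> ennreal ((2 * pi)\<^sup>2) * (self_energy e + ?S)"
      by (simp add: distrib_left add_left_mono)
    then show ?thesis
      by (subst (asm) ennreal_mult_le_mult_iff) auto
  qed
  show thesis
  proof (rule that[of "2 / c\<^sup>2"])
    show "0 < 2 / c\<^sup>2" using c(1) by simp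
    fix e :: real assume e: "0 < e"
    let ?S = "\<Sum>j. ennreal (m e j) * a j"
    obtain N where N: "1 / real (Suc N) < e" using nat_approx_posE[OF e] by metis
    have "self_energy (1 / real (Suc n)) \<le> self_energy e + ?S" if "n \<ge> N" for n
    proof (rule step)
      have "1 / real (Suc n) \<le> 1 / real (Suc N)" using that by (intro divide_left_mono) auto
      then show "1 / real (Suc n) < e" using N by simp
    qed simp
    then have "ennreal (area \<Omega>) \<le> self_energy e + ?S"
      by (intro LIMSEQ_le_const2[OF self_energy_tendsto]) blast
    then have "self_energy e + gap e \<le> self_energy e + ?S" using energy_gap[OF e] by simp
    moreover have "self_energy e \<noteq> \<infinity>"
    proof
      assume "self_energy e = \<infinity>"
      then show False using energy_gap[OF e] by simp
    qed
    ultimately have "gap e \<le> ?S" by (simp add: ennreal_add_left_cancel_le)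
    then show "gap e \<le> (\<Sum>j. ennreal (2 / c\<^sup>2 * min 1 (4 ^ j * e\<^sup>2)) * (\<integral>\<^sup>+x. ennreal ((norm (piece j x))\<^sup>2) \<partial>lborel))"
      unfolding m_def a_def .
  qed
qed

end

section \<open>Sequence norms, unit cubes and a truncated geometric series\<close>

lemma epowr_epowr_inverse: "0 < r \<Longrightarrow> epowr (epowr x r) (1 / r) = x"
  by (cases "x = \<infinity>") (auto simp: epowr_def powr_powr less_top[symmetric] ennreal_enn2real_if)

text \<open>The dependence on \<open>q\<close> disappears here: whatever its value, the norm
  dominates each level.\<close>

lemma le_lq_norm_from:
  assumes "1 \<le> q" "J \<le> j"
  shows "a j \<le> lq_norm_from q J a"
proof (cases "q = \<infinity>")
  case True
  then show ?thesis using assms(2) by (auto simp: lq_norm_from_def intro: SUP_upper)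
next
  case False
  define r where "r = enn2real q"
  have r: "1 \<le> r" using enn2real_mono[of 1 q] assms(1) False by (simp add: r_def less_top)
  have "(\<Sum>i\<in>{j - J}. epowr (a (J + i)) r) \<le> (\<Sum>i. epowr (a (J + i)) r)"
    by (rule sum_le_suminf) auto
  then have "epowr (a j) r \<le> (\<Sum>i. epowr (a (J + i)) r)" using assms(2) by simp
  then have "epowr (epowr (a j) r) (1 / r) \<le> epowr (\<Sum>i. epowr (a (J + i)) r) (1 / r)"
    using r by (intro epowr_mono) auto
  then show ?thesis using False r by (simp add: lq_norm_from_def r_def[symmetric] epowr_epowr_inverse)
qed

lemma dyadic_cube_unit_cover:
  obtains F :: "(int^2) set" where "finite F" "\<And>x. norm x \<le> R \<Longrightarrow> x \<in> (\<Union>k\<in>F. dyadic_cube 0 k)"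
proof -
  define F :: "(int^2) set" where "F = (\<lambda>(m, n). vector [m, n]) ` ({\<lfloor>- R\<rfloor>..\<lfloor>R\<rfloor>} \<times> {\<lfloor>- R\<rfloor>..\<lfloor>R\<rfloor>})"
  have "x \<in> (\<Union>k\<in>F. dyadic_cube 0 k)" if "norm x \<le> R" for x :: "real^2"
  proof -
    define k :: "int^2" where "k = vector [\<lfloor>x $ 1\<rfloor>, \<lfloor>x $ 2\<rfloor>]"
    have "\<bar>x $ 1\<bar> \<le> R" "\<bar>x $ 2\<bar> \<le> R" using component_le_norm_cart[of x] that order_trans by blast+
    then have "\<lfloor>- R\<rfloor> \<le> \<lfloor>x $ 1\<rfloor>" "\<lfloor>x $ 1\<rfloor> \<le> \<lfloor>R\<rfloor>" "\<lfloor>- R\<rfloor> \<le> \<lfloor>x $ 2\<rfloor>" "\<lfloor>x $ 2\<rfloor> \<le> \<lfloor>R\<rfloor>"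
      by (intro floor_mono; simp add: abs_le_iff)+
    then have "k \<in> F" unfolding F_def k_def by (auto intro!: image_eqI[of _ _ "(\<lfloor>x $ 1\<rfloor>, \<lfloor>x $ 2\<rfloor>)"])
    moreover have "x \<in> dyadic_cube 0 k"
    proof -
      define y where "y = x - (\<chi> i. real_of_int (k $ i))"
      have "y $ 1 = frac (x $ 1)" "y $ 2 = frac (x $ 2)" by (simp_all add: y_def k_def frac_def)
      then have "\<forall>i. 0 \<le> y $ i \<and> y $ i < 1" by (simp add: forall_2 frac_lt_1)
      moreover have "x = (2 powi (- 0)) *\<^sub>R (y + (\<chi> i. real_of_int (k $ i)))" by (simp add: y_def)
      ultimately show ?thesis unfolding dyadic_cube_def by blast
    qed
    ultimately show ?thesis by blast
  qed
  then show thesis by (intro that[of F]) (auto simp: F_def)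
qed

text \<open>The weight sum at scale \<open>(1/2) ^ i\<close>: the terms grow geometrically up to
  \<open>j = i\<close> and decay afterwards, so its size is that of \<open>b ^ i\<close>. Raising
  \<open>i\<close> by one multiplies the sum by \<open>b\<close> and adds one term, which
  \<open>1/2 \<le> b\<close> bounds by \<open>b ^ Suc i * (1/2) ^ Suc i\<close>; the part
  \<open>1 - (1/2) ^ i\<close> of the bound collects these additions.\<close>

lemma suminf_min_geometric_le:
  assumes "1/2 \<le> b" "b < (1::real)"
  shows "(\<Sum>j. ennreal (min 1 (4 ^ j * (1/4) ^ i) * b ^ j)) \<le> ennreal (b ^ i * (1 / (1 - b) + 1 - (1/2) ^ i))"
proof (induction i)
  case 0
  have "(\<Sum>j. ennreal (min 1 (4 ^ j * (1/4) ^ 0) * b ^ j)) \<le> ennreal (1 / (1 - b))"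
  proof (rule suminf_geometric_ennreal_le)
    fix k
    have "min 1 (4 ^ k * (1/4) ^ 0) * b ^ k \<le> 1 * b ^ k" using assms by (intro mult_right_mono) auto
    then show "ennreal (min 1 (4 ^ k * (1/4) ^ 0) * b ^ k) \<le> ennreal (1 * b ^ k)" by (rule ennreal_leI)
  qed (use assms in auto)
  then show ?case by simp
next
  case (Suc i)
  let ?f = "\<lambda>j. ennreal (min 1 (4 ^ j * (1/4) ^ Suc i) * b ^ j)"
  have eq: "?f (j + 1) = ennreal b * ennreal (min 1 (4 ^ j * (1/4) ^ i) * b ^ j)" for j
    using assms by (simp add: ennreal_mult[symmetric] mult_ac)
  have "(\<Sum>j. ?f j) = (\<Sum>j. ?f (j + 1)) + (\<Sum>j<1. ?f j)" by (rule suminf_offset) (rule summableI)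
  also have "(\<Sum>j. ?f (j + 1)) = ennreal b * (\<Sum>j. ennreal (min 1 (4 ^ j * (1/4) ^ i) * b ^ j))"
    unfolding eq by (rule ennreal_suminf_cmult)
  also have "(\<Sum>j<1. ?f j) = ennreal (min 1 ((1/4) ^ Suc i))" by simp
  finally have "(\<Sum>j. ?f j) \<le> ennreal b * ennreal (b ^ i * (1 / (1 - b) + 1 - (1/2) ^ i)) + ennreal (b ^ Suc i * (1/2) ^ Suc i)"
  proof (rule ord_eq_le_trans[OF _ add_mono[OF mult_left_mono[OF Suc.IH] ennreal_leI]])
    have "(1/4 :: real) ^ Suc i = (1/2) ^ Suc i * (1/2) ^ Suc i" by (simp only: power_mult_distrib[symmetric]) simp
    also have "\<dots> \<le> b ^ Suc i * (1/2) ^ Suc i" using assms by (intro mult_right_mono power_mono) auto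
    finally show "min 1 ((1/4) ^ Suc i) \<le> b ^ Suc i * (1/2) ^ Suc i" by simp
  qed simp
  also have "\<dots> = ennreal (b * (b ^ i * (1 / (1 - b) + 1 - (1/2) ^ i)) + b ^ Suc i * (1/2) ^ Suc i)"
  proof -
    have "(1/2 :: real) ^ i \<le> 1" by (intro power_le_one) auto
    moreover have "0 \<le> 1 / (1 - b)" using assms by simp
    ultimately have "0 \<le> 1 / (1 - b) + 1 - (1/2) ^ i" by argo
    then have "0 \<le> b ^ i * (1 / (1 - b) + 1 - (1/2) ^ i)" using assms by simp
    then show ?thesis using assms by (simp add: ennreal_plus ennreal_mult)
  qed
  also have "b * (b ^ i * (1 / (1 - b) + 1 - (1/2) ^ i)) + b ^ Suc i * (1/2) ^ Suc i = b ^ Suc i * (1 / (1 - b) + 1 - (1/2) ^ Suc i)"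
    by (simp add: algebra_simps)
  finally show ?case .
qed

section \<open>Non-membership\<close>

context snowflake_convolution
begin

text \<open>Both points lie within \<open>2 * e\<close> of \<open>a\<close>, so the Gaussian between
  them is at least \<open>exp (- 8) / (2 * pi * e\<^sup>2)\<close>; multiplied by the area
  \<open>pi * (e / 100)\<^sup>2\<close> of the outer ball this is the constant.\<close>

lemma outer_ge:
  assumes "arc_separates \<Omega> a b" "norm (b - a) = e" "0 < e" "x \<in> seg_gate a b"
  shows "ennreal (exp (- 8) / 20000) \<le> outer e x"
proof -
  have ab: "a \<noteq> b" using assms by auto
  let ?Y = "ball (seg_pt a b (5/18) (1/18)) (e / 100)"
  have Y: "?Y \<subseteq> seg_left_gate a b" using ball_in_seg_gates(2)[OF ab] assms(2) by simp
  have "ennreal (exp (- 8) / 20000) = ennreal (exp (- 8) / (2 * pi * e\<^sup>2)) * emeasure lborel ?Y"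
    using assms(3) emeasure_lborel_eq_area[OF bounded_ball, of "seg_pt a b (5/18) (1/18)" "e / 100"]
      area_ball[of "e / 100" "seg_pt a b (5/18) (1/18)"]
    by (simp add: ennreal_mult[symmetric] power_divide field_simps)
  also have "\<dots> = (\<integral>\<^sup>+y. ennreal (exp (- 8) / (2 * pi * e\<^sup>2)) * indicator ?Y y \<partial>lborel)"
    by (subst nn_integral_cmult_indicator) auto
  also have "\<dots> \<le> outer e x"
    unfolding outer_def
  proof (rule nn_integral_mono)
    fix y
    show "ennreal (exp (- 8) / (2 * pi * e\<^sup>2)) * indicator ?Y y \<le> indicator (- \<Omega>) y * ennreal (gauss e (x - y))"
    proof (cases "y \<in> ?Y")
      case True
      then have y: "y \<in> seg_left_gate a b" using Y by blast
      then have "y \<in> - \<Omega>" using arc_separates_gates(2)[OF assms(1)] by blast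
      have "dist x a \<le> 2 * e" "dist y a \<le> 2 * e"
        using seg_cell_near[OF ab] y assms(2,4) unfolding mem_seg_left_gate mem_seg_gate by blast+
      then have "norm (x - y) \<le> 4 * e" using dist_triangle2[of x y a] by (simp add: dist_norm)
      then have "norm (x - y) / e \<le> 4" using assms(3) by (simp add: field_simps)
      then have "(norm (x - y) / e)\<^sup>2 \<le> 4\<^sup>2" using assms(3) by (intro power_mono) auto
      then have "exp (- 8) \<le> exp (- (norm (x - y) / e)\<^sup>2 / 2)" by simp
      then have "exp (- 8) / (2 * pi * e\<^sup>2) \<le> gauss e (x - y)"
        unfolding gauss_def by (intro divide_right_mono) auto
      then show ?thesis using True \<open>y \<in> - \<Omega>\<close> by (simp add: ennreal_leI)
    qed simp
  qed
  finally show ?thesis .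
qed

text \<open>Each of the \<open>4 ^ n\<close> disjoint cells contributes its inner ball.\<close>

lemma area_outer_ge:
  assumes "arc_separates \<Omega> a b" "norm (b - a) = 3 ^ n * e" "0 < e"
  shows "4 ^ n * (pi * (e / 100)\<^sup>2) \<le> area (seg_cell a b \<inter> {x \<in> \<Omega>. ennreal (exp (- 8) / 20000) \<le> outer e x})"
  using assms(1,2)
proof (induction n arbitrary: a b)
  case 0
  let ?X = "{x \<in> \<Omega>. ennreal (exp (- 8) / 20000) \<le> outer e x}"
  have n: "norm (b - a) = e" and ab: "a \<noteq> b" using 0 assms(3) by auto
  have X: "?X \<in> sets borel"
  proof -
    have "?X = \<Omega> \<inter> {x \<in> space borel. ennreal (exp (- 8) / 20000) \<le> outer e x}" by auto
    then show ?thesis by simp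
  qed
  have "pi * (e / 100)\<^sup>2 = area (ball (seg_pt a b (1/2) 0) (e / 100))" using assms(3) by (simp add: area_ball)
  also have "\<dots> \<le> area (seg_cell a b \<inter> ?X)"
  proof (rule area_mono)
    show "ball (seg_pt a b (1/2) 0) (e / 100) \<subseteq> seg_cell a b \<inter> ?X"
    proof
      fix x assume "x \<in> ball (seg_pt a b (1/2) 0) (e / 100)"
      then have x: "x \<in> seg_gate a b" using ball_in_seg_gates(1)[OF ab] n by auto
      then show "x \<in> seg_cell a b \<inter> ?X"
        using outer_ge[OF 0(1) n assms(3) x] arc_separates_gates(1)[OF 0(1)] by (auto simp: mem_seg_gate)
    qed
    show "bounded (seg_cell a b \<inter> ?X)" using bounded_seg_cell[OF ab] by (rule bounded_Int[OF disjI1])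
  qed (use X in auto)
  finally show ?case by simp
next
  case (Suc n)
  let ?X = "{x \<in> \<Omega>. ennreal (exp (- 8) / 20000) \<le> outer e x}"
  have ab: "a \<noteq> b" using Suc.prems assms(3) by auto
  have X: "?X \<in> sets borel"
  proof -
    have "?X = \<Omega> \<inter> {x \<in> space borel. ennreal (exp (- 8) / 20000) \<le> outer e x}" by auto
    then show ?thesis by simp
  qed
  have "4 ^ n * (pi * (e / 100)\<^sup>2) \<le> area (seg_cell c f \<inter> ?X)" if "(c, f) \<in> koch_children a b" for c f
    by (rule Suc.IH[OF arc_separates_children[OF Suc.prems(1) that]]) (use norm_koch_children[OF that] Suc.prems(2) in simp)
  from this[OF koch_childrenI(1)] this[OF koch_childrenI(2)] this[OF koch_childrenI(3)] this[OF koch_childrenI(4)]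
  have "4 * (4 ^ n * (pi * (e / 100)\<^sup>2)) \<le> area (seg_cell a b \<inter> ?X)"
    using area_seg_cell_children[OF ab X] by linarith
  then show ?case by simp
qed

text \<open>At scale \<open>e\<close> there are \<open>(L / e) powr koch_dim\<close> cells, which
  turns an area of order \<open>e\<^sup>2\<close> per cell into a total of order
  \<open>e powr (2 - koch_dim)\<close>.\<close>

lemma gap_ge:
  obtains \<kappa> L where "0 < \<kappa>" "0 < L" "\<And>m. ennreal (\<kappa> * (L / 3 ^ m) powr (2 - koch_dim)) \<le> gap (L / 3 ^ m)"
proof -
  define L where "L = norm (B - A)"
  have sep: "arc_separates \<Omega> A B"
    by (rule snowflake_arc_separates[OF triangle open_domain bounded_domain frontier_domain])
  then have L: "0 < L" by (auto simp: L_def arc_separates_def arc_isolated_def)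
  define \<kappa> where "\<kappa> = exp (- 8) / 20000 * (pi / 10000 * L powr koch_dim)"
  have "ennreal (\<kappa> * (L / 3 ^ m) powr (2 - koch_dim)) \<le> gap (L / 3 ^ m)" for m
  proof -
    define e where "e = L / 3 ^ m"
    have e: "0 < e" "L = 3 ^ m * e" using L by (auto simp: e_def)
    let ?X = "{x \<in> \<Omega>. ennreal (exp (- 8) / 20000) \<le> outer e x}"
    have X: "?X \<in> sets borel"
    proof -
      have "?X = \<Omega> \<inter> {x \<in> space borel. ennreal (exp (- 8) / 20000) \<le> outer e x}" by auto
      then show ?thesis by simp
    qed
    have "(3 ^ m) powr koch_dim = (L / e) powr koch_dim" using e by simp
    then have "4 ^ m * (pi * (e / 100)\<^sup>2) = pi / 10000 * L powr koch_dim * e powr (2 - koch_dim)"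
      unfolding powr_koch_dim using e L by (simp add: powr_divide powr_diff power_divide powr_mult)
    then have "\<kappa> * e powr (2 - koch_dim) = exp (- 8) / 20000 * (4 ^ m * (pi * (e / 100)\<^sup>2))"
      by (simp add: \<kappa>_def)
    also have "ennreal \<dots> \<le> ennreal (exp (- 8) / 20000 * area (seg_cell A B \<inter> ?X))"
      using area_outer_ge[OF sep _ e(1), of m] e(2) by (intro ennreal_leI mult_left_mono) (auto simp: L_def)
    also have "\<dots> = ennreal (exp (- 8) / 20000) * emeasure lborel (seg_cell A B \<inter> ?X)"
    proof -
      have "bounded (seg_cell A B \<inter> ?X)" by (rule bounded_subset[OF bounded_domain]) auto
      then have "emeasure lborel (seg_cell A B \<inter> ?X) = ennreal (area (seg_cell A B \<inter> ?X))"
        by (rule emeasure_lborel_eq_area)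
      then show ?thesis by (simp only: ennreal_mult measure_nonneg divide_nonneg_nonneg exp_ge_zero zero_le_numeral)
    qed
    also have "\<dots> = (\<integral>\<^sup>+x. ennreal (exp (- 8) / 20000) * indicator (seg_cell A B \<inter> ?X) x \<partial>lborel)"
      using X by (subst nn_integral_cmult_indicator) auto
    also have "\<dots> \<le> gap e"
      unfolding gap_def by (intro nn_integral_mono) (auto simp: indicator_def)
    finally show ?thesis by (simp add: e_def)
  qed
  moreover have "0 < \<kappa>" using L by (simp add: \<kappa>_def)
  ultimately show thesis using L that by blast
qed

text \<open>The neighbourhoods of the curve have area tending to 0. The decay of the pieces gives
  pointwise convergence only off the curve.\<close>

lemma curve_null: "AE x in lborel. 0 < curve_dist x"
proof (rule AE_I)
  obtain c where c: "0 < c" 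
    "\<And>r. 0 < r \<Longrightarrow> emeasure lborel {x. curve_dist x < r} \<le> ennreal (c * r powr (2 - koch_dim) * (1 + r) powr koch_dim)"
    by (rule curve_integrals) (rule that; assumption)
  define b :: real where "b = (1/2) powr (2 - koch_dim)"
  have b: "0 < b" "b < 1"
    using koch_dim_bounds gr_one_powr[of 2 "2 - koch_dim"] by (auto simp: b_def powr_divide)
  have "emeasure lborel {x. curve_dist x \<le> 0} \<le> ennreal (4 * c * b ^ n)" for n
  proof -
    have "emeasure lborel {x. curve_dist x \<le> 0} \<le> emeasure lborel {x. curve_dist x < (1/2) ^ n}"
      by (intro emeasure_mono) (auto intro: le_less_trans)
    also have "\<dots> \<le> ennreal (c * ((1/2) ^ n) powr (2 - koch_dim) * (1 + (1/2) ^ n) powr koch_dim)"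
      by (rule c(2)) simp
    also have "\<dots> \<le> ennreal (4 * c * b ^ n)"
    proof (rule ennreal_leI)
      have 1: "((1/2) ^ n) powr (2 - koch_dim) = b ^ n"
        by (simp add: b_def powr_realpow[symmetric] powr_powr mult.commute)
      have "(1 + (1/2) ^ n) powr koch_dim \<le> 2 powr koch_dim"
        using koch_dim_bounds power_le_one[of "1/2::real" n] by (intro powr_mono2) auto
      also have "\<dots> \<le> 2 powr 2" using koch_dim_bounds by (intro powr_mono) auto
      finally have "c * b ^ n * (1 + (1/2) ^ n) powr koch_dim \<le> c * b ^ n * 4"
        using c(1) b by (intro mult_left_mono) auto
      then show "c * ((1/2) ^ n) powr (2 - koch_dim) * (1 + (1/2) ^ n) powr koch_dim \<le> 4 * c * b ^ n"
        unfolding 1 by simp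
    qed
    finally show ?thesis .
  qed
  moreover have "(\<lambda>n. ennreal (4 * c * b ^ n)) \<longlonglongrightarrow> ennreal (4 * c * 0)"
    using b by (intro tendsto_ennrealI tendsto_mult tendsto_const LIMSEQ_power_zero) auto
  ultimately have "emeasure lborel {x. curve_dist x \<le> 0} \<le> ennreal (4 * c * 0)"
    by (intro LIMSEQ_le_const[where a = "emeasure lborel {x. curve_dist x \<le> 0}"]) auto
  then show "emeasure lborel {x. curve_dist x \<le> 0} = 0" by simp
  show "{x. curve_dist x \<le> 0} \<in> sets lborel" by simp
qed auto

text \<open>The \<open>q = \<infinity>\<close> norm of critical smoothness dominates all pieces at once, so that dominated
  convergence makes them small.\<close>

lemma pieces_tendsto_zero:
  assumes p: "1 \<le> p" and q: "1 \<le> q" and s: "(2 - koch_dim) / p \<le> s"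
    and mem: "regular_distribution (indicator \<Omega>) \<in> triebel_lizorkin_type_space \<phi>\<^sub>0 \<phi> s \<tau> (ennreal p) q"
  shows "(\<lambda>j. \<integral>\<^sup>+x\<in>{x. curve_dist x < 1}. ennreal ((2 powr (real j * ((2 - koch_dim) / p)) * norm (piece j x)) powr p) \<partial>lborel) \<longlonglongrightarrow> 0"
proof -
  define s0 where "s0 = (2 - koch_dim) / p"
  have s0: "0 < s0" "s0 < 1" using p koch_dim_bounds by (auto simp: s0_def field_simps)
  define h where "h j x = (2 powr (real j * s0) * norm (piece j x)) powr p" for j x
  have [measurable]: "h j \<in> borel_measurable borel" for j unfolding h_def by measurable
  define l where "l x = lq_norm_from q 0 (\<lambda>j. ennreal (2 powr (real j * s)) * ennreal (norm (piece j x)))" for x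
  have hl: "ennreal (h j x) \<le> epowr (l x) p" for j x
  proof -
    have "ennreal (2 powr (real j * s0) * norm (piece j x)) \<le> ennreal (2 powr (real j * s) * norm (piece j x))"
      using s by (intro ennreal_leI mult_right_mono powr_mono mult_left_mono) (auto simp: s0_def)
    also have "\<dots> = ennreal (2 powr (real j * s)) * ennreal (norm (piece j x))" by (rule ennreal_mult) auto
    also have "\<dots> \<le> l x" unfolding l_def by (rule le_lq_norm_from[OF q, of 0 j]) simp
    finally have "epowr (ennreal (2 powr (real j * s0) * norm (piece j x))) p \<le> epowr (l x) p"
      using p by (intro epowr_mono) auto
    then show ?thesis by (simp add: epowr_ennreal h_def)
  qed
  \<comment> \<open>One majorant for all levels; it is at most \<open>epowr (l x) p\<close>, whose
    integral over each unit cube is finite by membership.\<close>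
  define G where "G x = (SUP j. ennreal (h j x))" for x
  have [measurable]: "G \<in> borel_measurable borel" unfolding G_def by measurable
  have Gl: "G x \<le> epowr (l x) p" for x unfolding G_def by (rule SUP_least) (rule hl)
  have cube: "(\<integral>\<^sup>+x\<in>dyadic_cube 0 k. G x \<partial>lborel) < \<infinity>" for k :: "int^2"
  proof -
    have "ennreal (1 / measure lborel (dyadic_cube 0 k) powr \<tau>) * Lp_norm_on (ennreal p) (dyadic_cube 0 k) (\<lambda>x.
          lq_norm_from q (nat 0) (\<lambda>j. ennreal (2 powr (real j * s)) * ennreal (norm (piece j x))))
      \<le> triebel_lizorkin_type_norm \<phi>\<^sub>0 \<phi> s \<tau> (ennreal p) q (regular_distribution (indicator \<Omega>))"
      unfolding triebel_lizorkin_type_norm_def piece_def[symmetric] by (rule SUP_upper2[of "(0, k)"]) auto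
    also have "\<dots> < \<infinity>" using mem by (simp add: triebel_lizorkin_type_space_def)
    finally have "Lp_norm_on (ennreal p) (dyadic_cube 0 k) l < \<infinity>"
      by (simp add: measure_dyadic_cube l_def[abs_def])
    then have "(\<integral>\<^sup>+x\<in>dyadic_cube 0 k. epowr (l x) p \<partial>lborel) < \<infinity>"
      using p by (auto simp: Lp_norm_on_ennreal epowr_def less_top[symmetric] split: if_splits)
    moreover have "(\<integral>\<^sup>+x\<in>dyadic_cube 0 k. G x \<partial>lborel) \<le> (\<integral>\<^sup>+x\<in>dyadic_cube 0 k. epowr (l x) p \<partial>lborel)"
      by (intro nn_integral_mono mult_right_mono Gl) auto
    ultimately show ?thesis by (rule order_le_less_trans[rotated])
  qed
  let ?K = "{x. curve_dist x < 1}"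
  have [measurable]: "?K \<in> sets borel" by measurable
  \<comment> \<open>\<open>?K\<close> is bounded and therefore covered by finitely many unit cubes,
    on which the normalising factor is 1.\<close>
  obtain R where R: "\<And>x. x \<in> ?K \<Longrightarrow> norm x \<le> R"
  proof -
    obtain r where r: "\<And>y. y \<in> frontier \<Omega> \<Longrightarrow> norm y \<le> r"
      using bounded_subset[OF bounded_closure[OF bounded_domain], of "frontier \<Omega>"]
      unfolding bounded_iff frontier_def by blast
    have "norm x \<le> r + 1" if "x \<in> ?K" for x
    proof -
      obtain y where "y \<in> frontier \<Omega>" "curve_dist x = dist x y"
        using infdist_attains_inf[OF frontier_closed frontier_nonempty, of x] by blast
      then show ?thesis using r[of y] that norm_triangle_ineq[of y "x - y"] by (simp add: dist_norm)
    qed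
    then show thesis using that by blast
  qed
  obtain F :: "(int^2) set" where F: "finite F" "\<And>x. norm x \<le> R \<Longrightarrow> x \<in> (\<Union>k\<in>F. dyadic_cube 0 k)"
    by (rule dyadic_cube_unit_cover[of R]) (rule that; assumption)
  have "(\<integral>\<^sup>+x\<in>?K. G x \<partial>lborel) \<le> (\<integral>\<^sup>+x. (\<Sum>k\<in>F. G x * indicator (dyadic_cube 0 k) x) \<partial>lborel)"
  proof (rule nn_integral_mono)
    fix x
    show "G x * indicator ?K x \<le> (\<Sum>k\<in>F. G x * indicator (dyadic_cube 0 k) x)"
    proof (cases "x \<in> ?K")
      case True
      then obtain k where k: "k \<in> F" "x \<in> dyadic_cube 0 k" using F(2)[OF R[OF True]] by blast
      have "G x * indicator (dyadic_cube 0 k) x \<le> (\<Sum>k\<in>F. G x * indicator (dyadic_cube 0 k) x)"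
        by (rule member_le_sum) (use k F in auto)
      then show ?thesis using k True by simp
    qed simp
  qed
  also have "\<dots> = (\<Sum>k\<in>F. \<integral>\<^sup>+x\<in>dyadic_cube 0 k. G x \<partial>lborel)"
    by (rule nn_integral_sum) measurable
  also have "\<dots> < \<infinity>" using F(1) by (induction F rule: finite_induct) (use cube in auto)
  finally have fin: "(\<integral>\<^sup>+x\<in>?K. G x \<partial>lborel) < \<infinity>" .
  obtain c where c: "0 < c" "\<And>j x. 0 < j \<Longrightarrow> norm (piece j x) \<le> c * (1 / (1 + 2 ^ j * curve_dist x)) ^ 1"
    by (rule piece_decay[of 1]) (rule that; assumption)
  define b :: real where "b = 2 powr ((s0 - 1) * p)"
  have b: "0 < b" "b < 1"
    using s0 p powr_less_mono[of "(s0 - 1) * p" 0 2] by (auto simp: b_def mult_neg_pos)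
  \<comment> \<open>Off the curve one power of decay already yields \<open>1 / 2 ^ j\<close>, which
    beats the weight because \<open>s0 < 1\<close>.\<close>
  have lim: "(\<lambda>j. h j x) \<longlonglongrightarrow> 0" if x: "0 < curve_dist x" for x
  proof (rule tendsto_sandwich[of "\<lambda>j. 0" _ _ "\<lambda>j. (c / curve_dist x) powr p * b ^ j"])
    show "eventually (\<lambda>j. h j x \<le> (c / curve_dist x) powr p * b ^ j) sequentially"
      using eventually_gt_at_top[of 0]
    proof eventually_elim
      case (elim j)
      have "norm (piece j x) \<le> c * (1 / (1 + 2 ^ j * curve_dist x))" using c(2)[OF elim, of x] by simp
      also have "\<dots> \<le> c * (1 / (2 ^ j * curve_dist x))"
        using c(1) x by (intro mult_left_mono divide_left_mono) (auto intro!: mult_pos_pos add_pos_pos)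
      finally have "2 powr (real j * s0) * norm (piece j x) \<le> 2 powr (real j * s0) * (c * (1 / (2 ^ j * curve_dist x)))"
        by (rule mult_left_mono) simp
      also have "\<dots> = (c / curve_dist x) * 2 powr (real j * (s0 - 1))"
        using x by (simp add: right_diff_distrib powr_diff powr_realpow mult.commute)
      finally have "h j x \<le> ((c / curve_dist x) * 2 powr (real j * (s0 - 1))) powr p"
        unfolding h_def using p by (intro powr_mono2) auto
      also have "\<dots> = (c / curve_dist x) powr p * b ^ j"
      proof -
        have "b ^ j = 2 powr (real j * (s0 - 1) * p)"
          by (simp add: b_def powr_realpow[symmetric] powr_powr mult_ac)
        then show ?thesis by (simp only: powr_mult powr_powr)
      qed
      finally show ?case .
    qed
    have "(\<lambda>j. (c / curve_dist x) powr p * b ^ j) \<longlonglongrightarrow> (c / curve_dist x) powr p * 0"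
      using b by (intro tendsto_mult tendsto_const LIMSEQ_power_zero) auto
    then show "(\<lambda>j. (c / curve_dist x) powr p * b ^ j) \<longlonglongrightarrow> 0" by simp
  qed (auto simp: h_def)
  have "(\<lambda>j. \<integral>\<^sup>+x. ennreal (h j x) * indicator ?K x \<partial>lborel) \<longlonglongrightarrow> (\<integral>\<^sup>+(x::real^2). 0 \<partial>lborel)"
  proof (rule nn_integral_dominated_convergence[where w = "\<lambda>x. G x * indicator ?K x"])
    show "(\<integral>\<^sup>+x\<in>?K. G x \<partial>lborel) < \<infinity>" by (rule fin)
    show "AE x in lborel. ennreal (h j x) * indicator ?K x \<le> G x * indicator ?K x" for j
      unfolding G_def by (intro AE_I2 mult_right_mono SUP_upper) auto
    show "AE x in lborel. (\<lambda>j. ennreal (h j x) * indicator ?K x) \<longlonglongrightarrow> 0"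
      using curve_null
    proof eventually_elim
      case (elim x)
      have "(\<lambda>j. ennreal (h j x)) \<longlonglongrightarrow> ennreal 0" by (intro tendsto_ennrealI lim elim)
      then show ?case by (cases "x \<in> ?K") auto
    qed
  qed measurable
  then show ?thesis by (simp add: h_def s0_def)
qed

text \<open>Turns small \<open>p\<close>-th powers near the curve into small energies, for any
  \<open>p\<close>. Values up to \<eta> are charged to the first power; larger values
  \<open>u\<close> are bounded and satisfy \<open>1 \<le> (u / \<eta>) powr p\<close>; away from the
  curve the decay gains a factor \<open>(1/4) ^ j\<close>.\<close>

lemma pieces_L2_small:
  assumes p: "1 \<le> p" and q: "1 \<le> q" and s: "(2 - koch_dim) / p \<le> s"
    and mem: "regular_distribution (indicator \<Omega>) \<in> triebel_lizorkin_type_space \<phi>\<^sub>0 \<phi> s \<tau> (ennreal p) q"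
    and \<epsilon>: "0 < \<epsilon>"
  shows "\<exists>J. \<forall>j\<ge>J. (\<integral>\<^sup>+x. ennreal ((norm (piece j x))\<^sup>2) \<partial>lborel) \<le> ennreal (\<epsilon> * (1 / 2 ^ j) powr (2 - koch_dim))"
proof -
  obtain c0 where c0: "0 < c0" "\<And>j x. norm (piece j x) \<le> c0"
    by (rule piece_bounded) (rule that; assumption)
  obtain c1 where c1: "0 < c1"
    "\<And>j. (\<integral>\<^sup>+x. ennreal (norm (piece j x)) \<partial>lborel) \<le> ennreal (c1 * (1 / 2 ^ j) powr (2 - koch_dim))"
    by (rule piece_L1) (rule that; assumption)
  obtain c2 where c2: "0 < c2"
    "\<And>j. (\<integral>\<^sup>+x. ennreal ((1 / (1 + 2 ^ j * curve_dist x)) ^ 4) \<partial>lborel) \<le> ennreal (c2 * (1 / 2 ^ j) powr (2 - koch_dim))"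
    by (rule curve_integrals) (rule that; assumption)
  obtain c6 where c6: "0 < c6" "\<And>j x. 0 < j \<Longrightarrow> norm (piece j x) \<le> c6 * (1 / (1 + 2 ^ j * curve_dist x)) ^ 6"
    by (rule piece_decay[of 6]) (rule that; assumption)
  \<comment> \<open>Gives the first of three contributions a third of \<epsilon>; the other two
    become as small for large \<open>j\<close>.\<close>
  define \<eta> where "\<eta> = \<epsilon> / (3 * c1)"
  have \<eta>: "0 < \<eta>" using \<epsilon> c1(1) by (simp add: \<eta>_def)
  define M where "M = c0\<^sup>2 / \<eta> powr p"
  have M: "0 < M" using c0(1) \<eta> by (simp add: M_def)
  define bb where "bb j = (1 / 2 ^ j :: real) powr (2 - koch_dim)" for j :: nat
  have bb: "0 < bb j" for j by (simp add: bb_def)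
  let ?K = "{x. curve_dist x < 1}"
  define h where "h j x = (2 powr (real j * ((2 - koch_dim) / p)) * norm (piece j x)) powr p" for j x
  have [measurable]: "h j \<in> borel_measurable borel" for j unfolding h_def by measurable
  have hb: "norm (piece j x) powr p = bb j * h j x" for j x
  proof -
    have "h j x = 2 powr (real j * (2 - koch_dim)) * norm (piece j x) powr p"
      using p by (simp add: h_def powr_mult powr_powr)
    moreover have "bb j * 2 powr (real j * (2 - koch_dim)) = 1"
    proof -
      have "bb j = 1 / 2 powr (real j * (2 - koch_dim))"
        by (simp add: bb_def powr_divide powr_realpow[symmetric] powr_powr)
      then show ?thesis by simp
    qed
    ultimately show ?thesis by (simp flip: mult.assoc)
  qed
  have pt: "ennreal ((norm (piece j x))\<^sup>2) \<le> ennreal \<eta> * ennreal (norm (piece j x))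
      + (ennreal (M * bb j) * (ennreal (h j x) * indicator ?K x)
      + ennreal (c0 * c6 * (1/4) ^ j) * ennreal ((1 / (1 + 2 ^ j * curve_dist x)) ^ 4))" if j: "0 < j" for j x
  proof -
    define u where "u = norm (piece j x)"
    have u: "0 \<le> u" "u \<le> c0" using c0(2) by (auto simp: u_def)
    show ?thesis
    proof (cases "x \<in> ?K")
      case True
      have "u\<^sup>2 \<le> \<eta> * u + M * u powr p"
      proof (cases "u \<le> \<eta>")
        case True
        then have "u * u \<le> \<eta> * u" using u by (intro mult_right_mono)
        moreover have "0 \<le> M * u powr p" using M by simp
        ultimately show ?thesis unfolding power2_eq_square by argo
      next
        case False
        then have "\<eta> powr p \<le> u powr p" using \<eta> p by (intro powr_mono2) auto
        then have "c0\<^sup>2 * 1 \<le> c0\<^sup>2 * (u powr p / \<eta> powr p)" using \<eta> by (intro mult_left_mono) auto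
        moreover have "u\<^sup>2 \<le> c0\<^sup>2" using u by (intro power_mono) auto
        moreover have "0 \<le> \<eta> * u" using \<eta> u by simp
        ultimately show ?thesis by (simp add: M_def)
      qed
      then have "ennreal (u\<^sup>2) \<le> ennreal (\<eta> * u + M * (bb j * h j x))"
        unfolding hb[symmetric] u_def[symmetric] by (rule ennreal_leI)
      also have "\<dots> = ennreal (\<eta> * u) + ennreal (M * bb j * h j x)"
        using \<eta> u M bb[of j] by (subst ennreal_plus) (auto simp: h_def mult.assoc intro!: mult_nonneg_nonneg less_imp_le)
      also have "\<dots> = ennreal \<eta> * ennreal u + ennreal (M * bb j) * (ennreal (h j x) * indicator ?K x)"
        using True \<eta> u M bb[of j] by (simp add: ennreal_mult h_def)
      also have "\<dots> \<le> ennreal \<eta> * ennreal u + (ennreal (M * bb j) * (ennreal (h j x) * indicator ?K x)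
          + ennreal (c0 * c6 * (1/4) ^ j) * ennreal ((1 / (1 + 2 ^ j * curve_dist x)) ^ 4))"
        by (intro add_left_mono) simp
      finally show ?thesis by (simp add: u_def)
    next
      case False
      define t where "t = 1 / (1 + 2 ^ j * curve_dist x)"
      have d: "1 \<le> curve_dist x" using False by simp
      have t0: "0 \<le> t" unfolding t_def using d by simp
      have "2 ^ j * 1 \<le> 2 ^ j * curve_dist x" using d by (intro mult_left_mono) auto
      then have "2 ^ j \<le> 1 + 2 ^ j * curve_dist x" unfolding mult_1_right by argo
      then have "t \<le> 1 / 2 ^ j"
        unfolding t_def by (intro divide_left_mono) (auto intro!: mult_pos_pos add_pos_nonneg mult_nonneg_nonneg infdist_nonneg)
      then have t2: "t\<^sup>2 \<le> (1 / 2 ^ j)\<^sup>2" using t0 by (intro power_mono)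
      have "u\<^sup>2 \<le> c0 * u" unfolding power2_eq_square using u by (intro mult_right_mono)
      also have "\<dots> \<le> c0 * (c6 * t ^ 6)"
        using c6(2)[OF j, of x] c0(1) unfolding t_def u_def by (intro mult_left_mono) auto
      \<comment> \<open>Two of the six powers produce \<open>(1/4) ^ j\<close>, the other four are
        integrated by \<open>curve_integrals\<close>.\<close>
      also have "\<dots> = c0 * c6 * t\<^sup>2 * t ^ 4" by (simp add: power_numeral_reduce)
      also have "\<dots> \<le> c0 * c6 * (1 / 2 ^ j)\<^sup>2 * t ^ 4"
        using t0 t2 c0(1) c6(1) by (intro mult_right_mono mult_left_mono) auto
      also have "(1 / 2 ^ j :: real)\<^sup>2 = (1/4) ^ j"
        by (simp add: power_divide two_power_square)
      finally have "ennreal (u\<^sup>2) \<le> ennreal (c0 * c6 * (1/4) ^ j * t ^ 4)" by (rule ennreal_leI)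
      also have "\<dots> = ennreal (c0 * c6 * (1/4) ^ j) * ennreal (t ^ 4)"
        using c0(1) c6(1) t0 by (intro ennreal_mult) auto
      finally show ?thesis unfolding u_def t_def by (simp add: add_increasing)
    qed
  qed
  have int: "(\<integral>\<^sup>+x. ennreal ((norm (piece j x))\<^sup>2) \<partial>lborel) \<le> ennreal (\<eta> * (c1 * bb j))
      + (ennreal (M * bb j) * (\<integral>\<^sup>+x\<in>?K. ennreal (h j x) \<partial>lborel) + ennreal (c0 * c6 * (1/4) ^ j * (c2 * bb j)))" if j: "0 < j" for j
  proof -
    let ?g1 = "\<lambda>x. ennreal (norm (piece j x))" and ?g2 = "\<lambda>x. ennreal (h j x) * indicator ?K x"
      and ?g3 = "\<lambda>x. ennreal ((1 / (1 + 2 ^ j * curve_dist x)) ^ 4)"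
    have [measurable]: "?g1 \<in> borel_measurable borel" "?g2 \<in> borel_measurable borel" "?g3 \<in> borel_measurable borel"
      by measurable
    have "(\<integral>\<^sup>+x. ennreal ((norm (piece j x))\<^sup>2) \<partial>lborel)
      \<le> (\<integral>\<^sup>+x. ennreal \<eta> * ?g1 x + (ennreal (M * bb j) * ?g2 x + ennreal (c0 * c6 * (1/4) ^ j) * ?g3 x) \<partial>lborel)"
      by (intro nn_integral_mono pt j)
    also have "\<dots> = (\<integral>\<^sup>+x. ennreal \<eta> * ?g1 x \<partial>lborel) + (\<integral>\<^sup>+x. ennreal (M * bb j) * ?g2 x + ennreal (c0 * c6 * (1/4) ^ j) * ?g3 x \<partial>lborel)"
      by (rule nn_integral_add) measurable
    also have "(\<integral>\<^sup>+x. ennreal (M * bb j) * ?g2 x + ennreal (c0 * c6 * (1/4) ^ j) * ?g3 x \<partial>lborel)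
        = (\<integral>\<^sup>+x. ennreal (M * bb j) * ?g2 x \<partial>lborel) + (\<integral>\<^sup>+x. ennreal (c0 * c6 * (1/4) ^ j) * ?g3 x \<partial>lborel)"
      by (rule nn_integral_add) measurable
    also have "(\<integral>\<^sup>+x. ennreal \<eta> * ?g1 x \<partial>lborel) = ennreal \<eta> * (\<integral>\<^sup>+x. ?g1 x \<partial>lborel)"
      by (rule nn_integral_cmult) measurable
    also have "(\<integral>\<^sup>+x. ennreal (M * bb j) * ?g2 x \<partial>lborel) = ennreal (M * bb j) * (\<integral>\<^sup>+x. ?g2 x \<partial>lborel)"
      by (rule nn_integral_cmult) measurable
    also have "(\<integral>\<^sup>+x. ennreal (c0 * c6 * (1/4) ^ j) * ?g3 x \<partial>lborel) = ennreal (c0 * c6 * (1/4) ^ j) * (\<integral>\<^sup>+x. ?g3 x \<partial>lborel)"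
      by (rule nn_integral_cmult) measurable
    also have "ennreal \<eta> * (\<integral>\<^sup>+x. ?g1 x \<partial>lborel) + (ennreal (M * bb j) * (\<integral>\<^sup>+x. ?g2 x \<partial>lborel) + ennreal (c0 * c6 * (1/4) ^ j) * (\<integral>\<^sup>+x. ?g3 x \<partial>lborel))
        \<le> ennreal \<eta> * ennreal (c1 * bb j) + (ennreal (M * bb j) * (\<integral>\<^sup>+x. ?g2 x \<partial>lborel) + ennreal (c0 * c6 * (1/4) ^ j) * ennreal (c2 * bb j))"
      unfolding bb_def by (intro add_mono mult_left_mono c1(2) c2(2) order_refl) auto
    also have "ennreal \<eta> * ennreal (c1 * bb j) = ennreal (\<eta> * (c1 * bb j))"
      using \<eta> c1(1) bb[of j] by (intro ennreal_mult[symmetric]) auto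
    also have "ennreal (c0 * c6 * (1/4) ^ j) * ennreal (c2 * bb j) = ennreal (c0 * c6 * (1/4) ^ j * (c2 * bb j))"
      using c0(1) c6(1) c2(1) bb[of j] by (intro ennreal_mult[symmetric]) auto
    finally show ?thesis .
  qed
  have "(\<lambda>j. \<integral>\<^sup>+x\<in>?K. ennreal (h j x) \<partial>lborel) \<longlonglongrightarrow> 0"
    using pieces_tendsto_zero[OF p q s mem] unfolding h_def .
  then have "eventually (\<lambda>j. (\<integral>\<^sup>+x\<in>?K. ennreal (h j x) \<partial>lborel) < ennreal (\<epsilon> / (3 * M))) sequentially"
    using \<epsilon> M by (intro order_tendstoD(2)) auto
  moreover have "(\<lambda>j. c0 * c6 * (1/4) ^ j * c2) \<longlonglongrightarrow> c0 * c6 * 0 * c2"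
    by (intro tendsto_mult tendsto_const LIMSEQ_power_zero) auto
  then have "eventually (\<lambda>j. c0 * c6 * (1/4) ^ j * c2 < \<epsilon> / 3) sequentially"
    using \<epsilon> by (intro order_tendstoD(2)) auto
  ultimately have "eventually (\<lambda>j. (\<integral>\<^sup>+x. ennreal ((norm (piece j x))\<^sup>2) \<partial>lborel) \<le> ennreal (\<epsilon> * bb j)) sequentially"
    using eventually_gt_at_top[of 0]
  proof eventually_elim
    case (elim j)
    have "ennreal (M * bb j) * (\<integral>\<^sup>+x\<in>?K. ennreal (h j x) \<partial>lborel) \<le> ennreal (M * bb j) * ennreal (\<epsilon> / (3 * M))"
      by (rule mult_left_mono[OF less_imp_le[OF elim(1)]]) simp
    also have "\<dots> = ennreal (M * bb j * (\<epsilon> / (3 * M)))"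
      using M bb[of j] \<epsilon> by (intro ennreal_mult[symmetric]) auto
    also have "M * bb j * (\<epsilon> / (3 * M)) = \<epsilon> / 3 * bb j" using M by simp
    finally have 2: "ennreal (M * bb j) * (\<integral>\<^sup>+x\<in>?K. ennreal (h j x) \<partial>lborel) \<le> ennreal (\<epsilon> / 3 * bb j)" .
    have "c0 * c6 * (1/4) ^ j * c2 * bb j \<le> \<epsilon> / 3 * bb j"
      using elim(2) bb[of j] by (intro mult_right_mono) auto
    then have 3: "ennreal (c0 * c6 * (1/4) ^ j * (c2 * bb j)) \<le> ennreal (\<epsilon> / 3 * bb j)"
      by (intro ennreal_leI) (simp only: mult.assoc)
    have 1: "\<eta> * (c1 * bb j) = \<epsilon> / 3 * bb j" using c1(1) by (simp add: \<eta>_def)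
    have "(\<integral>\<^sup>+x. ennreal ((norm (piece j x))\<^sup>2) \<partial>lborel)
      \<le> ennreal (\<epsilon> / 3 * bb j) + (ennreal (\<epsilon> / 3 * bb j) + ennreal (\<epsilon> / 3 * bb j))"
      using int[OF elim(3)] 2 3 unfolding 1 by (meson add_mono order_refl order_trans)
    also have "\<dots> = ennreal (\<epsilon> / 3 * bb j + (\<epsilon> / 3 * bb j + \<epsilon> / 3 * bb j))"
      using \<epsilon> bb[of j] by (simp only: ennreal_plus[symmetric] mult_nonneg_nonneg add_nonneg_nonneg less_imp_le divide_nonneg_nonneg zero_le_numeral)
    also have "\<epsilon> / 3 * bb j + (\<epsilon> / 3 * bb j + \<epsilon> / 3 * bb j) = \<epsilon> * bb j" by simp
    finally show ?case .
  qed
  then show ?thesis unfolding eventually_sequentially bb_def .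
qed

text \<open>At a scale of order \<open>(1/2) ^ i\<close> the late levels allow a leak of a small
  multiple of \<open>b ^ i\<close> and the early ones of order \<open>(1/4) ^ i\<close>, which is
  negligible against \<open>b ^ i\<close> since \<open>1/2 \<le> b\<close>. For small scales this
  contradicts \<open>gap_ge\<close>.\<close>

lemma indicator_not_in_triebel_lizorkin:
  assumes p: "1 \<le> p" and q: "1 \<le> q" and s: "(2 - koch_dim) / p \<le> s"
  shows "regular_distribution (indicator \<Omega>) \<notin> triebel_lizorkin_type_space \<phi>\<^sub>0 \<phi> s \<tau> (ennreal p) q"
proof
  assume mem: "regular_distribution (indicator \<Omega>) \<in> triebel_lizorkin_type_space \<phi>\<^sub>0 \<phi> s \<tau> (ennreal p) q"
  define a where "a j = (\<integral>\<^sup>+x. ennreal ((norm (piece j x))\<^sup>2) \<partial>lborel)" for j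
  define b :: real where "b = (1/2) powr (2 - koch_dim)"
  have b1: "b < 1" using koch_dim_bounds gr_one_powr[of 2 "2 - koch_dim"] by (auto simp: b_def powr_divide)
  have "(1/2::real) powr 1 \<le> b" unfolding b_def using koch_dim_bounds by (intro powr_mono') auto
  then have b2: "1/2 \<le> b" by simp
  have bj: "(1 / 2 ^ j) powr (2 - koch_dim) = b ^ j" for j
  proof -
    have "(1 / 2 ^ j) powr (2 - koch_dim) = ((1/2) ^ j) powr (2 - koch_dim)" by (simp add: power_divide)
    then show ?thesis by (simp add: b_def powr_realpow[symmetric] powr_powr mult.commute)
  qed
  obtain c0 where c0: "0 < c0" "\<And>j x. norm (piece j x) \<le> c0"
    by (rule piece_bounded) (rule that; assumption)
  obtain c1 where c1: "0 < c1"
    "\<And>j. (\<integral>\<^sup>+x. ennreal (norm (piece j x)) \<partial>lborel) \<le> ennreal (c1 * (1 / 2 ^ j) powr (2 - koch_dim))"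
    by (rule piece_L1) (rule that; assumption)
  define C where "C = c0 * c1"
  have C: "0 < C" using c0 c1 by (simp add: C_def)
  have aC: "a j \<le> ennreal C" for j
  proof -
    have "a j \<le> (\<integral>\<^sup>+x. ennreal c0 * ennreal (norm (piece j x)) \<partial>lborel)"
      unfolding a_def
    proof (rule nn_integral_mono)
      fix x
      have "(norm (piece j x))\<^sup>2 \<le> c0 * norm (piece j x)"
        unfolding power2_eq_square by (intro mult_right_mono c0) auto
      then show "ennreal ((norm (piece j x))\<^sup>2) \<le> ennreal c0 * ennreal (norm (piece j x))"
        using c0(1) by (simp add: ennreal_leI ennreal_mult[symmetric])
    qed
    also have "\<dots> = ennreal c0 * (\<integral>\<^sup>+x. ennreal (norm (piece j x)) \<partial>lborel)"
      by (rule nn_integral_cmult) measurable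
    also have "\<dots> \<le> ennreal c0 * ennreal (c1 * b ^ j)"
      using c1(2)[of j] unfolding bj by (intro mult_left_mono) auto
    also have "\<dots> = ennreal (c0 * (c1 * b ^ j))" using c0(1) c1(1) b2 by (intro ennreal_mult[symmetric]) auto
    also have "\<dots> \<le> ennreal C"
    proof (rule ennreal_leI)
      have "c0 * c1 * b ^ j \<le> c0 * c1 * 1" using c0(1) c1(1) b1 b2 by (intro mult_left_mono power_le_one) auto
      then show "c0 * (c1 * b ^ j) \<le> C" by (simp add: C_def mult.assoc)
    qed
    finally show ?thesis .
  qed
  obtain c3 where c3: "0 < c3"
    "\<And>e. 0 < e \<Longrightarrow> gap e \<le> (\<Sum>j. ennreal (c3 * min 1 (4 ^ j * e\<^sup>2)) * (\<integral>\<^sup>+x. ennreal ((norm (piece j x))\<^sup>2) \<partial>lborel))"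
    by (rule gap_le) (rule that; assumption)
  note c3 = c3[folded a_def]
  obtain \<kappa> L where \<kappa>: "0 < \<kappa>" "0 < L" "\<And>m. ennreal (\<kappa> * (L / 3 ^ m) powr (2 - koch_dim)) \<le> gap (L / 3 ^ m)"
    by (rule gap_ge) (rule that; assumption)
  define D where "D = 1 / (1 - b) + 1"
  have D: "1 \<le> D" using b1 by (simp add: D_def)
  \<comment> \<open>Chosen so that \<open>c3 * \<epsilon> * D = \<kappa> * b / 2\<close>, half of
    what the lower bound still provides after rounding the scale to a power of 1/2.\<close>
  define \<epsilon> where "\<epsilon> = \<kappa> * b / (2 * c3 * D)"
  have \<epsilon>: "0 < \<epsilon>" using \<kappa>(1) b2 c3(1) D by (simp add: \<epsilon>_def)
  obtain J where J: "\<And>j. J \<le> j \<Longrightarrow> a j \<le> ennreal (\<epsilon> * b ^ j)"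
    using pieces_L2_small[OF p q s mem \<epsilon>] unfolding bj a_def by blast
  \<comment> \<open>For \<open>j < J\<close> one has \<open>4 ^ j \<le> 8 ^ J * (1/2) ^ j\<close>,
    which places the finitely many early levels under a geometric series.\<close>
  define Q where "Q = c3 * C * 8 ^ J"
  have Q: "0 < Q" using c3(1) C by (simp add: Q_def)
  have upper: "gap e \<le> ennreal (c3 * \<epsilon> * (b ^ i * D) + 2 * Q * (1/4) ^ i)" if e: "0 < e" "e \<le> (1/2) ^ i" for e i
  proof -
    have e2: "e\<^sup>2 \<le> (1/4) ^ i"
    proof -
      have "e\<^sup>2 \<le> ((1/2) ^ i)\<^sup>2" using e by (intro power_mono) auto
      then show ?thesis by (simp add: power_divide two_power_square)
    qed
    have "gap e \<le> (\<Sum>j. ennreal (c3 * min 1 (4 ^ j * e\<^sup>2)) * a j)" by (rule c3(2)[OF e(1)])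
    also have "\<dots> \<le> (\<Sum>j. ennreal (c3 * \<epsilon>) * ennreal (min 1 (4 ^ j * (1/4) ^ i) * b ^ j) + ennreal (Q * (1/4) ^ i * (1/2) ^ j))"
    proof (intro suminf_le summableI)
      fix j
      define t where "t = min 1 (4 ^ j * (1/4 :: real) ^ i)"
      have t: "0 \<le> t" by (simp add: t_def)
      have "4 ^ j * e\<^sup>2 \<le> 4 ^ j * (1/4) ^ i" using e2 by (rule mult_left_mono) simp
      then have "min 1 (4 ^ j * e\<^sup>2) \<le> t" unfolding t_def by (rule min.mono[OF order_refl])
      then have le: "ennreal (c3 * min 1 (4 ^ j * e\<^sup>2)) * a j \<le> ennreal (c3 * t) * a j"
        using c3(1) by (intro mult_right_mono ennreal_leI mult_left_mono) auto
      show "ennreal (c3 * min 1 (4 ^ j * e\<^sup>2)) * a j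
          \<le> ennreal (c3 * \<epsilon>) * ennreal (min 1 (4 ^ j * (1/4) ^ i) * b ^ j) + ennreal (Q * (1/4) ^ i * (1/2) ^ j)"
      proof (cases "J \<le> j")
        case True
        have "ennreal (c3 * t) * a j \<le> ennreal (c3 * t) * ennreal (\<epsilon> * b ^ j)"
          by (intro mult_left_mono J True) simp
        also have "\<dots> = ennreal (c3 * \<epsilon>) * ennreal (t * b ^ j)"
          using c3(1) t \<epsilon> b2 by (simp add: ennreal_mult[symmetric] mult_ac)
        finally show ?thesis using le unfolding t_def[symmetric] by (intro add_increasing2) auto
      next
        case False
        have "ennreal (c3 * t) * a j \<le> ennreal (c3 * t) * ennreal C"
          by (intro mult_left_mono aC) simp
        also have "\<dots> = ennreal (c3 * t * C)"
          using c3(1) t C by (intro ennreal_mult[symmetric]) auto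
        also have "\<dots> \<le> ennreal (Q * (1/4) ^ i * (1/2) ^ j)"
        proof (rule ennreal_leI)
          have "t \<le> 4 ^ j * (1/4) ^ i" by (simp add: t_def)
          also have "\<dots> \<le> (8 ^ J * (1/2) ^ j) * (1/4) ^ i"
          proof (rule mult_right_mono)
            have "(8::real) ^ j \<le> 8 ^ J" using False by (intro power_increasing) auto
            then have "8 ^ j * (1/2) ^ j \<le> 8 ^ J * (1/2 :: real) ^ j" by (rule mult_right_mono) simp
            then show "4 ^ j \<le> 8 ^ J * (1/2 :: real) ^ j" by (simp flip: power_mult_distrib)
          qed simp
          finally have "c3 * C * t \<le> c3 * C * ((8 ^ J * (1/2) ^ j) * (1/4) ^ i)"
            using c3(1) C by (intro mult_left_mono) auto
          then show "c3 * t * C \<le> Q * (1/4) ^ i * (1/2) ^ j" unfolding Q_def by (simp only: mult_ac)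
        qed
        finally show ?thesis using le by (intro add_increasing) auto
      qed
    qed
    also have "\<dots> = ennreal (c3 * \<epsilon>) * (\<Sum>j. ennreal (min 1 (4 ^ j * (1/4) ^ i) * b ^ j)) + (\<Sum>j. ennreal (Q * (1/4) ^ i * (1/2) ^ j))"
      by (simp add: suminf_add[symmetric] ennreal_suminf_cmult)
    also have "\<dots> \<le> ennreal (c3 * \<epsilon>) * ennreal (b ^ i * D) + ennreal (Q * (1/4) ^ i / (1 - 1/2))"
    proof (intro add_mono mult_left_mono)
      have "b ^ i * (1 / (1 - b) + 1 - (1/2) ^ i) \<le> b ^ i * D"
        unfolding D_def using b2 by (intro mult_left_mono) auto
      then show "(\<Sum>j. ennreal (min 1 (4 ^ j * (1/4) ^ i) * b ^ j)) \<le> ennreal (b ^ i * D)"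
        using suminf_min_geometric_le[OF b2 b1, of i] ennreal_leI order_trans by blast
      show "(\<Sum>j. ennreal (Q * (1/4) ^ i * (1/2) ^ j)) \<le> ennreal (Q * (1/4) ^ i / (1 - 1/2))"
        by (rule suminf_geometric_ennreal_le) (use Q in auto)
    qed simp
    also have "\<dots> = ennreal (c3 * \<epsilon> * (b ^ i * D)) + ennreal (2 * Q * (1/4) ^ i)"
      using c3(1) \<epsilon> b2 D by (subst ennreal_mult[symmetric]) (auto simp: mult_ac)
    also have "\<dots> = ennreal (c3 * \<epsilon> * (b ^ i * D) + 2 * Q * (1/4) ^ i)"
      using c3(1) \<epsilon> b2 D Q by (intro ennreal_plus[symmetric]) auto
    finally show ?thesis .
  qed
  have contra: "\<kappa> * b / 2 \<le> 4 * Q * e" if e: "0 < e" "e \<le> 1" "e = L / 3 ^ m" for e m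
  proof -
    \<comment> \<open>The lower bound lives on triadic scales, the upper one on dyadic ones;
      \<open>i\<close> is fixed by \<open>(1/2) ^ Suc i < e\<close> and
      \<open>e \<le> (1/2) ^ i\<close>.\<close>
    have "\<exists>n. (1/2) ^ Suc n < e"
    proof -
      obtain n where "(1/2) ^ n < e" using real_arch_pow_inv[of e "1/2"] e by auto
      moreover have "(1/2::real) ^ Suc n \<le> (1/2) ^ n" by simp
      ultimately show ?thesis by (meson le_less_trans)
    qed
    then obtain i where i: "(1/2) ^ Suc i < e" "\<And>n. n < i \<Longrightarrow> \<not> (1/2) ^ Suc n < e"
      using exists_least_iff[of "\<lambda>n. (1/2) ^ Suc n < e"] by auto
    have ei: "e \<le> (1/2) ^ i"
    proof (cases i)
      case 0 then show ?thesis using e by simp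
    next
      case (Suc n) then show ?thesis using i(2)[of n] by simp
    qed
    have "b ^ Suc i = ((1/2) ^ Suc i) powr (2 - koch_dim)"
      using bj[of "Suc i"] by (simp add: power_divide)
    also have "\<dots> \<le> e powr (2 - koch_dim)" using i(1) koch_dim_bounds by (intro powr_mono2) auto
    finally have "\<kappa> * b ^ Suc i \<le> \<kappa> * e powr (2 - koch_dim)" using \<kappa>(1) by (intro mult_left_mono) auto
    moreover have "ennreal (\<kappa> * e powr (2 - koch_dim)) \<le> ennreal (c3 * \<epsilon> * (b ^ i * D) + 2 * Q * (1/4) ^ i)"
      using order_trans[OF \<kappa>(3)[of m]] upper[OF e(1) ei] unfolding e(3) by blast
    then have "\<kappa> * e powr (2 - koch_dim) \<le> c3 * \<epsilon> * (b ^ i * D) + 2 * Q * (1/4) ^ i"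
      using c3(1) \<epsilon> b2 D Q by (subst (asm) ennreal_le_iff) auto
    moreover have "c3 * \<epsilon> * (b ^ i * D) = \<kappa> * b / 2 * b ^ i"
      using c3(1) D by (simp add: \<epsilon>_def)
    moreover have "2 * Q * (1/4) ^ i \<le> 2 * Q * ((1/2) ^ i * b ^ i)"
    proof (rule mult_left_mono)
      have "(1/4 :: real) ^ i = (1/2) ^ i * (1/2) ^ i" by (simp flip: power_mult_distrib)
      also have "\<dots> \<le> (1/2) ^ i * b ^ i" using b2 by (intro mult_left_mono power_mono) auto
      finally show "(1/4 :: real) ^ i \<le> (1/2) ^ i * b ^ i" .
    qed (use Q in simp)
    ultimately have "\<kappa> * b ^ Suc i \<le> \<kappa> * b / 2 * b ^ i + 2 * Q * ((1/2) ^ i * b ^ i)" by linarith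
    then have "(\<kappa> * b) * b ^ i \<le> (\<kappa> * b / 2 + 2 * Q * (1/2) ^ i) * b ^ i" by (simp add: algebra_simps)
    then have "\<kappa> * b \<le> \<kappa> * b / 2 + 2 * Q * (1/2) ^ i"
      by (rule mult_right_le_imp_le) (use b2 in simp)
    moreover have "2 * Q * (1/2) ^ i \<le> 2 * Q * (2 * e)" using i(1) Q by (intro mult_left_mono) auto
    ultimately show ?thesis by simp
  qed
  \<comment> \<open>With the 16 the right-hand side of \<open>contra\<close> falls to
    \<open>\<kappa> * b / 4\<close>, half of its left-hand side.\<close>
  define \<delta> where "\<delta> = min 1 (\<kappa> * b / (16 * Q))"
  have \<delta>: "0 < \<delta>" using \<kappa>(1) b2 Q by (simp add: \<delta>_def)
  obtain m where "L / \<delta> < 3 ^ m" using real_arch_pow[of 3 "L / \<delta>"] by auto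
  then have m: "L / 3 ^ m < \<delta>" using \<delta> by (simp add: field_simps)
  have "\<kappa> * b / 2 \<le> 4 * Q * (L / 3 ^ m)"
    by (rule contra[of _ m]) (use m \<kappa>(2) in \<open>auto simp: \<delta>_def\<close>)
  also have "\<dots> \<le> 4 * Q * (\<kappa> * b / (16 * Q))"
    using m Q by (intro mult_left_mono) (auto simp: \<delta>_def)
  also have "\<dots> = \<kappa> * b / 4" using Q by simp
  finally show False using \<kappa>(1) b2 by simp
qed

end

theorem theorem5p21:
  fixes p d :: real and \<Omega> :: "(real^2) set" and \<phi>\<^sub>0 \<phi> :: "real^2 \<Rightarrow> complex"
  assumes "admissible_pair \<phi>\<^sub>0 \<phi>"
    and "1 \<le> p"
    and "d = ln 4 / ln 3"
    and "snowflake_domain \<Omega>"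
  shows "regular_distribution (indicator \<Omega>)
           \<in> besov_type_space \<phi>\<^sub>0 \<phi> ((2 - d) / p) (d / (2 * p)) (ennreal p) \<infinity> \<and>
         (\<forall>(q::ennreal) (\<tau>::real) (s::real).
            1 \<le> q \<and> 0 < \<tau> \<and> \<tau> \<le> d / (2 * p) \<and> 0 < s \<and> s < min (1 / p) (2 * (1 / p - \<tau>)) \<longrightarrow>
            (regular_distribution (indicator \<Omega>)
               \<in> triebel_lizorkin_type_space \<phi>\<^sub>0 \<phi> s \<tau> (ennreal p) q
             \<longleftrightarrow> s < (2 - d) / p))"
proof -
  have d: "d = koch_dim" using assms(3) by (simp add: koch_dim_def)
  obtain A B C where "ccw_equilateral_triangle A B C" "open \<Omega>" "bounded \<Omega>" "frontier \<Omega> = snowflake_curve A B C"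
    using assms(4) unfolding snowflake_domain_def by blast
  then interpret snowflake_convolution \<phi>\<^sub>0 \<phi> \<Omega> A B C
    using assms(1) by unfold_locales
  show ?thesis
    unfolding d
    using indicator_in_besov[OF assms(2)] indicator_in_triebel_lizorkin[OF assms(2)]
      indicator_not_in_triebel_lizorkin[OF assms(2)]
    by (meson less_imp_le not_le)
qed

end
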